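(* Let $\ell-d\le-1$. Then, for any $\varepsilon>0$, $t_0>0$, integer $K\ge M$, and all $x\in\mathbb R^d_\varepsilon$ and $t\ge t_0\varepsilon^\ell$, the second discrete Green function satisfies $$\mathbf v^\varepsilon(x,t)=\frac{1}{\varepsilon^{d-\ell}}\,\Omega\!\left(\frac x\varepsilon\right)+\frac{1}{t^{d/\ell-1}}F_0\!\left(\frac{x}{t^{1/\ell}}\right)+\sum_{k=M}^K\frac{\varepsilon^k}{t^{(k+d)/\ell-1}}F_k\!\left(\frac{x}{t^{1/\ell}}\right)+\mathbf r^\varepsilon_{\mathbf v}(K;x,t),$$ where $$\Omega(y)=\frac{1}{(2\pi)^d}\int_{R_\pi}\frac{e^{iy\theta}}{A(\theta)}\,d\theta,$$ $$|\mathbf r^\varepsilon_{\mathbf v}(K;x,t)|\le\frac{\varepsilon^{K+1}R_{\mathbf v}(K,t_0)}{t^{(K+d+1)/\ell-1}},$$ and $R_{\mathbf v}(K,t_0)\ge0$ does not depend on $\varepsilon>0$, $x\in\mathbb R_\varepsilon^d$, and $t\ge t_0\varepsilon^\ell$.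
   Context: Differential operator. Let $d\in\mathbb N$ and let $\ell\in\mathbb N$ be even. Let $\mathcal A(\mathcal D)=\sum_{|\alpha|=\ell}b_\alpha\mathcal D^\alpha$ with $b_\alpha\in\mathbb C$, $\mathcal D_j=-i\,\partial/\partial y_j$, be a differential operator on $\mathbb R^d$ with symbol $\mathcal A(\xi)=\sum_{|\alpha|=\ell}b_\alpha\xi^\alpha$. It is strongly elliptic: there is $c>0$ with $\operatorname{Re}\mathcal A(\xi)\ge c|\xi|^\ell$ for all $\xi\in\mathbb R^d$. Difference operator. For $\varepsilon>0$ let $\mathbb R^d_\varepsilon=\varepsilon\mathbb Z^d$. For a function $u$ on $\mathbb R^d$ or on $\mathbb R^d_\varepsilon$ let $\delta_{\varepsilon,k\pm}u(y)=u(y\pm\varepsilon e_k)-u(y)$, where $e_k$ is the $k$th unit coordinate vector. Fix an integer $\hat\ell\ge\ell$ and coefficients $a_\nu\in\mathbb C$ (not depending on $\varepsilon$), $\nu=(\nu_1,\dots,\nu_{2d})$ a multi-index, and let $$\mathbf A_\varepsilon=\varepsilon^{-\ell}\sum_{\ell\le|\nu|\le\hat\ell}a_\nu\,\delta_{\varepsilon,1-}^{\nu_1}\delta_{\varepsilon,1+}^{\nu_2}\cdots\delta_{\varepsilon,d-}^{\nu_{2d-1}}\delta_{\varepsilon,d+}^{\nu_{2d}}.$$ A function on $\mathbb R^d$ is called smooth if it is continuous and bounded together with all its derivatives. Assume that $\mathbf A_\varepsilon$ is an $M$th order approximation of $\mathcal A(\mathcal D)$ for a fixed $M\in\mathbb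 N$: for every smooth $u$ there is $C(u)>0$ such that $\sup_{y\in\mathbb R^d}|\mathbf A_\varepsilon u(y)-\mathcal A(\mathcal D)u(y)|\le C(u)\varepsilon^M$ for all $\varepsilon>0$. The symbol of $\mathbf A_\varepsilon$ is $$A(\theta)=\sum_{\ell\le|\nu|\le\hat\ell}a_\nu(e^{-i\theta_1}-1)^{\nu_1}(e^{i\theta_1}-1)^{\nu_2}\cdots(e^{-i\theta_d}-1)^{\nu_{2d-1}}(e^{i\theta_d}-1)^{\nu_{2d}}.$$ Assume $\operatorname{Re}A(\theta)>0$ for all $\theta\in R_\pi\setminus\{0\}$, where $R_\lambda=[-\lambda,\lambda]^d$. Second discrete Green function. $\mathbf v^\varepsilon(x,t)$, $x\in\mathbb R^d_\varepsilon$, $t\ge0$, is the function that is rapidly decreasing in $x$ (faster than any negative power of $|x|$), $C^1$ in $t\in[0,\infty)$, and satisfies $\partial_t\mathbf v^\varepsilon+\mathbf A_\varepsilon\mathbf v^\varepsilon=\boldsymbol\delta^\varepsilon$ for $t>0$, $\mathbf v^\varepsilon(x,0)=0$, where $\boldsymbol\delta^\varepsilon(0)=\varepsilon^{-d}$ and $\boldsymbol\delta^\varepsilon(x)=0$ for $x\ne0$. It is given by $$\mathbf v^\varepsilon(x,t)=\frac1{(2\pi)^d}\int_{R_{\pi/\varepsilon}}\frac{1-e^{-t\varepsilon^{-\ell}A(\varepsilon\eta)}}{\varepsilon^{-\ell}A(\varepsilon\eta)}e^{ix\eta}\,d\eta.$$ The functions $H_k$, $F_k$. $H(y)=\frac{1}{(2\pi)^d}\int_{\mathbb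 R^d}e^{-\mathcal A(\xi)}e^{iy\xi}\,d\xi$. The polynomials $\mathcal P_{m+\ell}(\xi)$, $m\ge1$, are defined by the expansion, for each fixed $\xi\in\mathbb R^d$ as $s\to0+$ (any $K$), $e^{-s^{-\ell}A(s\xi)}=e^{-\mathcal A(\xi)}\bigl(1+\sum_{m=1}^Ks^m\mathcal P_{m+\ell}(\xi)+O(s^{K+1})\bigr)$ (one has $\mathcal P_{m+\ell}=0$ for $1\le m\le M-1$). Put $H_0=H$ and $H_k=\mathcal P_{k+\ell}(\mathcal D)H$ for $k\ge1$. For $\ell-d\le-1$, $k\ge0$, and $y=rn$ with $r=|y|>0$, $n=y/|y|$, $$F_k(y)=-\frac{\ell}{r^{d+k-\ell}}\int_0^r\rho^{d+k-\ell-1}H_k(\rho n)\,d\rho,$$ and $F_k(0)=\lim_{y\to0}F_k(y)=-\frac{\ell}{k+d-\ell}H_k(0)$. *)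

theory Defs
  imports
    "HOL-Analysis.Analysis"
    "HOL-Library.Poly_Mapping"
    "HOL-Library.Landau_Symbols"
begin

section \<open>Multi-indices, polynomials and products of operators\<close>

text \<open>
  The dimension \<open>d\<close> is \<open>CARD('d)\<close>. Multi-indices are of type \<open>nat^'d\<close>, and polynomials in \<open>d\<close>
  variables with complex coefficients are finitely supported maps from multi-indices to
  coefficients.
\<close>

definition msize :: "nat^'d::finite \<Rightarrow> nat" where
  "msize \<alpha> = (\<Sum>k\<in>UNIV. \<alpha> $ k)"

type_synonym 'd cpoly = "(nat^'d) \<Rightarrow>\<^sub>0 complex"

definition poly_eval :: "'d::finite cpoly \<Rightarrow> real^'d \<Rightarrow> complex" where
  "poly_eval p \<xi> =
     (\<Sum>\<alpha>\<in>Poly_Mapping.keys p. Poly_Mapping.lookup p \<alpha> * (\<Prod>k\<in>UNIV. complex_of_real (\<xi> $ k) ^ (\<alpha> $ k)))"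

text \<open>
  A fixed enumeration of the coordinates. It only serves to write down compositions
  \<open>T 1 \<circ> \<dots> \<circ> T d\<close>; the operators composed below commute (difference operators always, partial
  derivatives on smooth functions), so its choice does not matter.
\<close>

definition coords :: "'d::finite list" where
  "coords = (SOME ks. distinct ks \<and> set ks = UNIV)"

definition op_prod :: "('d::finite \<Rightarrow> 'f \<Rightarrow> 'f) \<Rightarrow> 'f \<Rightarrow> 'f" where
  "op_prod T = foldr (\<lambda>k S. T k \<circ> S) coords id"


section \<open>Differential operators\<close>

definition partial_deriv ::
  "'d::finite \<Rightarrow> (real^'d \<Rightarrow> complex) \<Rightarrow> real^'d \<Rightarrow> complex" where
  "partial_deriv k u y = vector_derivative (\<lambda>s. u (y + s *\<^sub>R axis k 1)) (at 0)"

definition smooth :: "(real^'d::finite \<Rightarrow> complex) \<Rightarrow> bool" where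
  "smooth u \<longleftrightarrow> (\<forall>ks. let w = foldr partial_deriv ks u in
     continuous_on UNIV w \<and> bounded (range w) \<and>
     (\<forall>k y. (\<lambda>s. w (y + s *\<^sub>R axis k 1)) differentiable (at 0)))"

definition D_op :: "'d::finite \<Rightarrow> (real^'d \<Rightarrow> complex) \<Rightarrow> real^'d \<Rightarrow> complex" where
  "D_op k u = (\<lambda>y. - \<i> * partial_deriv k u y)"

definition D_pow :: "nat^'d::finite \<Rightarrow> (real^'d \<Rightarrow> complex) \<Rightarrow> real^'d \<Rightarrow> complex" where
  "D_pow \<alpha> = op_prod (\<lambda>k. D_op k ^^ (\<alpha> $ k))"

definition poly_D :: "'d::finite cpoly \<Rightarrow> (real^'d \<Rightarrow> complex) \<Rightarrow> real^'d \<Rightarrow> complex" where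
  "poly_D p u y = (\<Sum>\<alpha>\<in>Poly_Mapping.keys p. Poly_Mapping.lookup p \<alpha> * D_pow \<alpha> u y)"

definition strongly_elliptic :: "nat \<Rightarrow> 'd::finite cpoly \<Rightarrow> bool" where
  "strongly_elliptic l b \<longleftrightarrow> (\<exists>c>0. \<forall>\<xi>. c * norm \<xi> ^ l \<le> Re (poly_eval b \<xi>))"


section \<open>Difference operators\<close>

definition grid :: "real \<Rightarrow> (real^'d::finite) set" where
  "grid \<epsilon> = {x. \<forall>k. \<exists>m::int. x $ k = \<epsilon> * of_int m}"

text \<open>
  Functions on \<^term>\<open>grid \<epsilon>\<close> are represented by functions on the whole space of which only the
  values on the grid are used; at grid points the difference operators see no other values.
\<close>

definition diff_minus ::
  "real \<Rightarrow> 'd::finite \<Rightarrow> (real^'d \<Rightarrow> complex) \<Rightarrow> real^'d \<Rightarrow> complex" where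
  "diff_minus \<epsilon> k u = (\<lambda>y. u (y - \<epsilon> *\<^sub>R axis k 1) - u y)"

definition diff_plus ::
  "real \<Rightarrow> 'd::finite \<Rightarrow> (real^'d \<Rightarrow> complex) \<Rightarrow> real^'d \<Rightarrow> complex" where
  "diff_plus \<epsilon> k u = (\<lambda>y. u (y + \<epsilon> *\<^sub>R axis k 1) - u y)"

text \<open>
  A multi-index \<open>\<nu> = (\<nu>\<^sub>1, \<dots>, \<nu>\<^sub>2\<^sub>d)\<close> is split into the pair \<open>(\<mu>, \<kappa>)\<close> of its odd-numbered entries,
  \<open>\<mu> = (\<nu>\<^sub>1, \<nu>\<^sub>3, \<dots>)\<close> (powers of the backward differences), and even-numbered entries,
  \<open>\<kappa> = (\<nu>\<^sub>2, \<nu>\<^sub>4, \<dots>)\<close> (powers of the forward differences).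
\<close>

definition diff_indices :: "nat \<Rightarrow> nat \<Rightarrow> ((nat^'d::finite) \<times> (nat^'d)) set" where
  "diff_indices l lhat = {(\<mu>, \<kappa>). l \<le> msize \<mu> + msize \<kappa> \<and> msize \<mu> + msize \<kappa> \<le> lhat}"

definition diff_op ::
  "nat \<Rightarrow> nat \<Rightarrow> ((nat^'d::finite) \<times> (nat^'d) \<Rightarrow> complex) \<Rightarrow> real \<Rightarrow>
   (real^'d \<Rightarrow> complex) \<Rightarrow> real^'d \<Rightarrow> complex" where
  "diff_op l lhat a \<epsilon> u y = 1 / complex_of_real \<epsilon> ^ l *
     (\<Sum>(\<mu>, \<kappa>)\<in>diff_indices l lhat. a (\<mu>, \<kappa>) *
        op_prod (\<lambda>k. (diff_minus \<epsilon> k ^^ (\<mu> $ k)) \<circ> (diff_plus \<epsilon> k ^^ (\<kappa> $ k))) u y)"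

definition diff_symbol ::
  "nat \<Rightarrow> nat \<Rightarrow> ((nat^'d::finite) \<times> (nat^'d) \<Rightarrow> complex) \<Rightarrow> real^'d \<Rightarrow> complex" where
  "diff_symbol l lhat a \<theta> =
     (\<Sum>(\<mu>, \<kappa>)\<in>diff_indices l lhat. a (\<mu>, \<kappa>) *
        (\<Prod>k\<in>UNIV. (exp (- \<i> * complex_of_real (\<theta> $ k)) - 1) ^ (\<mu> $ k) *
                    (exp (\<i> * complex_of_real (\<theta> $ k)) - 1) ^ (\<kappa> $ k)))"

definition approximates ::
  "nat \<Rightarrow> nat \<Rightarrow> ((nat^'d::finite) \<times> (nat^'d) \<Rightarrow> complex) \<Rightarrow> 'd cpoly \<Rightarrow> nat \<Rightarrow> bool" where
  "approximates l lhat a b M \<longleftrightarrow>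
     (\<forall>u. smooth u \<longrightarrow> (\<exists>C>0. \<forall>\<epsilon>>0. \<forall>y.
        norm (diff_op l lhat a \<epsilon> u y - poly_D b u y) \<le> C * \<epsilon> ^ M))"

definition cube :: "real \<Rightarrow> (real^'d::finite) set" where
  "cube r = {\<theta>. \<forall>k. \<theta> $ k \<in> {- r..r}}"


section \<open>The second discrete Green function\<close>

definition grid_delta :: "real \<Rightarrow> real^'d::finite \<Rightarrow> complex" where
  "grid_delta \<epsilon> x = (if x = 0 then 1 / complex_of_real \<epsilon> ^ CARD('d) else 0)"

definition second_green ::
  "nat \<Rightarrow> nat \<Rightarrow> ((nat^'d::finite) \<times> (nat^'d) \<Rightarrow> complex) \<Rightarrow> real \<Rightarrow>
   (real^'d \<Rightarrow> real \<Rightarrow> complex) \<Rightarrow> bool" where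
  "second_green l lhat a \<epsilon> v \<longleftrightarrow>
     (\<forall>t\<ge>0. \<forall>N::nat. \<exists>C. \<forall>x\<in>grid \<epsilon>. norm x ^ N * norm (v x t) \<le> C) \<and>
     (\<forall>x\<in>grid \<epsilon>. v x 0 = 0 \<and>
        (\<exists>v'. continuous_on {0..} v' \<and>
           (\<forall>t\<ge>0. (v x has_vector_derivative v' t) (at t within {0..})) \<and>
           (\<forall>t>0. v' t + diff_op l lhat a \<epsilon> (\<lambda>z. v z t) x = grid_delta \<epsilon> x)))"


section \<open>The functions in the asymptotic expansion\<close>

definition Omega ::
  "nat \<Rightarrow> nat \<Rightarrow> ((nat^'d::finite) \<times> (nat^'d) \<Rightarrow> complex) \<Rightarrow> real^'d \<Rightarrow> complex" where
  "Omega l lhat a y = 1 / (2 * complex_of_real pi) ^ CARD('d) *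
     (LINT \<theta>:cube pi|lborel. exp (\<i> * complex_of_real (y \<bullet> \<theta>)) / diff_symbol l lhat a \<theta>)"

definition H_fun :: "'d::finite cpoly \<Rightarrow> real^'d \<Rightarrow> complex" where
  "H_fun b y = 1 / (2 * complex_of_real pi) ^ CARD('d) *
     (LINT \<xi>|lborel. exp (- poly_eval b \<xi>) * exp (\<i> * complex_of_real (y \<bullet> \<xi>)))"

text \<open>
  The polynomial with index \<open>m + l\<close> of the expansion is \<open>exp_polys l lhat a b m\<close>. For \<open>m \<ge> 1\<close> it is
  uniquely determined by the expansion; the value at \<open>m = 0\<close> is irrelevant.
\<close>

definition exp_polys ::
  "nat \<Rightarrow> nat \<Rightarrow> ((nat^'d::finite) \<times> (nat^'d) \<Rightarrow> complex) \<Rightarrow> 'd cpoly \<Rightarrow> nat \<Rightarrow> 'd cpoly" where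
  "exp_polys l lhat a b = (SOME P. \<forall>K \<xi>.
     (\<lambda>s::real. exp (- diff_symbol l lhat a (s *\<^sub>R \<xi>) / complex_of_real s ^ l)
        - exp (- poly_eval b \<xi>) *
          (1 + (\<Sum>m=1..K. complex_of_real s ^ m * poly_eval (P m) \<xi>)))
     \<in> O[at_right 0](\<lambda>s. complex_of_real s ^ (K + 1)))"

definition Hk_fun ::
  "nat \<Rightarrow> nat \<Rightarrow> ((nat^'d::finite) \<times> (nat^'d) \<Rightarrow> complex) \<Rightarrow> 'd cpoly \<Rightarrow> nat \<Rightarrow>
   real^'d \<Rightarrow> complex" where
  "Hk_fun l lhat a b k =
     (if k = 0 then H_fun b else poly_D (exp_polys l lhat a b k) (H_fun b))"

text \<open>
  Meaningful for \<open>l < CARD('d)\<close>, where the subtractions on natural numbers do not truncate. The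
  value at \<open>0\<close> is the limit of \<open>F_fun l lhat a b k y\<close> as \<open>y\<close> tends to \<open>0\<close>.
\<close>

definition F_fun ::
  "nat \<Rightarrow> nat \<Rightarrow> ((nat^'d::finite) \<times> (nat^'d) \<Rightarrow> complex) \<Rightarrow> 'd cpoly \<Rightarrow> nat \<Rightarrow>
   real^'d \<Rightarrow> complex" where
  "F_fun l lhat a b k y =
     (if y = 0 then - of_nat l / of_nat (k + CARD('d) - l) * Hk_fun l lhat a b k 0
      else - of_nat l / complex_of_real (norm y) ^ (CARD('d) + k - l) *
        (LINT \<rho>:{0..norm y}|lborel.
           complex_of_real \<rho> ^ (CARD('d) + k - l - 1) *
           Hk_fun l lhat a b k (\<rho> *\<^sub>R ((1 / norm y) *\<^sub>R y))))"

end

theory Submission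
  imports Defs
begin

text \<open>
  The Green function is the Fourier integral of \<open>(1 - exp (- \<tau> A)) / A\<close> over the cube, in the scaled
  variables \<open>y = x / \<epsilon>\<close>, \<open>\<tau> = t / \<epsilon>\<^sup>l\<close>. Its time derivative, the first discrete Green function
  \<open>G y \<tau>\<close>, is after the substitution \<open>\<theta> = s \<xi>\<close> with \<open>s = \<tau> powr (- 1 / l)\<close> an integral of
  \<open>exp (- A (s \<xi>) / s\<^sup>l)\<close>, whose expansion in powers of \<open>s\<close> is uniform up to a factor
  \<open>(1 + \<bar>\<xi>\<bar>)\<^sup>N exp (- c \<bar>\<xi>\<bar>\<^sup>l)\<close>; this gives the expansion of \<open>G\<close> in the \<open>H\<^sub>k\<close>. The functions \<open>F\<^sub>k\<close>,
  rescaled, are exactly the primitives in time of the \<open>H\<^sub>k\<close>-terms that vanish as \<open>\<tau> \<rightarrow> \<infinity>\<close>, while the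
  Green function itself tends to \<open>\<Omega>\<close> because \<open>1 / A\<close> is integrable for \<open>l < d\<close>. So the remainder
  vanishes at infinity, and integrating the bound for its derivative from \<open>\<tau>\<close> to \<open>\<infinity>\<close> bounds it.
\<close>

section \<open>Superpositions of plane waves\<close>

text \<open>A term by term expansion of \<open>(1 - exp (- \<tau> A)) / A\<close> has coefficients
  with algebraic decay only, and splitting off \<open>1 / A\<close> leaves
  \<open>exp (- \<tau> A) / A\<close>, whose expansion is more and more singular at the origin.
  Differentiation in time removes the denominator and leaves polynomials times
  \<open>exp (- P)\<close>. The variable \<open>s\<close> runs through \<open>{0<..S}\<close> with
  \<open>S = t0 powr (- 1 / l)\<close>; this is how \<open>R\<close> comes to depend on
  \<open>t0\<close>. The approximation property is tested on plane waves, where the constant depends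
  on \<open>\<xi>\<close>: it fixes the leading coefficient \<open>P\<close> and makes the terms
  with \<open>1 \<le> k < M\<close> vanish, while uniformity in \<open>\<xi>\<close> comes from the
  algebraic form of the symbol. Two obstacles shape the proof. \<open>exp_polys\<close> is a choice,
  so one family of polynomials valid for every \<open>K\<close> must be constructed before anything
  is known about it. And \<open>second_green\<close> bounds \<open>v\<close> at each time
  separately, without local uniformity in time, so Gronwall's inequality is not directly applicable
  and the identification of \<open>v\<close> with the Fourier integral needs a uniqueness argument
  of its own.\<close>

lemma lborel_product_vec:
  fixes f :: "'d::finite \<Rightarrow> real \<Rightarrow> complex"
  assumes int: "\<And>k. integrable lborel (f k)"
  shows "integrable lborel (\<lambda>x::real^'d. \<Prod>k\<in>UNIV. f k (x $ k))"
    and "(LINT x|(lborel :: (real^'d) measure). (\<Prod>k\<in>UNIV. f k (x $ k))) = (\<Prod>k\<in>UNIV. integral\<^sup>L lborel (f k))"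
proof -
  interpret product_sigma_finite "\<lambda>_::real^'d. lborel :: real measure" ..
  \<comment> \<open>\<open>lborel\<close> on vectors is the image of the product measure over
    \<open>Basis\<close>; \<open>g\<close> transports the factors \<open>f k\<close> along the
    bijection that sends \<open>k\<close> to \<open>axis k 1\<close>.\<close>
  define g where "g = (\<lambda>b::real^'d. f (THE k. b = axis k 1))"
  have g: "g (axis k 1) = f k" for k
    unfolding g_def by (rule arg_cong[where f = f]) (auto simp: axis_eq_axis)
  have inj: "inj (\<lambda>k::'d. axis k (1::real))" by (auto simp: inj_def axis_eq_axis)
  have B: "(Basis :: (real^'d) set) = range (\<lambda>k. axis k 1)" by (auto simp: Basis_vec_def)
  have meas [measurable]: "f k \<in> borel_measurable borel" for k
    using borel_measurable_integrable[OF int[of k]] by simp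
  have mF: "(\<lambda>x::real^'d. \<Prod>k\<in>UNIV. f k (x $ k)) \<in> borel_measurable borel"
    by measurable
  have T: "(\<lambda>h. \<Sum>b\<in>Basis. h b *\<^sub>R b) \<in> measurable (\<Pi>\<^sub>M b\<in>(Basis::(real^'d) set). (lborel::real measure)) borel"
    by measurable
  have nth: "(\<Sum>b\<in>Basis. h b *\<^sub>R b) $ k = h (axis k 1)" for h :: "real^'d \<Rightarrow> real" and k :: 'd
  proof -
    have "(\<Sum>b\<in>Basis. h b *\<^sub>R b) $ k = (\<Sum>b\<in>Basis. h b *\<^sub>R b) \<bullet> axis k 1"
      by (simp add: inner_axis)
    also have "\<dots> = h (axis k 1)" by (intro inner_sum_left_Basis) (auto simp: B)
    finally show ?thesis .
  qed
  have eq: "(\<Prod>k\<in>UNIV. f k ((\<Sum>b\<in>Basis. h b *\<^sub>R b) $ k)) = (\<Prod>b\<in>Basis. g b (h b))" for h :: "real^'d \<Rightarrow> real"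
  proof -
    have "(\<Prod>b\<in>Basis. g b (h b)) = (\<Prod>k\<in>UNIV. f k (h (axis k 1)))"
      by (simp add: B prod.reindex[OF inj] g)
    also have "\<dots> = (\<Prod>k\<in>UNIV. f k ((\<Sum>b\<in>Basis. h b *\<^sub>R b) $ k))"
      by (intro prod.cong refl arg_cong[where f = "f k" for k] nth[symmetric])
    finally show ?thesis by (rule sym)
  qed
  have gi: "integrable lborel (g b)" if "b \<in> Basis" for b
    using that int by (auto simp: B g)
  show "integrable lborel (\<lambda>x::real^'d. \<Prod>k\<in>UNIV. f k (x $ k))"
    unfolding lborel_eq[where 'a = "real^'d"] by (subst integrable_distr_eq[OF T mF], unfold eq)
      (rule product_integrable_prod[OF finite_Basis gi])
  have "(LINT x|(lborel :: (real^'d) measure). (\<Prod>k\<in>UNIV. f k (x $ k))) = (\<Prod>b\<in>Basis. integral\<^sup>L lborel (g b))"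
    unfolding lborel_eq[where 'a = "real^'d"] by (subst integral_distr[OF T mF], unfold eq)
      (rule product_integral_prod[OF finite_Basis gi])
  also have "\<dots> = (\<Prod>k\<in>UNIV. integral\<^sup>L lborel (f k))"
    unfolding B by (subst prod.reindex[OF inj]) (simp add: g)
  finally show "(LINT x|(lborel :: (real^'d) measure). (\<Prod>k\<in>UNIV. f k (x $ k))) = (\<Prod>k\<in>UNIV. integral\<^sup>L lborel (f k))" .
qed

section \<open>Operators that act on superpositions as multipliers\<close>

lemma coords: "distinct (coords :: 'd::finite list)" "set (coords :: 'd list) = UNIV"
proof -
  obtain ks :: "'d list" where "set ks = UNIV" "distinct ks"
    using finite_distinct_list[OF finite[of "UNIV :: 'd set"]] by metis
  then have "distinct ks \<and> set ks = UNIV" by (rule conjI[rotated])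
  then have "distinct (coords :: 'd list) \<and> set (coords :: 'd list) = UNIV"
    unfolding coords_def by (rule someI)
  then show "distinct (coords :: 'd list)" "set (coords :: 'd list) = UNIV" by (rule conjunct1, rule conjunct2)
qed

text \<open>Composing multiplier operators multiplies their multipliers, and multiplication is
  commutative, so the order chosen by \<open>coords\<close> disappears. \<open>S\<close> is the
  class of amplitudes on which the rule holds: all functions for a single plane wave, the rapidly
  decreasing ones for Fourier integrals.\<close>

lemma op_prod_multiplier:
  fixes T :: "'d::finite \<Rightarrow> 'f \<Rightarrow> 'f" and U :: "('p \<Rightarrow> 'c::comm_monoid_mult) \<Rightarrow> 'f"
  assumes T: "\<And>k \<phi>. \<phi> \<in> S \<Longrightarrow> T k (U \<phi>) = U (\<lambda>x. m k x * \<phi> x)"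
    and S: "\<And>k \<phi>. \<phi> \<in> S \<Longrightarrow> (\<lambda>x. m k x * \<phi> x) \<in> S"
    and \<phi>: "\<phi> \<in> S"
  shows "op_prod T (U \<phi>) = U (\<lambda>x. (\<Prod>k\<in>UNIV. m k x) * \<phi> x)"
    and "(\<lambda>x. (\<Prod>k\<in>UNIV. m k x) * \<phi> x) \<in> S"
proof -
  have "distinct ks \<Longrightarrow> foldr (\<lambda>k S. T k \<circ> S) ks id (U \<phi>) = U (\<lambda>x. (\<Prod>k\<in>set ks. m k x) * \<phi> x) \<and>
     (\<lambda>x. (\<Prod>k\<in>set ks. m k x) * \<phi> x) \<in> S" for ks
  proof (induction ks)
    case (Cons k ks)
    then show ?case using T[of _ k] S[of _ k] by (auto simp: mult.assoc)
  qed (use \<phi> in auto)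
  from this[of coords] show "op_prod T (U \<phi>) = U (\<lambda>x. (\<Prod>k\<in>UNIV. m k x) * \<phi> x)"
    and "(\<lambda>x. (\<Prod>k\<in>UNIV. m k x) * \<phi> x) \<in> S"
    by (simp_all add: op_prod_def coords)
qed

lemma funpow_multiplier:
  fixes T :: "'f \<Rightarrow> 'f" and U :: "('p \<Rightarrow> 'c::comm_monoid_mult) \<Rightarrow> 'f"
  assumes T: "\<And>\<phi>. \<phi> \<in> S \<Longrightarrow> T (U \<phi>) = U (\<lambda>x. m x * \<phi> x)"
    and S: "\<And>\<phi>. \<phi> \<in> S \<Longrightarrow> (\<lambda>x. m x * \<phi> x) \<in> S"
    and \<phi>: "\<phi> \<in> S"
  shows "(T ^^ n) (U \<phi>) = U (\<lambda>x. m x ^ n * \<phi> x)" and "(\<lambda>x. m x ^ n * \<phi> x) \<in> S"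
proof -
  have "(T ^^ n) (U \<phi>) = U (\<lambda>x. m x ^ n * \<phi> x) \<and> (\<lambda>x. m x ^ n * \<phi> x) \<in> S"
  proof (induction n)
    case (Suc n)
    then show ?case using T[of "\<lambda>x. m x ^ n * \<phi> x"] S[of "\<lambda>x. m x ^ n * \<phi> x"] by (auto simp: mult.assoc)
  qed (use \<phi> in auto)
  then show "(T ^^ n) (U \<phi>) = U (\<lambda>x. m x ^ n * \<phi> x)" and "(\<lambda>x. m x ^ n * \<phi> x) \<in> S" by auto
qed

lemma finite_msize_le: "finite {\<alpha>::nat^'d::finite. msize \<alpha> \<le> n}"
proof (rule finite_subset)
  show "{\<alpha>::nat^'d::finite. msize \<alpha> \<le> n} \<subseteq> (\<lambda>f. \<chi> k. f k) ` (UNIV \<rightarrow>\<^sub>E {..n})"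
  proof
    fix \<alpha> :: "nat^'d" assume "\<alpha> \<in> {\<alpha>. msize \<alpha> \<le> n}"
    then have "\<alpha> $ k \<le> n" for k
      using member_le_sum[of k UNIV "\<lambda>k. \<alpha> $ k"] by (auto simp: msize_def)
    then show "\<alpha> \<in> (\<lambda>f. \<chi> k. f k) ` (UNIV \<rightarrow>\<^sub>E {..n})"
      by (intro image_eqI[of _ _ "\<lambda>k. \<alpha> $ k"]) (auto simp: vec_eq_iff)
  qed
  show "finite ((\<lambda>f. \<chi> k. f k) ` ((UNIV::'d set) \<rightarrow>\<^sub>E {..n}))"
    by (intro finite_imageI finite_PiE) auto
qed

lemma finite_diff_indices [simp]: "finite (diff_indices l lhat :: ((nat^'d::finite) \<times> (nat^'d)) set)"
proof (rule finite_subset)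
  show "(diff_indices l lhat :: ((nat^'d::finite) \<times> (nat^'d)) set) \<subseteq> {\<alpha>. msize \<alpha> \<le> lhat} \<times> {\<alpha>. msize \<alpha> \<le> lhat}"
    by (auto simp: diff_indices_def)
qed (simp add: finite_msize_le)

text \<open>The contribution of one coordinate to the symbol. \<open>\<omega>\<close> is the phase
  per unit frequency of one grid step: the grid width for a plane wave, \<open>1\<close> in scaled
  variables, and \<open>s\<close> when the symbol is expanded.\<close>

definition diff_factor :: "real \<Rightarrow> 'd::finite \<Rightarrow> (nat^'d) \<times> (nat^'d) \<Rightarrow> real^'d \<Rightarrow> complex" where
  "diff_factor \<omega> k \<nu> \<eta> = (exp (- \<i> * complex_of_real (\<omega> * \<eta> $ k)) - 1) ^ (fst \<nu> $ k) *
     (exp (\<i> * complex_of_real (\<omega> * \<eta> $ k)) - 1) ^ (snd \<nu> $ k)"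

lemma diff_symbol_eq:
  "diff_symbol l lhat a (\<omega> *\<^sub>R \<eta>) = (\<Sum>\<nu>\<in>diff_indices l lhat. a \<nu> * (\<Prod>k\<in>UNIV. diff_factor \<omega> k \<nu> \<eta>))"
  unfolding diff_symbol_def diff_factor_def by (intro sum.cong) auto

text \<open>\<open>U\<close> stands for any superposition of exponentials \<open>e\<^sup>i\<^sup>y\<^sup>\<eta>\<close> with amplitude function \<open>\<phi>\<close>.\<close>

lemma diff_op_multiplier:
  fixes U :: "(real^'d::finite \<Rightarrow> complex) \<Rightarrow> real^'d \<Rightarrow> complex"
  assumes minus: "\<And>k \<phi>. \<phi> \<in> S \<Longrightarrow> diff_minus \<epsilon> k (U \<phi>) = U (\<lambda>\<eta>. (exp (- \<i> * complex_of_real (\<omega> * \<eta> $ k)) - 1) * \<phi> \<eta>)"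
    and plus: "\<And>k \<phi>. \<phi> \<in> S \<Longrightarrow> diff_plus \<epsilon> k (U \<phi>) = U (\<lambda>\<eta>. (exp (\<i> * complex_of_real (\<omega> * \<eta> $ k)) - 1) * \<phi> \<eta>)"
    and Sm: "\<And>k \<phi>. \<phi> \<in> S \<Longrightarrow> (\<lambda>\<eta>. (exp (- \<i> * complex_of_real (\<omega> * \<eta> $ k)) - 1) * \<phi> \<eta>) \<in> S"
    and Sp: "\<And>k \<phi>. \<phi> \<in> S \<Longrightarrow> (\<lambda>\<eta>. (exp (\<i> * complex_of_real (\<omega> * \<eta> $ k)) - 1) * \<phi> \<eta>) \<in> S"
    and \<phi>: "\<phi> \<in> S"
  shows "diff_op l lhat a \<epsilon> (U \<phi>) y = 1 / complex_of_real \<epsilon> ^ l *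
      (\<Sum>\<nu>\<in>diff_indices l lhat. a \<nu> * U (\<lambda>\<eta>. (\<Prod>k\<in>UNIV. diff_factor \<omega> k \<nu> \<eta>) * \<phi> \<eta>) y)"
    and "\<And>\<nu>. (\<lambda>\<eta>. (\<Prod>k\<in>UNIV. diff_factor \<omega> k \<nu> \<eta>) * \<phi> \<eta>) \<in> S"
proof -
  have 1: "((diff_minus \<epsilon> k ^^ (fst \<nu> $ k)) \<circ> (diff_plus \<epsilon> k ^^ (snd \<nu> $ k))) (U \<phi>) =
      U (\<lambda>\<eta>. diff_factor \<omega> k \<nu> \<eta> * \<phi> \<eta>) \<and> (\<lambda>\<eta>. diff_factor \<omega> k \<nu> \<eta> * \<phi> \<eta>) \<in> S" if "\<phi> \<in> S" for k \<phi> \<nu>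
  proof -
    note p = funpow_multiplier[where T = "diff_plus \<epsilon> k" and S = S and U = U and n = "snd \<nu> $ k", OF plus Sp that]
    note m = funpow_multiplier[where T = "diff_minus \<epsilon> k" and S = S and U = U and n = "fst \<nu> $ k", OF minus Sm p(2)]
    show ?thesis using p m by (simp add: diff_factor_def mult.assoc)
  qed
  have 2: "op_prod (\<lambda>k. (diff_minus \<epsilon> k ^^ (fst \<nu> $ k)) \<circ> (diff_plus \<epsilon> k ^^ (snd \<nu> $ k))) (U \<phi>) =
      U (\<lambda>\<eta>. (\<Prod>k\<in>UNIV. diff_factor \<omega> k \<nu> \<eta>) * \<phi> \<eta>)"
    and 3: "(\<lambda>\<eta>. (\<Prod>k\<in>UNIV. diff_factor \<omega> k \<nu> \<eta>) * \<phi> \<eta>) \<in> S" for \<nu>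
    using op_prod_multiplier[where T = "\<lambda>k. (diff_minus \<epsilon> k ^^ (fst \<nu> $ k)) \<circ> (diff_plus \<epsilon> k ^^ (snd \<nu> $ k))"
        and U = U and S = S and m = "\<lambda>k. diff_factor \<omega> k \<nu>", OF _ _ \<phi>] 1 by auto
  show "diff_op l lhat a \<epsilon> (U \<phi>) y = 1 / complex_of_real \<epsilon> ^ l *
      (\<Sum>\<nu>\<in>diff_indices l lhat. a \<nu> * U (\<lambda>\<eta>. (\<Prod>k\<in>UNIV. diff_factor \<omega> k \<nu> \<eta>) * \<phi> \<eta>) y)"
    unfolding diff_op_def
    by (intro arg_cong2[where f = "(*)"] sum.cong refl) (auto simp flip: 2)
  show "\<And>\<nu>. (\<lambda>\<eta>. (\<Prod>k\<in>UNIV. diff_factor \<omega> k \<nu> \<eta>) * \<phi> \<eta>) \<in> S" by (rule 3)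
qed

text \<open>The sum over monomials stays outside \<open>U\<close> because \<open>U\<close> is not
  assumed linear; each instance recombines it by its own means. The second part supplies the
  admissibility that is needed for this.\<close>

lemma poly_D_multiplier:
  fixes U :: "(real^'d::finite \<Rightarrow> complex) \<Rightarrow> real^'d \<Rightarrow> complex"
  assumes D: "\<And>k \<phi>. \<phi> \<in> S \<Longrightarrow> D_op k (U \<phi>) = U (\<lambda>\<xi>. complex_of_real (\<xi> $ k) * \<phi> \<xi>)"
    and S: "\<And>k \<phi>. \<phi> \<in> S \<Longrightarrow> (\<lambda>\<xi>. complex_of_real (\<xi> $ k) * \<phi> \<xi>) \<in> S"
    and \<phi>: "\<phi> \<in> S"
  shows "poly_D p (U \<phi>) y = (\<Sum>\<alpha>\<in>Poly_Mapping.keys p. Poly_Mapping.lookup p \<alpha> *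
      U (\<lambda>\<xi>. (\<Prod>k\<in>UNIV. complex_of_real (\<xi> $ k) ^ (\<alpha> $ k)) * \<phi> \<xi>) y)"
    and "\<And>\<alpha>. (\<lambda>\<xi>. (\<Prod>k\<in>UNIV. complex_of_real (\<xi> $ k) ^ (\<alpha> $ k)) * \<phi> \<xi>) \<in> S"
proof -
  have 1: "(D_op k ^^ (\<alpha> $ k)) (U \<phi>) = U (\<lambda>\<xi>. complex_of_real (\<xi> $ k) ^ (\<alpha> $ k) * \<phi> \<xi>)"
    "(\<lambda>\<xi>. complex_of_real (\<xi> $ k) ^ (\<alpha> $ k) * \<phi> \<xi>) \<in> S" if "\<phi> \<in> S" for k \<phi> \<alpha>
    using funpow_multiplier[where T = "D_op k" and S = S and U = U, OF D S that] by auto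
  note 2 = op_prod_multiplier[where U = U and S = S and m = "\<lambda>k \<xi>. complex_of_real (\<xi> $ k) ^ (\<alpha> $ k)" for \<alpha>, OF 1 \<phi>]
  show "poly_D p (U \<phi>) y = (\<Sum>\<alpha>\<in>Poly_Mapping.keys p. Poly_Mapping.lookup p \<alpha> *
      U (\<lambda>\<xi>. (\<Prod>k\<in>UNIV. complex_of_real (\<xi> $ k) ^ (\<alpha> $ k)) * \<phi> \<xi>) y)"
    by (simp only: poly_D_def D_pow_def 2(1))
  show "\<And>\<alpha>. (\<lambda>\<xi>. (\<Prod>k\<in>UNIV. complex_of_real (\<xi> $ k) ^ (\<alpha> $ k)) * \<phi> \<xi>) \<in> S" by (rule 2(2))
qed

section \<open>Plane waves as test functions\<close>

definition plane_wave :: "real^'d::finite \<Rightarrow> real^'d \<Rightarrow> complex" where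
  "plane_wave \<xi> y = exp (\<i> * complex_of_real (y \<bullet> \<xi>))"

lemma norm_plane_wave [simp]: "norm (plane_wave \<xi> y) = 1"
  by (simp add: plane_wave_def)

lemma plane_wave_shift:
  "plane_wave \<xi> (y + s *\<^sub>R axis k 1) = exp (\<i> * complex_of_real (s * \<xi> $ k)) * plane_wave \<xi> y"
  by (simp add: plane_wave_def inner_add_left inner_axis' ring_distribs exp_add mult.commute)

lemma plane_wave_has_derivative:
  "((\<lambda>s. plane_wave \<xi> (y + s *\<^sub>R axis k 1)) has_vector_derivative (\<i> * complex_of_real (\<xi> $ k) * plane_wave \<xi> y)) (at 0)"
  unfolding plane_wave_shift
  by (auto intro!: derivative_eq_intros has_vector_derivative_real_field simp: field_simps)

lemma partial_deriv_plane_wave: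
  "partial_deriv k (\<lambda>y. c * plane_wave \<xi> y) = (\<lambda>y. (\<i> * complex_of_real (\<xi> $ k) * c) * plane_wave \<xi> y)"
proof
  fix y
  have "((\<lambda>s. c * plane_wave \<xi> (y + s *\<^sub>R axis k 1)) has_vector_derivative (c * (\<i> * complex_of_real (\<xi> $ k) * plane_wave \<xi> y))) (at 0)"
    by (intro has_vector_derivative_mult_right plane_wave_has_derivative)
  then show "partial_deriv k (\<lambda>y. c * plane_wave \<xi> y) y = (\<i> * complex_of_real (\<xi> $ k) * c) * plane_wave \<xi> y"
    unfolding partial_deriv_def by (auto dest!: vector_derivative_at simp: algebra_simps)
qed

text \<open>Every iterated partial derivative is again a multiple of the wave, so continuity,
  boundedness and differentiability have to be checked for multiples only.\<close>

lemma smooth_plane_wave: "smooth (plane_wave \<xi>)"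
  unfolding smooth_def Let_def
proof
  fix ks :: "'a list"
  have "\<exists>c. foldr partial_deriv ks (plane_wave \<xi>) = (\<lambda>y. c * plane_wave \<xi> y)"
  proof (induction ks)
    case Nil
    show ?case by (rule exI[of _ 1]) auto
  next
    case (Cons k ks)
    then show ?case by (auto simp: partial_deriv_plane_wave)
  qed
  then obtain c where c: "foldr partial_deriv ks (plane_wave \<xi>) = (\<lambda>y. c * plane_wave \<xi> y)" ..
  have "continuous_on UNIV (\<lambda>y. c * plane_wave \<xi> y)"
    unfolding plane_wave_def by (intro continuous_intros)
  moreover have "bounded (range (\<lambda>y. c * plane_wave \<xi> y))"
    by (auto simp: bounded_iff norm_mult intro!: exI[of _ "norm c"])
  moreover have "(\<lambda>s. c * plane_wave \<xi> (y + s *\<^sub>R axis k 1)) differentiable (at 0)" for k y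
    using has_vector_derivative_mult_right[OF plane_wave_has_derivative[of \<xi> y k], of c]
    by (auto simp: differentiable_def has_vector_derivative_def)
  ultimately show "continuous_on UNIV (foldr partial_deriv ks (plane_wave \<xi>)) \<and>
       bounded (range (foldr partial_deriv ks (plane_wave \<xi>))) \<and>
       (\<forall>k y. (\<lambda>s. foldr partial_deriv ks (plane_wave \<xi>) (y + s *\<^sub>R axis k 1)) differentiable at 0)"
    unfolding c by auto
qed

text \<open>A plane wave is an eigenfunction of both operators, with the symbols as eigenvalues; at
  the point \<open>0\<close> the wave itself equals \<open>1\<close>.\<close>

lemma symbol_plane_wave:
  assumes "\<epsilon> > 0"
  shows "diff_op l lhat a \<epsilon> (plane_wave \<xi>) 0 = diff_symbol l lhat a (\<epsilon> *\<^sub>R \<xi>) / complex_of_real \<epsilon> ^ l"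
    and "poly_D b (plane_wave \<xi>) 0 = poly_eval b \<xi>"
proof -
  \<comment> \<open>A superposition concentrated at the single frequency \<open>\<xi>\<close>: the
    amplitude enters through its value there, so every amplitude is admissible.\<close>
  define U where "U = (\<lambda>\<phi> y. \<phi> \<xi> * plane_wave \<xi> y)"
  have U: "plane_wave \<xi> = U (\<lambda>_. 1)" by (auto simp: U_def)
  have U0: "U \<phi> 0 = \<phi> \<xi>" for \<phi> by (simp add: U_def plane_wave_def)
  have plus: "diff_plus \<epsilon> k (U \<phi>) = U (\<lambda>\<eta>. (exp (\<i> * complex_of_real (\<epsilon> * \<eta> $ k)) - 1) * \<phi> \<eta>)" for k \<phi>
    by (auto simp: diff_plus_def U_def plane_wave_shift algebra_simps)
  have minus: "diff_minus \<epsilon> k (U \<phi>) = U (\<lambda>\<eta>. (exp (- \<i> * complex_of_real (\<epsilon> * \<eta> $ k)) - 1) * \<phi> \<eta>)" for k \<phi>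
    using plane_wave_shift[of \<xi> _ "-\<epsilon>" k] by (auto simp: diff_minus_def U_def algebra_simps)
  show "diff_op l lhat a \<epsilon> (plane_wave \<xi>) 0 = diff_symbol l lhat a (\<epsilon> *\<^sub>R \<xi>) / complex_of_real \<epsilon> ^ l"
    unfolding U by (subst diff_op_multiplier(1)[where S = UNIV, OF minus plus])
      (auto simp: U0 diff_symbol_eq)
  have D: "D_op k (U \<phi>) = U (\<lambda>\<xi>. complex_of_real (\<xi> $ k) * \<phi> \<xi>)" for k \<phi>
    unfolding U_def D_op_def partial_deriv_plane_wave by (simp add: mult.assoc)
  show "poly_D b (plane_wave \<xi>) 0 = poly_eval b \<xi>"
    unfolding U poly_eval_def by (subst poly_D_multiplier(1)[where S = UNIV, OF D]) (auto simp: U0)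
qed

text \<open>\<open>C\<close> is the constant of one test function and hence depends on
  \<open>\<xi>\<close>. Bounds uniform in \<open>\<xi>\<close> are obtained separately, from
  \<open>poly_expansion\<close>.\<close>

lemma approximates_symbol:
  assumes "approximates l lhat a b M"
  shows "\<exists>C>0. \<forall>\<epsilon>>0. norm (diff_symbol l lhat a (\<epsilon> *\<^sub>R \<xi>) / complex_of_real \<epsilon> ^ l - poly_eval b \<xi>) \<le> C * \<epsilon> ^ M"
proof -
  obtain C where "C > 0" and C: "\<And>\<epsilon> y. \<epsilon> > 0 \<Longrightarrow>
      norm (diff_op l lhat a \<epsilon> (plane_wave \<xi>) y - poly_D b (plane_wave \<xi>) y) \<le> C * \<epsilon> ^ M"
    using assms[unfolded approximates_def, rule_format, OF smooth_plane_wave] by metis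
  have "norm (diff_symbol l lhat a (\<epsilon> *\<^sub>R \<xi>) / complex_of_real \<epsilon> ^ l - poly_eval b \<xi>) \<le> C * \<epsilon> ^ M" if "\<epsilon> > 0" for \<epsilon>
    using C[OF that, of 0] unfolding symbol_plane_wave[OF that] .
  with \<open>C > 0\<close> show ?thesis by blast
qed

section \<open>Expansions with polynomial coefficients\<close>

definition mono_eval :: "nat^'d::finite \<Rightarrow> real^'d \<Rightarrow> complex" where
  "mono_eval \<alpha> \<xi> = (\<Prod>k\<in>UNIV. complex_of_real (\<xi> $ k) ^ (\<alpha> $ k))"

lemma mono_eval_add: "mono_eval (\<alpha> + \<beta>) \<xi> = mono_eval \<alpha> \<xi> * mono_eval \<beta> \<xi>"
  by (simp add: mono_eval_def power_add prod.distrib)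

lemma norm_mono_eval_le: "norm (mono_eval \<alpha> \<xi>) \<le> (1 + norm \<xi>) ^ msize \<alpha>"
proof -
  have "norm (mono_eval \<alpha> \<xi>) = (\<Prod>k\<in>UNIV. \<bar>\<xi> $ k\<bar> ^ (\<alpha> $ k))"
    by (simp add: mono_eval_def norm_power flip: prod_norm)
  also have "\<dots> \<le> (\<Prod>k\<in>UNIV. (1 + norm \<xi>) ^ (\<alpha> $ k))"
    using component_le_norm_cart[of \<xi>] by (intro prod_mono conjI power_mono) (auto intro: add_increasing)
  also have "\<dots> = (1 + norm \<xi>) ^ msize \<alpha>"
    by (simp add: msize_def power_sum)
  finally show ?thesis .
qed

lemma poly_eval_superset:
  assumes "finite S" "Poly_Mapping.keys p \<subseteq> S"
  shows "poly_eval p \<xi> = (\<Sum>\<alpha>\<in>S. Poly_Mapping.lookup p \<alpha> * mono_eval \<alpha> \<xi>)"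
  unfolding poly_eval_def mono_eval_def
  using assms by (intro sum.mono_neutral_left) (auto simp: in_keys_iff)

text \<open>Polynomiality as a property of functions, so that sums and products need no bookkeeping
  of coefficients. The coefficient maps come back when a family is compared with
  \<open>exp_polys\<close>.\<close>

definition polyfun :: "(real^'d::finite \<Rightarrow> complex) \<Rightarrow> bool" where
  "polyfun f \<longleftrightarrow> (\<exists>p. f = poly_eval p)"

lemma polyfun_monomial: "polyfun (\<lambda>\<xi>. c * mono_eval \<alpha> \<xi>)"
  unfolding polyfun_def
proof
  show "(\<lambda>\<xi>. c * mono_eval \<alpha> \<xi>) = poly_eval (Poly_Mapping.single \<alpha> c)"
    by (rule ext, subst poly_eval_superset[where S = "{\<alpha>}"]) auto
qed

lemma polyfun_add:
  assumes "polyfun f" "polyfun g"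
  shows "polyfun (\<lambda>\<xi>. f \<xi> + g \<xi>)"
proof -
  from assms obtain p q where pq: "f = poly_eval p" "g = poly_eval q" by (auto simp: polyfun_def)
  have "(\<lambda>\<xi>. f \<xi> + g \<xi>) = poly_eval (p + q)"
    unfolding pq
  proof
    fix \<xi>
    let ?S = "Poly_Mapping.keys p \<union> Poly_Mapping.keys q"
    show "poly_eval p \<xi> + poly_eval q \<xi> = poly_eval (p + q) \<xi>"
      using Poly_Mapping.keys_add[of p q]
      by (subst (1 2 3) poly_eval_superset[where S = ?S])
        (auto simp: lookup_add ring_distribs sum.distrib)
  qed
  then show ?thesis by (auto simp: polyfun_def)
qed

lemma polyfun_const: "polyfun (\<lambda>\<xi>. c)"
  using polyfun_monomial[of c 0] by (simp add: mono_eval_def)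

lemma polyfun_coordinate: "polyfun (\<lambda>\<xi>. complex_of_real (\<xi> $ k))"
proof -
  have "complex_of_real (\<xi> $ k) = 1 * mono_eval (axis k 1) \<xi>" for \<xi>
    by (simp add: mono_eval_def axis_def if_distrib[of "\<lambda>n. x ^ n" for x] cong: if_cong)
  then show ?thesis by (metis (no_types) polyfun_monomial ext)
qed

lemma polyfun_sum:
  "(\<And>i. i \<in> I \<Longrightarrow> polyfun (f i)) \<Longrightarrow> polyfun (\<lambda>\<xi>. \<Sum>i\<in>I. f i \<xi>)"
  by (induction I rule: infinite_finite_induct) (auto intro: polyfun_const polyfun_add)

lemma polyfun_mult:
  assumes "polyfun f" "polyfun g"
  shows "polyfun (\<lambda>\<xi>. f \<xi> * g \<xi>)"
proof -
  from assms obtain p q where pq: "f = poly_eval p" "g = poly_eval q" by (auto simp: polyfun_def)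
  have eq: "(\<lambda>\<xi>. f \<xi> * g \<xi>) = (\<lambda>\<xi>. \<Sum>\<alpha>\<in>Poly_Mapping.keys p. \<Sum>\<beta>\<in>Poly_Mapping.keys q.
      (Poly_Mapping.lookup p \<alpha> * Poly_Mapping.lookup q \<beta>) * mono_eval (\<alpha> + \<beta>) \<xi>)"
    unfolding pq poly_eval_def mono_eval_def[symmetric] mono_eval_add
    by (simp add: sum_product mult_ac)
  show ?thesis unfolding eq by (intro polyfun_sum polyfun_monomial)
qed

lemma polyfun_power: "polyfun f \<Longrightarrow> polyfun (\<lambda>\<xi>. f \<xi> ^ n)"
  by (induction n) (auto intro: polyfun_const polyfun_mult)

lemma polyfun_bound:
  assumes "polyfun f"
  shows "\<exists>C\<ge>0. \<exists>N. \<forall>\<xi>. norm (f \<xi>) \<le> C * (1 + norm \<xi>) ^ N"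
proof -
  from assms obtain p where p: "f = poly_eval p" by (auto simp: polyfun_def)
  \<comment> \<open>\<open>insert 0\<close> keeps the argument of \<open>Max\<close> nonempty for
    the zero polynomial.\<close>
  define N where "N = Max (insert 0 (msize ` Poly_Mapping.keys p))"
  have "norm (f \<xi>) \<le> (\<Sum>\<alpha>\<in>Poly_Mapping.keys p. norm (Poly_Mapping.lookup p \<alpha>)) * (1 + norm \<xi>) ^ N" for \<xi>
  proof -
    have "norm (f \<xi>) \<le> (\<Sum>\<alpha>\<in>Poly_Mapping.keys p. norm (Poly_Mapping.lookup p \<alpha>) * norm (mono_eval \<alpha> \<xi>))"
      unfolding p poly_eval_def mono_eval_def[symmetric]
      by (rule order.trans[OF norm_sum]) (simp add: norm_mult)
    also have "\<dots> \<le> (\<Sum>\<alpha>\<in>Poly_Mapping.keys p. norm (Poly_Mapping.lookup p \<alpha>) * (1 + norm \<xi>) ^ N)"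
    proof (intro sum_mono mult_left_mono)
      fix \<alpha> assume "\<alpha> \<in> Poly_Mapping.keys p"
      then have "msize \<alpha> \<le> N" by (auto simp: N_def)
      then have "(1 + norm \<xi>) ^ msize \<alpha> \<le> (1 + norm \<xi>) ^ N" by (intro power_increasing) auto
      with norm_mono_eval_le[of \<alpha> \<xi>] show "norm (mono_eval \<alpha> \<xi>) \<le> (1 + norm \<xi>) ^ N" by simp
    qed auto
    finally show ?thesis by (simp add: sum_distrib_right)
  qed
  then show ?thesis by (intro exI[of _ "\<Sum>\<alpha>\<in>Poly_Mapping.keys p. norm (Poly_Mapping.lookup p \<alpha>)"] exI[of _ N] conjI) (auto intro: sum_nonneg)
qed

text \<open>
  \<open>poly_expansion K f\<close>: the function \<open>f s \<xi>\<close>, \<open>s > 0\<close>, has an expansion in powers of \<open>s\<close> up to a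
  remainder \<open>s ^ K * g s \<xi>\<close>, with coefficients polynomial in \<open>\<xi>\<close> and with \<open>g\<close> of polynomial growth
  in \<open>\<xi>\<close>, uniformly for bounded \<open>s\<close>. The recursive form makes closure under products an easy
  induction.
\<close>

primrec poly_expansion :: "nat \<Rightarrow> (real \<Rightarrow> real^'d::finite \<Rightarrow> complex) \<Rightarrow> bool" where
  "poly_expansion 0 f \<longleftrightarrow> (\<forall>S. \<exists>C\<ge>0. \<exists>N. \<forall>s\<in>{0<..S}. \<forall>\<xi>. norm (f s \<xi>) \<le> C * (1 + norm \<xi>) ^ N)"
| "poly_expansion (Suc K) f \<longleftrightarrow> (\<exists>p g. polyfun p \<and> poly_expansion K g \<and>
      (\<forall>s>0. \<forall>\<xi>. f s \<xi> = p \<xi> + complex_of_real s * g s \<xi>))"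

lemma poly_expansion_0I:
  assumes "\<And>S. S > 0 \<Longrightarrow> \<exists>C\<ge>0. \<exists>N. \<forall>s\<in>{0<..S}. \<forall>\<xi>. norm (f s \<xi>) \<le> C * (1 + norm \<xi>) ^ N"
  shows "poly_expansion 0 f"
  unfolding poly_expansion.simps
proof
  fix S :: real
  show "\<exists>C\<ge>0. \<exists>N. \<forall>s\<in>{0<..S}. \<forall>\<xi>. norm (f s \<xi>) \<le> C * (1 + norm \<xi>) ^ N"
  proof (cases "S > 0")
    case False
    then show ?thesis by (intro exI[of _ 0]) auto
  qed (rule assms)
qed

lemma poly_expansion_0E:
  assumes "poly_expansion 0 f"
  obtains C N where "C \<ge> 0" "\<And>s \<xi>. s \<in> {0<..S} \<Longrightarrow> norm (f s \<xi>) \<le> C * (1 + norm \<xi>) ^ N"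
  using assms[unfolded poly_expansion.simps, rule_format, of S] by blast

lemma poly_expansion_0_add:
  assumes "poly_expansion 0 f" "poly_expansion 0 g"
  shows "poly_expansion 0 (\<lambda>s \<xi>. f s \<xi> + g s \<xi>)"
proof (rule poly_expansion_0I)
  fix S :: real
  obtain C N where C: "C \<ge> 0" "\<And>s \<xi>. s \<in> {0<..S} \<Longrightarrow> norm (f s \<xi>) \<le> C * (1 + norm \<xi>) ^ N"
    using poly_expansion_0E[OF assms(1), where S = S] by blast
  obtain C' N' where C': "C' \<ge> 0" "\<And>s \<xi>. s \<in> {0<..S} \<Longrightarrow> norm (g s \<xi>) \<le> C' * (1 + norm \<xi>) ^ N'"
    using poly_expansion_0E[OF assms(2), where S = S] by blast
  have "norm (f s \<xi> + g s \<xi>) \<le> (C + C') * (1 + norm \<xi>) ^ max N N'" if "s \<in> {0<..S}" for s \<xi>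
  proof -
    have "C * (1 + norm \<xi>) ^ N \<le> C * (1 + norm \<xi>) ^ max N N'"
      "C' * (1 + norm \<xi>) ^ N' \<le> C' * (1 + norm \<xi>) ^ max N N'"
      using C(1) C'(1) by (intro mult_left_mono power_increasing; simp)+
    then show ?thesis
      using C(2)[OF that, of \<xi>] C'(2)[OF that, of \<xi>] norm_triangle_ineq[of "f s \<xi>" "g s \<xi>"]
      by (simp add: ring_distribs)
  qed
  then show "\<exists>C\<ge>0. \<exists>N. \<forall>s\<in>{0<..S}. \<forall>\<xi>. norm (f s \<xi> + g s \<xi>) \<le> C * (1 + norm \<xi>) ^ N"
    using C(1) C'(1) by (intro exI[of _ "C + C'"] conjI exI[of _ "max N N'"]) auto
qed

lemma poly_expansion_0_mult:
  assumes "poly_expansion 0 f" "poly_expansion 0 g"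
  shows "poly_expansion 0 (\<lambda>s \<xi>. f s \<xi> * g s \<xi>)"
proof (rule poly_expansion_0I)
  fix S :: real
  obtain C N where C: "C \<ge> 0" "\<And>s \<xi>. s \<in> {0<..S} \<Longrightarrow> norm (f s \<xi>) \<le> C * (1 + norm \<xi>) ^ N"
    using poly_expansion_0E[OF assms(1), where S = S] by blast
  obtain C' N' where C': "C' \<ge> 0" "\<And>s \<xi>. s \<in> {0<..S} \<Longrightarrow> norm (g s \<xi>) \<le> C' * (1 + norm \<xi>) ^ N'"
    using poly_expansion_0E[OF assms(2), where S = S] by blast
  have "norm (f s \<xi> * g s \<xi>) \<le> (C * C') * (1 + norm \<xi>) ^ (N + N')" if "s \<in> {0<..S}" for s \<xi>
  proof -
    have "norm (f s \<xi> * g s \<xi>) \<le> (C * (1 + norm \<xi>) ^ N) * (C' * (1 + norm \<xi>) ^ N')"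
      unfolding norm_mult using C(2)[OF that, of \<xi>] C'(2)[OF that, of \<xi>] C(1) C'(1) by (intro mult_mono) auto
    then show ?thesis by (simp add: power_add mult_ac)
  qed
  then show "\<exists>C\<ge>0. \<exists>N. \<forall>s\<in>{0<..S}. \<forall>\<xi>. norm (f s \<xi> * g s \<xi>) \<le> C * (1 + norm \<xi>) ^ N"
    using C(1) C'(1) by (intro exI[of _ "C * C'"] conjI exI[of _ "N + N'"]) auto
qed

lemma poly_expansion_0_polyfun: "polyfun p \<Longrightarrow> poly_expansion 0 (\<lambda>s. p)"
  using polyfun_bound[of p] by auto

lemma poly_expansion_0_scale: "poly_expansion 0 (\<lambda>s \<xi>. complex_of_real s)"
proof (rule poly_expansion_0I)
  fix S :: real assume "S > 0"
  then show "\<exists>C\<ge>0. \<exists>N. \<forall>s\<in>{0<..S}. \<forall>\<xi>::real^'a. norm (complex_of_real s) \<le> C * (1 + norm \<xi>) ^ N"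
    by (intro exI[of _ S] conjI exI[of _ 0]) auto
qed

lemma poly_expansion_cong:
  assumes "poly_expansion K f" "\<And>s \<xi>. s > 0 \<Longrightarrow> f s \<xi> = g s \<xi>"
  shows "poly_expansion K g"
  using assms by (cases K) (auto; metis greaterThanAtMost_iff)+

lemma poly_expansion_imp_0: "poly_expansion K f \<Longrightarrow> poly_expansion 0 f"
proof (induction K arbitrary: f)
  case (Suc K)
  then obtain p g where pg: "polyfun p" "poly_expansion K g"
    "\<And>s \<xi>. s > 0 \<Longrightarrow> p \<xi> + complex_of_real s * g s \<xi> = f s \<xi>" by auto
  have "poly_expansion 0 (\<lambda>s \<xi>. p \<xi> + complex_of_real s * g s \<xi>)"
    using pg(1) Suc.IH[OF pg(2)]
    by (intro poly_expansion_0_add poly_expansion_0_mult poly_expansion_0_scale poly_expansion_0_polyfun)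
  then show ?case by (rule poly_expansion_cong) (rule pg(3))
qed

lemma poly_expansion_SucD: "poly_expansion (Suc K) f \<Longrightarrow> poly_expansion K f"
proof (induction K arbitrary: f)
  case 0
  then show ?case by (rule poly_expansion_imp_0)
next
  case (Suc K)
  from Suc.prems obtain p g where pg: "polyfun p" "poly_expansion (Suc K) g"
    "\<forall>s>0. \<forall>\<xi>. f s \<xi> = p \<xi> + complex_of_real s * g s \<xi>" by (subst (asm) poly_expansion.simps(2)) blast
  then show ?case using Suc.IH[OF pg(2)] by (subst poly_expansion.simps(2)) blast
qed

lemma poly_expansion_polyfun: "polyfun p \<Longrightarrow> poly_expansion K (\<lambda>s. p)"
proof (induction K arbitrary: p)
  case 0
  then show ?case by (rule poly_expansion_0_polyfun)
next
  case (Suc K)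
  have "poly_expansion K (\<lambda>s (\<xi>::real^'a). 0)" by (rule Suc.IH) (rule polyfun_const)
  with Suc.prems show ?case by (auto intro!: exI[of _ p] exI[of _ "\<lambda>s \<xi>. 0"])
qed

lemma poly_expansion_scale: "poly_expansion K f \<Longrightarrow> poly_expansion (Suc K) (\<lambda>s \<xi>. complex_of_real s * f s \<xi>)"
  unfolding poly_expansion.simps by (intro exI[of _ "\<lambda>\<xi>. 0"] exI[of _ f]) (auto intro: polyfun_const)

lemma poly_expansion_add:
  "poly_expansion K f \<Longrightarrow> poly_expansion K g \<Longrightarrow> poly_expansion K (\<lambda>s \<xi>. f s \<xi> + g s \<xi>)"
proof (induction K arbitrary: f g)
  case 0
  then show ?case by (rule poly_expansion_0_add)
next
  case (Suc K)
  from Suc.prems(1) obtain p f1 where f: "polyfun p" "poly_expansion K f1"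
    "\<And>s \<xi>. s > 0 \<Longrightarrow> f s \<xi> = p \<xi> + complex_of_real s * f1 s \<xi>" by auto
  from Suc.prems(2) obtain q g1 where g: "polyfun q" "poly_expansion K g1"
    "\<And>s \<xi>. s > 0 \<Longrightarrow> g s \<xi> = q \<xi> + complex_of_real s * g1 s \<xi>" by auto
  show ?case unfolding poly_expansion.simps
    using f g Suc.IH[OF f(2) g(2)]
    by (intro exI[of _ "\<lambda>\<xi>. p \<xi> + q \<xi>"] exI[of _ "\<lambda>s \<xi>. f1 s \<xi> + g1 s \<xi>"])
      (auto simp: algebra_simps intro: polyfun_add)
qed

lemma poly_expansion_mult:
  "poly_expansion K f \<Longrightarrow> poly_expansion K g \<Longrightarrow> poly_expansion K (\<lambda>s \<xi>. f s \<xi> * g s \<xi>)"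
proof (induction K arbitrary: f g)
  case 0
  then show ?case by (rule poly_expansion_0_mult)
next
  case (Suc K)
  from Suc.prems(1) obtain p f1 where f: "polyfun p" "poly_expansion K f1"
    "\<And>s \<xi>. s > 0 \<Longrightarrow> f s \<xi> = p \<xi> + complex_of_real s * f1 s \<xi>" by auto
  from Suc.prems(2) obtain q g1 where g: "polyfun q" "poly_expansion K g1"
    "\<And>s \<xi>. s > 0 \<Longrightarrow> g s \<xi> = q \<xi> + complex_of_real s * g1 s \<xi>" by auto
  \<comment> \<open>In \<open>(p + s f1) (q + s g1)\<close> the part after \<open>p q\<close> is
    \<open>s\<close> times \<open>p g1 + f1 g\<close>; keeping \<open>g\<close> undivided there
    collects both remaining products, and \<open>g\<close> has an expansion of the lower order
    \<open>K\<close> as well.\<close>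
  have "poly_expansion K (\<lambda>s \<xi>. p \<xi> * g1 s \<xi> + f1 s \<xi> * g s \<xi>)"
    by (intro poly_expansion_add Suc.IH f g poly_expansion_polyfun poly_expansion_SucD[OF Suc.prems(2)])
  then show ?case unfolding poly_expansion.simps
    using f g
    by (intro exI[of _ "\<lambda>\<xi>. p \<xi> * q \<xi>"] exI[of _ "\<lambda>s \<xi>. p \<xi> * g1 s \<xi> + f1 s \<xi> * g s \<xi>"])
      (auto simp: algebra_simps intro: polyfun_mult)
qed

lemma poly_expansion_const: "poly_expansion K (\<lambda>s \<xi>. c)"
  by (intro poly_expansion_polyfun polyfun_const)

lemma poly_expansion_sum:
  "(\<And>i. i \<in> I \<Longrightarrow> poly_expansion K (f i)) \<Longrightarrow> poly_expansion K (\<lambda>s \<xi>. \<Sum>i\<in>I. f i s \<xi>)"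
  by (induction I rule: infinite_finite_induct) (auto intro: poly_expansion_const poly_expansion_add)

lemma poly_expansion_prod:
  "(\<And>i. i \<in> I \<Longrightarrow> poly_expansion K (f i)) \<Longrightarrow> poly_expansion K (\<lambda>s \<xi>. \<Prod>i\<in>I. f i s \<xi>)"
  by (induction I rule: infinite_finite_induct) (auto intro: poly_expansion_const poly_expansion_mult)

lemma poly_expansion_power: "poly_expansion K f \<Longrightarrow> poly_expansion K (\<lambda>s \<xi>. f s \<xi> ^ n)"
  by (induction n) (auto intro: poly_expansion_const poly_expansion_mult)

lemma poly_expansion_s_power: "poly_expansion K (\<lambda>s \<xi>. complex_of_real s ^ n)"
proof (intro poly_expansion_power)
  show "poly_expansion K (\<lambda>s (\<xi>::real^'a). complex_of_real s)"
    using poly_expansion_SucD[OF poly_expansion_scale[OF poly_expansion_const[of K 1]]] by simp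
qed

lemma poly_expansionD:
  assumes "poly_expansion K f"
  shows "\<exists>p g. (\<forall>m. polyfun (p m)) \<and> poly_expansion 0 g \<and>
    (\<forall>s>0. \<forall>\<xi>. f s \<xi> = (\<Sum>m<K. complex_of_real s ^ m * p m \<xi>) + complex_of_real s ^ K * g s \<xi>)"
  using assms
proof (induction K arbitrary: f)
  case 0
  then show ?case by (intro exI[of _ "\<lambda>m \<xi>. 0"] exI[of _ f]) (auto intro: polyfun_const)
next
  case (Suc K)
  from Suc.prems obtain p0 f1 where f: "polyfun p0" "poly_expansion K f1"
    "\<And>s \<xi>. s > 0 \<Longrightarrow> f s \<xi> = p0 \<xi> + complex_of_real s * f1 s \<xi>" by auto
  from Suc.IH[OF f(2)] obtain p g where pg: "\<And>m. polyfun (p m)" "poly_expansion 0 g"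
    "\<And>s \<xi>. s > 0 \<Longrightarrow> f1 s \<xi> = (\<Sum>m<K. complex_of_real s ^ m * p m \<xi>) + complex_of_real s ^ K * g s \<xi>" by blast
  have "polyfun (case_nat p0 p m)" for m using f(1) pg(1) by (cases m) auto
  moreover have "f s \<xi> = (\<Sum>m<Suc K. complex_of_real s ^ m * case_nat p0 p m \<xi>) + complex_of_real s ^ Suc K * g s \<xi>"
    if "s > 0" for s \<xi>
    unfolding sum.lessThan_Suc_shift
    using f(3)[OF that, of \<xi>] pg(3)[OF that, of \<xi>] by (simp add: algebra_simps sum_distrib_left)
  ultimately show ?case using pg(2) by blast
qed

text \<open>\<open>e n\<close> is the Taylor remainder of \<open>exp\<close> after degree
  \<open>n\<close>, divided by \<open>s ^ Suc n\<close>. Since \<open>z\<close> is purely imaginary,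
  the remainder is at most \<open>norm z ^ Suc n\<close> without an exponential factor, which gives
  polynomial growth in \<open>\<xi>\<close>. Splitting off the next Taylor term turns
  \<open>e n\<close> into a monomial plus \<open>s\<close> times \<open>e (Suc n)\<close>, which is
  the recursion in \<open>poly_expansion\<close>.\<close>

lemma poly_expansion_exp_factor:
  fixes \<sigma> :: real
  shows "poly_expansion K (\<lambda>s (\<xi>::real^'d::finite). (exp (\<i> * complex_of_real (\<sigma> * (s * \<xi> $ k))) - 1) / complex_of_real s)"
proof -
  define z where "z = (\<lambda>s (\<xi>::real^'d). \<i> * complex_of_real (\<sigma> * (s * \<xi> $ k)))"
  define e where "e = (\<lambda>n s \<xi>. (exp (z s \<xi>) - (\<Sum>j\<le>n. z s \<xi> ^ j / fact j)) / complex_of_real s ^ Suc n)"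
  have e0: "poly_expansion 0 (e n)" for n
  proof (rule poly_expansion_0I)
    fix S :: real
    have "norm (e n s \<xi>) \<le> \<bar>\<sigma>\<bar> ^ Suc n * (1 + norm \<xi>) ^ Suc n" if "s \<in> {0<..S}" for s \<xi>
    proof -
      have "norm (exp (z s \<xi>) - (\<Sum>j\<le>n. z s \<xi> ^ j / fact j)) \<le> exp \<bar>Re (z s \<xi>)\<bar> * norm (z s \<xi>) ^ Suc n / fact n"
        by (rule Taylor_exp)
      also have "\<dots> \<le> norm (z s \<xi>) ^ Suc n"
      proof -
        have "norm (z s \<xi>) ^ Suc n \<le> norm (z s \<xi>) ^ Suc n * fact n"
          using mult_left_mono[OF fact_ge_1[of n, where 'a = real], of "norm (z s \<xi>) ^ Suc n"] by simp
        moreover have "Re (z s \<xi>) = 0" by (simp add: z_def)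
        ultimately show ?thesis by (simp add: pos_divide_le_eq)
      qed
      also have "\<dots> = \<bar>\<sigma>\<bar> ^ Suc n * \<bar>\<xi> $ k\<bar> ^ Suc n * s ^ Suc n"
        using that by (simp add: z_def norm_mult abs_mult power_mult_distrib mult_ac)
      also have "\<dots> \<le> \<bar>\<sigma>\<bar> ^ Suc n * (1 + norm \<xi>) ^ Suc n * s ^ Suc n"
        using component_le_norm_cart[of \<xi> k] that
        by (intro mult_right_mono mult_left_mono power_mono) auto
      finally have "norm (exp (z s \<xi>) - (\<Sum>j\<le>n. z s \<xi> ^ j / fact j)) \<le> \<bar>\<sigma>\<bar> ^ Suc n * (1 + norm \<xi>) ^ Suc n * s ^ Suc n" .
      moreover have "norm (e n s \<xi>) = norm (exp (z s \<xi>) - (\<Sum>j\<le>n. z s \<xi> ^ j / fact j)) / s ^ Suc n"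
        using that by (simp add: e_def norm_divide norm_power del: power_Suc)
      ultimately show ?thesis using that by (simp add: pos_divide_le_eq del: power_Suc)
    qed
    then show "\<exists>C\<ge>0. \<exists>N. \<forall>s\<in>{0<..S}. \<forall>\<xi>. norm (e n s \<xi>) \<le> C * (1 + norm \<xi>) ^ N"
      by (intro exI[of _ "\<bar>\<sigma>\<bar> ^ Suc n"] exI[of _ "Suc n"] conjI) auto
  qed
  have eSuc: "e n s \<xi> = (\<i> * complex_of_real \<sigma>) ^ Suc n / fact (Suc n) * complex_of_real (\<xi> $ k) ^ Suc n
      + complex_of_real s * e (Suc n) s \<xi>" if "s > 0" for n s \<xi>
  proof -
    have zpow: "z s \<xi> ^ Suc n = (\<i> * complex_of_real \<sigma>) ^ Suc n * complex_of_real (\<xi> $ k) ^ Suc n * complex_of_real s ^ Suc n"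
      by (simp add: z_def power_mult_distrib mult_ac)
    have generic: "c \<noteq> 0 \<Longrightarrow> (a * b * c / f + x) / c = a / f * b + x / c" for a b c f x :: complex
      by (simp add: add_divide_distrib)
    define X where "X = exp (z s \<xi>) - (\<Sum>j\<le>Suc n. z s \<xi> ^ j / fact j)"
    have "e n s \<xi> = ((\<i> * complex_of_real \<sigma>) ^ Suc n * complex_of_real (\<xi> $ k) ^ Suc n * complex_of_real s ^ Suc n / fact (Suc n) + X) / complex_of_real s ^ Suc n"
    proof -
      have "exp (z s \<xi>) - (\<Sum>j\<le>n. z s \<xi> ^ j / fact j) = z s \<xi> ^ Suc n / fact (Suc n) + X"
        by (simp add: X_def del: power_Suc fact_Suc)
      then show ?thesis by (simp only: e_def zpow)
    qed
    moreover have "complex_of_real s * e (Suc n) s \<xi> = X / complex_of_real s ^ Suc n"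
      using that unfolding e_def X_def[symmetric] by simp
    ultimately show ?thesis
      using generic[of "complex_of_real s ^ Suc n"] that by (simp del: power_Suc fact_Suc)
  qed
  have "poly_expansion K (e n)" for n
  proof (induction K arbitrary: n)
    case 0
    show ?case by (rule e0)
  next
    case (Suc K)
    show ?case unfolding poly_expansion.simps
      by (intro exI[of _ "\<lambda>\<xi>. (\<i> * complex_of_real \<sigma>) ^ Suc n / fact (Suc n) * complex_of_real (\<xi> $ k) ^ Suc n"]
          exI[of _ "e (Suc n)"] conjI Suc.IH polyfun_mult polyfun_const polyfun_power polyfun_coordinate)
        (use eSuc in blast)
  qed
  \<comment> \<open>The Taylor polynomial of degree \<open>0\<close> is \<open>1\<close>, so
    \<open>e 0\<close> is the quotient in the statement.\<close>
  from this[of 0] show ?thesis by (simp add: e_def z_def)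
qed

definition scaled_symbol ::
  "nat \<Rightarrow> nat \<Rightarrow> ((nat^'d::finite) \<times> (nat^'d) \<Rightarrow> complex) \<Rightarrow> real \<Rightarrow> real^'d \<Rightarrow> complex" where
  "scaled_symbol l lhat a s \<xi> = diff_symbol l lhat a (s *\<^sub>R \<xi>) / complex_of_real s ^ l"

text \<open>Each difference factor is divided by one \<open>s\<close>, which absorbs as many powers
  of \<open>s\<close> as the size of \<open>\<nu>\<close>. This size is at least \<open>l\<close>,
  so after the division by \<open>s ^ l\<close> a nonnegative power of \<open>s\<close>
  remains.\<close>

lemma poly_expansion_scaled_symbol:
  "poly_expansion K (scaled_symbol l lhat a)"
proof (rule poly_expansion_cong)
  let ?e = "\<lambda>\<sigma> k s \<xi>. (exp (\<i> * complex_of_real (\<sigma> * (s * \<xi> $ k))) - 1) / complex_of_real s"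
  let ?f = "\<lambda>s \<xi>. \<Sum>\<nu>\<in>diff_indices l lhat. a \<nu> * (complex_of_real s ^ (msize (fst \<nu>) + msize (snd \<nu>) - l) *
      (\<Prod>k\<in>UNIV. ?e (-1) k s \<xi> ^ (fst \<nu> $ k) * ?e 1 k s \<xi> ^ (snd \<nu> $ k)))"
  show "poly_expansion K ?f"
    by (intro poly_expansion_sum poly_expansion_mult poly_expansion_const poly_expansion_s_power
        poly_expansion_prod poly_expansion_power poly_expansion_exp_factor)
  show "?f s \<xi> = scaled_symbol l lhat a s \<xi>" if "s > 0" for s \<xi>
    unfolding scaled_symbol_def diff_symbol_eq sum_divide_distrib
  proof (intro sum.cong refl)
    fix \<nu> :: "(nat^'a) \<times> (nat^'a)" assume "\<nu> \<in> diff_indices l lhat"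
    then have l: "l \<le> msize (fst \<nu>) + msize (snd \<nu>)" by (auto simp: diff_indices_def)
    have "(\<Prod>k\<in>UNIV. ?e (-1) k s \<xi> ^ (fst \<nu> $ k) * ?e 1 k s \<xi> ^ (snd \<nu> $ k)) =
       (\<Prod>k\<in>UNIV. diff_factor s k \<nu> \<xi> / (complex_of_real s ^ (fst \<nu> $ k) * complex_of_real s ^ (snd \<nu> $ k)))"
      by (simp add: diff_factor_def power_divide)
    also have "\<dots> = (\<Prod>k\<in>UNIV. diff_factor s k \<nu> \<xi>) / complex_of_real s ^ (msize (fst \<nu>) + msize (snd \<nu>))"
      by (simp add: prod_dividef prod.distrib power_sum msize_def power_add)
    also have "complex_of_real s ^ (msize (fst \<nu>) + msize (snd \<nu>)) =
        complex_of_real s ^ (msize (fst \<nu>) + msize (snd \<nu>) - l) * complex_of_real s ^ l"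
      using l by (simp flip: power_add)
    finally show "a \<nu> * (complex_of_real s ^ (msize (fst \<nu>) + msize (snd \<nu>) - l) *
        (\<Prod>k\<in>UNIV. ?e (-1) k s \<xi> ^ (fst \<nu> $ k) * ?e 1 k s \<xi> ^ (snd \<nu> $ k))) =
        a \<nu> * (\<Prod>k\<in>UNIV. diff_factor s k \<nu> \<xi>) / complex_of_real s ^ l"
      using that by simp
  qed
qed

text \<open>Letting \<open>s\<close> tend to \<open>0\<close> isolates \<open>c 0\<close>; once it
  is zero, both sides can be divided by \<open>s\<close> and the argument repeats with shifted
  coefficients.\<close>

lemma expansion_coefficients_zero:
  fixes c :: "nat \<Rightarrow> complex"
  assumes "S > 0" and "\<And>s. 0 < s \<Longrightarrow> s < S \<Longrightarrow> norm (\<Sum>m<K. complex_of_real s ^ m * c m) \<le> C * s ^ K"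
    and "m < K"
  shows "c m = 0"
  using assms(2,3)
proof (induction K arbitrary: c m)
  case (Suc K)
  have "((\<lambda>s. \<Sum>m<Suc K. complex_of_real s ^ m * c m) \<longlongrightarrow> (\<Sum>m<Suc K. complex_of_real 0 ^ m * c m)) (at_right 0)"
    by (intro tendsto_intros)
  moreover have "((\<lambda>s. \<Sum>m<Suc K. complex_of_real s ^ m * c m) \<longlongrightarrow> 0) (at_right 0)"
  proof (rule Lim_null_comparison)
    show "\<forall>\<^sub>F s in at_right 0. norm (\<Sum>m<Suc K. complex_of_real s ^ m * c m) \<le> C * s ^ Suc K"
      using eventually_at_right_less[of 0] Suc.prems(1) \<open>S > 0\<close>
      by (auto simp: eventually_at_right_field intro!: exI[of _ S])
    show "((\<lambda>s. C * s ^ Suc K) \<longlongrightarrow> 0) (at_right 0)"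
      by (auto intro!: tendsto_eq_intros)
  qed
  ultimately have "(\<Sum>m<Suc K. complex_of_real 0 ^ m * c m) = 0"
    using tendsto_unique trivial_limit_at_right_real by blast
  then have c0: "c 0 = 0" by (simp add: sum.lessThan_Suc_shift del: sum.lessThan_Suc)
  have "norm (\<Sum>m<K. complex_of_real s ^ m * c (Suc m)) \<le> C * s ^ K" if "0 < s" "s < S" for s
  proof -
    have "(\<Sum>m<Suc K. complex_of_real s ^ m * c m) = complex_of_real s * (\<Sum>m<K. complex_of_real s ^ m * c (Suc m))"
      unfolding sum.lessThan_Suc_shift c0 by (simp add: sum_distrib_left mult_ac)
    then have "s * norm (\<Sum>m<K. complex_of_real s ^ m * c (Suc m)) \<le> s * (C * s ^ K)"
      using Suc.prems(1)[OF that] that by (simp add: norm_mult mult_ac)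
    then show ?thesis using that by simp
  qed
  from Suc.IH[OF this] c0 Suc.prems(2) show ?case by (cases m) auto
qed simp

section \<open>The symbol of an elliptic scheme\<close>

text \<open>The factor \<open>max 1 (exp (Re z))\<close>, without an absolute value in the exponent,
  is essential: multiplied by the size of \<open>exp w\<close> it becomes the larger of the sizes of
  \<open>exp w\<close> and \<open>exp (w + z)\<close>, and both of these are under control where the
  bound is applied.\<close>

lemma exp_Taylor_remainder:
  "norm (exp z - (\<Sum>j\<le>n. z ^ j / fact j)) \<le> max 1 (exp (Re z)) * norm z ^ Suc n"
proof -
  have "norm (exp z - (\<Sum>j\<le>n. exp 0 * (z - 0) ^ j / fact j)) \<le> max 1 (exp (Re z)) * norm (z - 0) ^ Suc n / fact n"
  proof (rule complex_Taylor[of "closed_segment 0 z" n "\<lambda>k. exp"])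
    fix x assume "x \<in> closed_segment 0 z"
    then obtain u where u: "x = complex_of_real u * z" "0 \<le> u" "u \<le> 1"
      by (auto simp: closed_segment_def scaleR_conv_of_real)
    have "u * Re z \<le> max 0 (Re z)"
      using u mult_left_le_one_le[of "Re z" u] by (cases "Re z \<ge> 0") (auto simp: mult_nonneg_nonpos)
    then have "exp (u * Re z) \<le> exp (max 0 (Re z))" by simp
    then show "norm (exp x) \<le> max 1 (exp (Re z))" by (auto simp: u max_def split: if_splits)
  next
    show "(exp has_field_derivative exp x) (at x within closed_segment 0 z)" for x
      using DERIV_exp DERIV_subset by blast
  qed auto
  also have "\<dots> \<le> max 1 (exp (Re z)) * norm z ^ Suc n"
  proof -
    have "max 1 (exp (Re z)) * norm z ^ Suc n * 1 \<le> max 1 (exp (Re z)) * norm z ^ Suc n * fact n"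
      by (intro mult_left_mono) (auto simp: fact_ge_1)
    then show ?thesis by (simp add: pos_divide_le_eq)
  qed
  finally show ?thesis by simp
qed

section \<open>Asymptotic expansions in one variable\<close>

definition asymp_expansion :: "(real \<Rightarrow> complex) \<Rightarrow> (nat \<Rightarrow> complex) \<Rightarrow> nat \<Rightarrow> bool" where
  "asymp_expansion F c K \<longleftrightarrow> (\<exists>C. \<exists>S>0. \<forall>s. 0 < s \<longrightarrow> s < S \<longrightarrow>
     norm (F s - (\<Sum>m<K. complex_of_real s ^ m * c m)) \<le> C * s ^ K)"

lemma asymp_expansionI:
  assumes "S > 0" "\<And>s. 0 < s \<Longrightarrow> s < S \<Longrightarrow> norm (F s - (\<Sum>m<K. complex_of_real s ^ m * c m)) \<le> C * s ^ K"
  shows "asymp_expansion F c K"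
  using assms unfolding asymp_expansion_def by blast

lemma asymp_expansion_cong:
  assumes "asymp_expansion F c K" "\<And>m. m < K \<Longrightarrow> c m = d m"
  shows "asymp_expansion F d K"
proof -
  have "(\<Sum>m<K. complex_of_real s ^ m * c m) = (\<Sum>m<K. complex_of_real s ^ m * d m)" for s
    using assms(2) by (intro sum.cong) auto
  with assms(1) show ?thesis by (simp add: asymp_expansion_def)
qed

lemma asymp_expansion_SucD:
  assumes "asymp_expansion F c (Suc K)"
  shows "asymp_expansion F c K"
proof -
  from assms obtain C S where S: "S > 0" and
    C: "\<And>s. 0 < s \<Longrightarrow> s < S \<Longrightarrow> norm (F s - (\<Sum>m<Suc K. complex_of_real s ^ m * c m)) \<le> C * s ^ Suc K"
    unfolding asymp_expansion_def by blast
  show ?thesis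
  proof (rule asymp_expansionI[OF S])
    fix s assume s: "0 < s" "s < S"
    have "norm (F s - (\<Sum>m<K. complex_of_real s ^ m * c m)) \<le>
        norm (F s - (\<Sum>m<Suc K. complex_of_real s ^ m * c m)) + norm (complex_of_real s ^ K * c K)"
      using norm_triangle_ineq[of "F s - (\<Sum>m<Suc K. complex_of_real s ^ m * c m)" "complex_of_real s ^ K * c K"] by simp
    also have "\<dots> \<le> \<bar>C\<bar> * s ^ Suc K + s ^ K * norm (c K)"
    proof -
      have "C * s ^ Suc K \<le> \<bar>C\<bar> * s ^ Suc K" using s by (intro mult_right_mono) auto
      with C[OF s] have "norm (F s - (\<Sum>m<Suc K. complex_of_real s ^ m * c m)) \<le> \<bar>C\<bar> * s ^ Suc K"
        by (rule order.trans)
      then show ?thesis using s by (intro add_mono) (simp_all add: norm_mult norm_power)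
    qed
    also have "\<bar>C\<bar> * s ^ Suc K \<le> \<bar>C\<bar> * (S * s ^ K)"
      using s by (intro mult_left_mono) auto
    finally show "norm (F s - (\<Sum>m<K. complex_of_real s ^ m * c m)) \<le> (\<bar>C\<bar> * S + norm (c K)) * s ^ K"
      by (simp add: algebra_simps)
  qed
qed

lemma asymp_expansion_le: "asymp_expansion F c K \<Longrightarrow> j \<le> K \<Longrightarrow> asymp_expansion F c j"
  by (induction K) (auto simp: le_Suc_eq dest: asymp_expansion_SucD)

lemma asymp_expansion_unique:
  assumes "asymp_expansion F c K" "asymp_expansion F d K" "m < K"
  shows "c m = d m"
proof -
  from assms(1) obtain C S where S: "S > 0" and
    C: "\<And>s. 0 < s \<Longrightarrow> s < S \<Longrightarrow> norm (F s - (\<Sum>m<K. complex_of_real s ^ m * c m)) \<le> C * s ^ K"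
    unfolding asymp_expansion_def by blast
  from assms(2) obtain C' S' where S': "S' > 0" and
    C': "\<And>s. 0 < s \<Longrightarrow> s < S' \<Longrightarrow> norm (F s - (\<Sum>m<K. complex_of_real s ^ m * d m)) \<le> C' * s ^ K"
    unfolding asymp_expansion_def by blast
  have "c m - d m = 0"
  proof (rule expansion_coefficients_zero[where S = "min S S'" and K = K and c = "\<lambda>m. c m - d m" and C = "C + C'"])
    fix s assume s: "0 < s" "s < min S S'"
    have "(\<Sum>m<K. complex_of_real s ^ m * (c m - d m)) =
        (F s - (\<Sum>m<K. complex_of_real s ^ m * d m)) - (F s - (\<Sum>m<K. complex_of_real s ^ m * c m))"
      by (simp add: right_diff_distrib sum_subtractf)
    then show "norm (\<Sum>m<K. complex_of_real s ^ m * (c m - d m)) \<le> (C + C') * s ^ K"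
      using norm_triangle_ineq4[of "F s - (\<Sum>m<K. complex_of_real s ^ m * d m)" "F s - (\<Sum>m<K. complex_of_real s ^ m * c m)"]
        C[of s] C'[of s] s by (simp add: ring_distribs)
  qed (use S S' assms(3) in auto)
  then show ?thesis by simp
qed

lemma bigo_power_iff:
  "f \<in> O[at_right 0](\<lambda>s. complex_of_real s ^ n) \<longleftrightarrow>
     (\<exists>C. \<exists>S>0. \<forall>s. 0 < s \<longrightarrow> s < S \<longrightarrow> norm (f s :: complex) \<le> C * s ^ n)"
proof
  assume "f \<in> O[at_right 0](\<lambda>s. complex_of_real s ^ n)"
  then obtain C where "\<forall>\<^sub>F s in at_right 0. norm (f s) \<le> C * norm (complex_of_real s ^ n)"
    by (auto elim: landau_o.bigE)
  then obtain S where "S > 0" "\<forall>s>0. s < S \<longrightarrow> norm (f s) \<le> C * s ^ n"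
    by (auto simp: eventually_at_right_field norm_power)
  then show "\<exists>C. \<exists>S>0. \<forall>s. 0 < s \<longrightarrow> s < S \<longrightarrow> norm (f s) \<le> C * s ^ n" by blast
next
  assume "\<exists>C. \<exists>S>0. \<forall>s. 0 < s \<longrightarrow> s < S \<longrightarrow> norm (f s) \<le> C * s ^ n"
  then obtain C S where "S > 0" "\<And>s. 0 < s \<Longrightarrow> s < S \<Longrightarrow> norm (f s) \<le> C * s ^ n" by blast
  then show "f \<in> O[at_right 0](\<lambda>s. complex_of_real s ^ n)"
    by (intro bigoI[of _ C]) (auto simp: eventually_at_right_field norm_power intro!: exI[of _ S])
qed

text \<open>The leading \<open>1\<close> of the defining expansion of \<open>exp_polys\<close>
  becomes the coefficient of index \<open>0\<close>, so the order \<open>K\<close> there corresponds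
  to \<open>Suc K\<close> terms here.\<close>

lemma asymp_expansion_bigo:
  "(\<lambda>s. F s - E * (1 + (\<Sum>m=1..K. complex_of_real s ^ m * p m))) \<in> O[at_right 0](\<lambda>s. complex_of_real s ^ (K + 1))
    \<longleftrightarrow> asymp_expansion F (\<lambda>m. E * (if m = 0 then 1 else p m)) (Suc K)"
proof -
  have "E * (1 + (\<Sum>m=1..K. complex_of_real s ^ m * p m)) =
      (\<Sum>m<Suc K. complex_of_real s ^ m * (E * (if m = 0 then 1 else p m)))" for s
  proof -
    have "(\<Sum>m=1..K. complex_of_real s ^ m * p m) = (\<Sum>m<K. complex_of_real s ^ Suc m * p (Suc m))"
      by (rule sum.reindex_bij_witness[of _ Suc "\<lambda>m. m - 1"]) auto
    then show ?thesis
      unfolding sum.lessThan_Suc_shift by (simp add: distrib_left sum_distrib_left mult_ac)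
  qed
  then show ?thesis unfolding bigo_power_iff asymp_expansion_def by simp
qed

lemma cube_eq_cbox: "cube r = cbox (\<chi> k. - r) (\<chi> k. r)"
  by (auto simp: cube_def mem_box_cart)

lemma mem_cube_scale: "s > 0 \<Longrightarrow> s *\<^sub>R \<xi> \<in> cube r \<longleftrightarrow> \<xi> \<in> cube (r / s)"
  by (auto simp: cube_def field_simps)

lemma mem_cubeI: "norm \<xi> \<le> r \<Longrightarrow> \<xi> \<in> cube r"
  unfolding cube_def
proof (rule CollectI, rule allI)
  fix k assume "norm \<xi> \<le> r"
  with component_le_norm_cart[of \<xi> k] have "\<bar>\<xi> $ k\<bar> \<le> r" by linarith
  then show "\<xi> $ k \<in> {- r..r}" by (auto simp: abs_le_iff)
qed

lemma compact_cube: "compact (cube r)"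
  unfolding cube_eq_cbox by (rule compact_cbox)

lemma continuous_on_diff_symbol [continuous_intros]:
  "continuous_on S f \<Longrightarrow> continuous_on S (\<lambda>x. diff_symbol l lhat a (f x))"
  unfolding diff_symbol_def case_prod_unfold by (intro continuous_intros)

lemma continuous_on_poly_eval [continuous_intros]:
  "continuous_on S f \<Longrightarrow> continuous_on S (\<lambda>x. poly_eval p (f x))"
  unfolding poly_eval_def by (intro continuous_intros)

section \<open>Lower bounds and expansions for the symbol\<close>

locale elliptic_scheme =
  fixes l lhat M :: nat
    and b :: "'d::finite cpoly"
    and a :: "(nat^'d) \<times> (nat^'d) \<Rightarrow> complex"
  assumes l_pos: "l > 0"
    and elliptic: "strongly_elliptic l b"
    and M_pos: "M \<ge> 1"
    and approx: "approximates l lhat a b M"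
    and symbol_pos: "\<And>\<theta>. \<theta> \<in> cube pi - {0} \<Longrightarrow> Re (diff_symbol l lhat a \<theta>) > 0"
begin

abbreviation "A \<equiv> diff_symbol l lhat a"
abbreviation "B \<equiv> scaled_symbol l lhat a"
abbreviation "P \<equiv> poly_eval b"
abbreviation "Q k \<equiv> poly_eval (exp_polys l lhat a b k)"

lemma scaled_symbol_approx: "\<exists>C>0. \<forall>s>0. norm (B s \<xi> - P \<xi>) \<le> C * s ^ M"
  using approximates_symbol[OF approx, of \<xi>] unfolding scaled_symbol_def .

lemma scaled_symbol_tendsto: "((\<lambda>s. B s \<xi>) \<longlongrightarrow> P \<xi>) (at_right 0)"
proof -
  obtain C where C: "\<And>s. s > 0 \<Longrightarrow> norm (B s \<xi> - P \<xi>) \<le> C * s ^ M" using scaled_symbol_approx by blast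
  have "((\<lambda>s. B s \<xi> - P \<xi>) \<longlongrightarrow> 0) (at_right 0)"
  proof (rule Lim_null_comparison)
    show "\<forall>\<^sub>F s in at_right 0. norm (B s \<xi> - P \<xi>) \<le> C * s ^ M"
      using C by (auto simp: eventually_at_right_field intro!: exI[of _ 1])
    show "((\<lambda>s. C * s ^ M) \<longlongrightarrow> 0) (at_right 0)"
      using M_pos by (auto intro!: tendsto_eq_intros)
  qed
  then show ?thesis by (rule LIM_zero_cancel)
qed

text \<open>The algebraic expansion controls the error uniformly in \<open>\<xi>\<close> but leaves
  its leading polynomial unknown; the pointwise limit as \<open>s\<close> tends to \<open>0\<close>
  identifies that polynomial with \<open>P\<close>.\<close>

lemma scaled_symbol_error:
  "\<exists>g. poly_expansion K g \<and> (\<forall>s>0. \<forall>\<xi>. B s \<xi> = P \<xi> + complex_of_real s * g s \<xi>)"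
proof -
  obtain p g where g: "poly_expansion K g" "\<And>s \<xi>. s > 0 \<Longrightarrow> B s \<xi> = p \<xi> + complex_of_real s * g s \<xi>"
    using poly_expansion_scaled_symbol[of "Suc K" l lhat a] by auto
  have "p \<xi> = P \<xi>" for \<xi>
  proof -
    obtain C N where "C \<ge> 0" and C: "\<And>s \<xi>. s \<in> {0<..1} \<Longrightarrow> norm (g s \<xi>) \<le> C * (1 + norm \<xi>) ^ N"
      by (rule poly_expansion_0E[OF poly_expansion_imp_0[OF g(1)], where S = 1]) auto
    have "((\<lambda>s. B s \<xi> - p \<xi>) \<longlongrightarrow> 0) (at_right 0)"
    proof (rule Lim_null_comparison)
      show "\<forall>\<^sub>F s in at_right 0. norm (B s \<xi> - p \<xi>) \<le> s * (C * (1 + norm \<xi>) ^ N)"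
        using C[of _ \<xi>] g(2) by (auto simp: eventually_at_right_field norm_mult intro!: exI[of _ 1])
      show "((\<lambda>s. s * (C * (1 + norm \<xi>) ^ N)) \<longlongrightarrow> 0) (at_right 0)"
        by (auto intro!: tendsto_eq_intros)
    qed
    then have "((\<lambda>s. B s \<xi>) \<longlongrightarrow> p \<xi>) (at_right 0)" by (rule LIM_zero_cancel)
    then show ?thesis using scaled_symbol_tendsto tendsto_unique trivial_limit_at_right_real by blast
  qed
  then have "\<forall>s>0. \<forall>\<xi>. B s \<xi> = P \<xi> + complex_of_real s * g s \<xi>" using g(2) by simp
  with g(1) show ?thesis by blast
qed

text \<open>Near the origin write \<open>\<theta>\<close> as \<open>s\<close> times a unit vector:
  then \<open>A \<theta>\<close> is \<open>s ^ l\<close> times a small perturbation of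
  \<open>P\<close> on the unit sphere, and ellipticity applies. Away from the origin the quotient of
  \<open>Re (A \<theta>)\<close> by \<open>norm \<theta> ^ l\<close> attains a positive minimum on a
  compact set.\<close>

lemma symbol_lower_bound: "\<exists>c>0. \<forall>\<theta>\<in>cube pi. c * norm \<theta> ^ l \<le> Re (A \<theta>)"
proof -
  obtain c0 where c0: "c0 > 0" "\<And>\<xi>. c0 * norm \<xi> ^ l \<le> Re (P \<xi>)"
    using elliptic unfolding strongly_elliptic_def by blast
  obtain g where g: "poly_expansion 0 g" "\<And>s \<xi>. s > 0 \<Longrightarrow> B s \<xi> = P \<xi> + complex_of_real s * g s \<xi>"
    using scaled_symbol_error by blast
  obtain C N where C: "C \<ge> 0" "\<And>s \<xi>. s \<in> {0<..1} \<Longrightarrow> norm (g s \<xi>) \<le> C * (1 + norm \<xi>) ^ N"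
    by (rule poly_expansion_0E[OF g(1), where S = 1]) auto
  \<comment> \<open>On the unit sphere \<open>1 + norm \<xi>\<close> is \<open>2\<close>, so the
    perturbation is at most \<open>s * (C * 2 ^ N)\<close>; the choice of \<open>\<delta>\<close>
    makes it at most half of the ellipticity constant. The added \<open>1\<close> keeps the
    denominator positive when \<open>C = 0\<close>.\<close>
  define \<delta> where "\<delta> = min 1 (c0 / (2 * (C * 2 ^ N + 1)))"
  have D: "C * 2 ^ N + 1 > 0" using C(1) by (simp add: add_nonneg_pos)
  then have \<delta>: "\<delta> > 0" "\<delta> \<le> 1" using c0 by (auto simp: \<delta>_def)
  have near: "c0 / 2 * norm \<theta> ^ l \<le> Re (A \<theta>)" if "norm \<theta> \<le> \<delta>" "\<theta> \<noteq> 0" for \<theta>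
  proof -
    define s where "s = norm \<theta>"
    define \<xi> where "\<xi> = (1 / s) *\<^sub>R \<theta>"
    have s: "0 < s" "s \<le> \<delta>" "s \<in> {0<..1}" using that \<delta> by (auto simp: s_def)
    have \<xi>: "norm \<xi> = 1" "s *\<^sub>R \<xi> = \<theta>" using s by (auto simp: \<xi>_def s_def)
    have "s * norm (g s \<xi>) \<le> s * (C * 2 ^ N + 1)"
      using C(2)[OF s(3), of \<xi>] s \<xi>(1) by (intro mult_left_mono) auto
    also have "\<dots> \<le> c0 / 2"
    proof -
      have "s \<le> c0 / (2 * (C * 2 ^ N + 1))" using s(2) by (simp add: \<delta>_def)
      then show ?thesis using D by (simp add: field_simps)
    qed
    finally have "\<bar>Re (complex_of_real s * g s \<xi>)\<bar> \<le> c0 / 2"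
      using abs_Re_le_cmod[of "complex_of_real s * g s \<xi>"] s by (simp add: norm_mult)
    moreover have "Re (B s \<xi>) = Re (P \<xi>) + Re (complex_of_real s * g s \<xi>)"
      unfolding g(2)[OF s(1)] by simp
    ultimately have "c0 / 2 \<le> Re (B s \<xi>)" using c0(2)[of \<xi>] \<xi>(1) by simp
    also have "Re (B s \<xi>) = Re (A \<theta>) / s ^ l"
      unfolding scaled_symbol_def \<xi>(2) by (simp flip: of_real_power)
    finally show ?thesis using s(1) by (simp add: field_simps s_def)
  qed
  define F where "F = (cube pi :: (real^'d) set) \<inter> {\<theta>. \<delta> \<le> norm \<theta>}"
  have F: "compact F" unfolding F_def
    by (intro compact_Int_closed compact_cube closed_Collect_le continuous_intros)
  have "\<exists>c1>0. \<forall>\<theta>\<in>F. c1 * norm \<theta> ^ l \<le> Re (A \<theta>)"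
  proof (cases "F = {}")
    case False
    have "continuous_on F (\<lambda>\<theta>. Re (A \<theta>) / norm \<theta> ^ l)"
      using \<delta> by (intro continuous_intros) (auto simp: F_def)
    from continuous_attains_inf[OF F False this] obtain \<theta>0 where
      \<theta>0: "\<theta>0 \<in> F" "\<And>\<theta>. \<theta> \<in> F \<Longrightarrow> Re (A \<theta>0) / norm \<theta>0 ^ l \<le> Re (A \<theta>) / norm \<theta> ^ l" by blast
    have "\<theta>0 \<in> cube pi - {0}" using \<theta>0(1) \<delta> by (auto simp: F_def)
    then have "Re (A \<theta>0) / norm \<theta>0 ^ l > 0"
      using symbol_pos[of \<theta>0] by (intro divide_pos_pos) auto
    moreover have "Re (A \<theta>0) / norm \<theta>0 ^ l * norm \<theta> ^ l \<le> Re (A \<theta>)" if "\<theta> \<in> F" for \<theta>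
    proof -
      have "0 < norm \<theta>" using that \<delta> unfolding F_def by (auto simp: )
      then show ?thesis using \<theta>0(2)[OF that] by (simp add: pos_le_divide_eq)
    qed
    ultimately show ?thesis by blast
  qed (auto intro: exI[of _ 1])
  then obtain c1 where c1: "c1 > 0" "\<And>\<theta>. \<theta> \<in> F \<Longrightarrow> c1 * norm \<theta> ^ l \<le> Re (A \<theta>)" by blast
  \<comment> \<open>\<open>symbol_pos\<close> excludes the origin; the inequality there is the limit
    of \<open>near\<close> along a coordinate axis, and any axis will do.\<close>
  have A0: "0 \<le> Re (A 0)"
  proof -
    define u :: "real^'d" where "u = axis undefined 1"
    have u: "norm u = 1" by (simp add: u_def)
    have "continuous_on UNIV (\<lambda>s. Re (A (s *\<^sub>R u)))" by (intro continuous_intros)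
    then have "((\<lambda>s. Re (A (s *\<^sub>R u))) \<longlongrightarrow> Re (A (0 *\<^sub>R u))) (at_right 0)"
      by (intro continuous_on_tendsto_compose[where f = "\<lambda>s. Re (A (s *\<^sub>R u))" and g = "\<lambda>s. s"] tendsto_ident_at) auto
    moreover have "\<forall>\<^sub>F s in at_right 0. 0 \<le> Re (A (s *\<^sub>R u))"
    proof -
      have "0 \<le> Re (A (s *\<^sub>R u))" if "0 < s" "s < \<delta>" for s
      proof -
        have "0 \<le> c0 / 2 * norm (s *\<^sub>R u) ^ l" using c0(1) by simp
        also have "\<dots> \<le> Re (A (s *\<^sub>R u))" using that u by (intro near) auto
        finally show ?thesis .
      qed
      then show ?thesis using \<delta>(1) by (auto simp: eventually_at_right_field)
    qed
    ultimately have "0 \<le> Re (A (0 *\<^sub>R u))"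
      by (rule tendsto_lowerbound) simp
    then show ?thesis by simp
  qed
  show ?thesis
  proof (intro exI[of _ "min (c0 / 2) c1"] conjI ballI)
    show "min (c0 / 2) c1 > 0" using c0 c1 by simp
    fix \<theta> :: "real^'d" assume "\<theta> \<in> cube pi"
    show "min (c0 / 2) c1 * norm \<theta> ^ l \<le> Re (A \<theta>)"
    proof (cases "\<theta> = 0")
      case True
      then show ?thesis using A0 l_pos by (simp add: zero_power)
    next
      case False
      have m: "min (c0 / 2) c1 * norm \<theta> ^ l \<le> c0 / 2 * norm \<theta> ^ l" "min (c0 / 2) c1 * norm \<theta> ^ l \<le> c1 * norm \<theta> ^ l"
        by (intro mult_right_mono; simp)+
      show ?thesis
      proof (cases "norm \<theta> \<le> \<delta>")
        case True
        from m(1) near[OF True False] show ?thesis by (rule order.trans)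
      next
        case False
        then have "\<theta> \<in> F" using \<open>\<theta> \<in> cube pi\<close> by (auto simp: F_def)
        from m(2) c1(2)[OF this] show ?thesis by (rule order.trans)
      qed
    qed
  qed
qed

text \<open>One constant for both symbols, so that \<open>exp (- P \<xi>)\<close> and, on the cube,
  \<open>exp (- B s \<xi>)\<close> have the same majorant.\<close>

definition c0 :: real where
  "c0 = (SOME c. c > 0 \<and> (\<forall>\<theta>\<in>cube pi. c * norm \<theta> ^ l \<le> Re (A \<theta>)) \<and> (\<forall>\<xi>. c * norm \<xi> ^ l \<le> Re (P \<xi>)))"

lemma c0: "c0 > 0" "\<theta> \<in> cube pi \<Longrightarrow> c0 * norm \<theta> ^ l \<le> Re (A \<theta>)" "c0 * norm \<xi> ^ l \<le> Re (P \<xi>)"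
proof -
  obtain c1 where c1: "c1 > 0" "\<And>\<theta>. \<theta> \<in> cube pi \<Longrightarrow> c1 * norm \<theta> ^ l \<le> Re (A \<theta>)"
    using symbol_lower_bound by blast
  obtain c2 where c2: "c2 > 0" "\<And>\<xi>. c2 * norm \<xi> ^ l \<le> Re (P \<xi>)"
    using elliptic unfolding strongly_elliptic_def by blast
  have "min c1 c2 * norm \<theta> ^ l \<le> c1 * norm \<theta> ^ l" "min c1 c2 * norm \<theta> ^ l \<le> c2 * norm \<theta> ^ l" for \<theta> :: "real^'d"
    by (intro mult_right_mono; simp)+
  then have "min c1 c2 > 0 \<and> (\<forall>\<theta>\<in>cube pi. min c1 c2 * norm \<theta> ^ l \<le> Re (A \<theta>)) \<and> (\<forall>\<xi>. min c1 c2 * norm \<xi> ^ l \<le> Re (P \<xi>))"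
    using c1 c2 by (intro conjI ballI allI) (simp, (rule order.trans, assumption, blast)+)
  then have "\<exists>c. c > 0 \<and> (\<forall>\<theta>\<in>cube pi. c * norm \<theta> ^ l \<le> Re (A \<theta>)) \<and> (\<forall>\<xi>. c * norm \<xi> ^ l \<le> Re (P \<xi>))"
    by (rule exI)
  from someI_ex[OF this]
  show "c0 > 0" "\<theta> \<in> cube pi \<Longrightarrow> c0 * norm \<theta> ^ l \<le> Re (A \<theta>)" "c0 * norm \<xi> ^ l \<le> Re (P \<xi>)"
    unfolding c0_def[symmetric] by auto
qed

lemma scaled_symbol_lower_bound:
  assumes "s > 0" "\<xi> \<in> cube (pi / s)"
  shows "c0 * norm \<xi> ^ l \<le> Re (B s \<xi>)"
proof -
  have "c0 * norm (s *\<^sub>R \<xi>) ^ l \<le> Re (A (s *\<^sub>R \<xi>))"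
    using assms by (intro c0) (simp add: mem_cube_scale)
  moreover have "Re (B s \<xi>) = Re (A (s *\<^sub>R \<xi>)) / s ^ l"
    unfolding scaled_symbol_def by (simp flip: of_real_power)
  moreover have "norm (s *\<^sub>R \<xi>) ^ l = norm \<xi> ^ l * s ^ l"
    using assms(1) by (simp add: power_mult_distrib)
  ultimately show ?thesis using assms(1) by (simp add: pos_le_divide_eq mult.assoc)
qed

text \<open>With \<open>- B = - P + E\<close> and \<open>E\<close> of order \<open>s\<close>, expand
  \<open>exp E\<close> to degree \<open>K\<close>. The Taylor remainder carries
  \<open>norm (E s \<xi>) ^ Suc K\<close>, and the Taylor polynomial has itself an expansion in
  \<open>s\<close> whose tail carries \<open>s ^ Suc K\<close>. The coefficients \<open>q\<close>
  still depend on \<open>K\<close>.\<close>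

lemma exp_scaled_symbol_expansion:
  "\<exists>q. (\<forall>m. polyfun (q m)) \<and> (\<forall>S>0. \<exists>C\<ge>0. \<exists>N. \<forall>s\<in>{0<..S}. \<forall>\<xi>\<in>cube (pi / s).
     norm (exp (- B s \<xi>) - exp (- P \<xi>) * (\<Sum>m\<le>K. complex_of_real s ^ m * q m \<xi>))
       \<le> C * s ^ Suc K * (1 + norm \<xi>) ^ N * exp (- c0 * norm \<xi> ^ l))"
proof -
  obtain g where g: "poly_expansion (Suc K) g" "\<And>s \<xi>. s > 0 \<Longrightarrow> B s \<xi> = P \<xi> + complex_of_real s * g s \<xi>"
    using scaled_symbol_error by blast
  define E where "E = (\<lambda>s \<xi>. - complex_of_real s * g s \<xi>)"
  define T where "T = (\<lambda>s \<xi>. \<Sum>j\<le>K. E s \<xi> ^ j * (1 / fact j))"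
  have "poly_expansion (Suc K) E"
  proof (rule poly_expansion_cong)
    show "poly_expansion (Suc K) (\<lambda>s \<xi>. (-1) * (complex_of_real s ^ 1 * g s \<xi>))"
      by (intro poly_expansion_mult poly_expansion_const poly_expansion_s_power g)
  qed (simp add: E_def)
  then have "poly_expansion (Suc K) T"
    unfolding T_def by (intro poly_expansion_sum poly_expansion_mult poly_expansion_power poly_expansion_const)
  from poly_expansionD[OF this] obtain q h where q: "\<And>m. polyfun (q m)" and h: "poly_expansion 0 h"
    and T: "\<And>s \<xi>. s > 0 \<Longrightarrow> T s \<xi> = (\<Sum>m<Suc K. complex_of_real s ^ m * q m \<xi>) + complex_of_real s ^ Suc K * h s \<xi>"
    by blast
  have "\<exists>C\<ge>0. \<exists>N. \<forall>s\<in>{0<..S}. \<forall>\<xi>\<in>cube (pi / s).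
     norm (exp (- B s \<xi>) - exp (- P \<xi>) * (\<Sum>m\<le>K. complex_of_real s ^ m * q m \<xi>))
       \<le> C * s ^ Suc K * (1 + norm \<xi>) ^ N * exp (- c0 * norm \<xi> ^ l)" for S :: real
  proof -
    \<comment> \<open>Both error sources are put into one sum of nonnegative terms, so that a single
      pair \<open>C\<close>, \<open>N\<close> bounds them together.\<close>
    have "poly_expansion 0 (\<lambda>s \<xi>. complex_of_real (norm (g s \<xi>) ^ Suc K + norm (h s \<xi>)))"
    proof -
      have "poly_expansion 0 (\<lambda>s \<xi>. complex_of_real (norm (g s \<xi>)))" "poly_expansion 0 (\<lambda>s \<xi>. complex_of_real (norm (h s \<xi>)))"
        using h poly_expansion_imp_0[OF g(1)] by simp_all
      then show ?thesis unfolding of_real_add of_real_power by (intro poly_expansion_0_add poly_expansion_power)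
    qed
    then obtain C N where C: "C \<ge> 0" "\<And>s \<xi>. s \<in> {0<..S} \<Longrightarrow>
        norm (complex_of_real (norm (g s \<xi>) ^ Suc K + norm (h s \<xi>))) \<le> C * (1 + norm \<xi>) ^ N"
      by (rule poly_expansion_0E[where S = S]) auto
    have "norm (exp (- B s \<xi>) - exp (- P \<xi>) * (\<Sum>m\<le>K. complex_of_real s ^ m * q m \<xi>))
       \<le> C * s ^ Suc K * (1 + norm \<xi>) ^ N * exp (- c0 * norm \<xi> ^ l)"
      if s: "s \<in> {0<..S}" and \<xi>: "\<xi> \<in> cube (pi / s)" for s \<xi>
    proof -
      have s0: "s > 0" using s by simp
      have BE: "- B s \<xi> = - P \<xi> + E s \<xi>" using g(2)[OF s0] by (simp add: E_def)
      \<comment> \<open>\<open>E\<close> need not be bounded in \<open>\<xi>\<close>, so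
        \<open>exp (Re (E s \<xi>))\<close> cannot be estimated alone; its product with
        \<open>exp (- P \<xi>)\<close> has the size of \<open>exp (- B s \<xi>)\<close>. Here the
        cube condition on \<open>\<xi>\<close> enters.\<close>
      have m: "norm (exp (- P \<xi>)) * max 1 (exp (Re (E s \<xi>))) \<le> exp (- c0 * norm \<xi> ^ l)"
      proof -
        have "norm (exp (- P \<xi>)) * max 1 (exp (Re (E s \<xi>))) = max (exp (- Re (P \<xi>))) (exp (- Re (P \<xi>)) * exp (Re (E s \<xi>)))"
          by (simp add: max_mult_distrib_left)
        also have "exp (- Re (P \<xi>)) * exp (Re (E s \<xi>)) = exp (- Re (B s \<xi>))"
          using arg_cong[OF BE, of Re] by (simp flip: exp_add)
        finally show ?thesis using c0(3)[of \<xi>] scaled_symbol_lower_bound[OF s0 \<xi>] by simp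
      qed
      have eq: "exp (- B s \<xi>) - exp (- P \<xi>) * (\<Sum>m\<le>K. complex_of_real s ^ m * q m \<xi>) =
          exp (- P \<xi>) * (exp (E s \<xi>) - (\<Sum>j\<le>K. E s \<xi> ^ j / fact j)) + exp (- P \<xi>) * (complex_of_real s ^ Suc K * h s \<xi>)"
        unfolding BE exp_add using T[OF s0, of \<xi>] by (simp add: T_def lessThan_Suc_atMost algebra_simps)
      have "norm (exp (- P \<xi>) * (exp (E s \<xi>) - (\<Sum>j\<le>K. E s \<xi> ^ j / fact j))) \<le>
          norm (exp (- P \<xi>)) * (max 1 (exp (Re (E s \<xi>))) * norm (E s \<xi>) ^ Suc K)"
        unfolding norm_mult by (intro mult_left_mono exp_Taylor_remainder) auto
      also have "\<dots> = (norm (exp (- P \<xi>)) * max 1 (exp (Re (E s \<xi>)))) * norm (E s \<xi>) ^ Suc K" by simp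
      also have "\<dots> \<le> exp (- c0 * norm \<xi> ^ l) * norm (E s \<xi>) ^ Suc K"
        by (intro mult_right_mono m) auto
      also have "norm (E s \<xi>) ^ Suc K = s ^ Suc K * norm (g s \<xi>) ^ Suc K"
        using s0 by (simp add: E_def norm_mult power_mult_distrib)
      finally have 1: "norm (exp (- P \<xi>) * (exp (E s \<xi>) - (\<Sum>j\<le>K. E s \<xi> ^ j / fact j))) \<le>
          exp (- c0 * norm \<xi> ^ l) * (s ^ Suc K * norm (g s \<xi>) ^ Suc K)" .
      have 2: "norm (exp (- P \<xi>) * (complex_of_real s ^ Suc K * h s \<xi>)) \<le> exp (- c0 * norm \<xi> ^ l) * (s ^ Suc K * norm (h s \<xi>))"
        unfolding norm_mult using c0(3)[of \<xi>] s0 by (intro mult_mono) (auto simp: norm_power norm_mult)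
      have "norm (exp (- B s \<xi>) - exp (- P \<xi>) * (\<Sum>m\<le>K. complex_of_real s ^ m * q m \<xi>)) \<le>
          exp (- c0 * norm \<xi> ^ l) * s ^ Suc K * (norm (g s \<xi>) ^ Suc K + norm (h s \<xi>))"
        unfolding eq using norm_triangle_ineq[of "exp (- P \<xi>) * (exp (E s \<xi>) - (\<Sum>j\<le>K. E s \<xi> ^ j / fact j))"
            "exp (- P \<xi>) * (complex_of_real s ^ Suc K * h s \<xi>)"] 1 2 by (simp add: distrib_left mult.assoc)
      also have "\<dots> \<le> exp (- c0 * norm \<xi> ^ l) * s ^ Suc K * (C * (1 + norm \<xi>) ^ N)"
      proof (rule mult_left_mono)
        show "norm (g s \<xi>) ^ Suc K + norm (h s \<xi>) \<le> C * (1 + norm \<xi>) ^ N"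
          using C(2)[OF s, of \<xi>] unfolding norm_of_real by linarith
      qed (use s0 in auto)
      finally show ?thesis by (simp add: mult_ac)
    qed
    then show ?thesis using C(1) by blast
  qed
  then show ?thesis using q by blast
qed

text \<open>Identifies the coefficients, and in particular shows that \<open>exp_polys\<close> is not a junk choice.\<close>

lemma exp_polys_expansion:
  "asymp_expansion (\<lambda>s. exp (- B s \<xi>)) (\<lambda>m. exp (- P \<xi>) * (if m = 0 then 1 else Q m \<xi>)) (Suc K)"
  "S > 0 \<Longrightarrow> \<exists>C\<ge>0. \<exists>N. \<forall>s\<in>{0<..S}. \<forall>\<xi>\<in>cube (pi / s).
     norm (exp (- B s \<xi>) - exp (- P \<xi>) * (\<Sum>m\<le>K. complex_of_real s ^ m * (if m = 0 then 1 else Q m \<xi>)))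
       \<le> C * s ^ Suc K * (1 + norm \<xi>) ^ N * exp (- c0 * norm \<xi> ^ l)"
proof -
  let ?F = "\<lambda>\<xi> s. exp (- B s \<xi>)"
  define R where "R = (\<lambda>K q. \<forall>S>0. \<exists>C\<ge>0. \<exists>N. \<forall>s\<in>{0<..S}. \<forall>\<xi>\<in>cube (pi / s).
     norm (exp (- B s \<xi>) - exp (- P \<xi>) * (\<Sum>m\<le>K. complex_of_real s ^ m * q m \<xi>))
       \<le> C * s ^ Suc K * (1 + norm \<xi>) ^ N * exp (- c0 * norm \<xi> ^ l))"
  have "\<forall>K. \<exists>q. (\<forall>m. polyfun (q m)) \<and> R K q"
    unfolding R_def using exp_scaled_symbol_expansion by (rule allI)
  from choice[OF this] obtain q where qR: "\<forall>K. (\<forall>m. polyfun (q K m)) \<and> R K (q K)" ..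
  then have q: "polyfun (q K m)" and bnd: "R K (q K)" for K m by blast+
  note bnd = bnd[unfolded R_def, rule_format]
  have asy: "asymp_expansion (?F \<xi>) (\<lambda>m. exp (- P \<xi>) * q K m \<xi>) (Suc K)" for K \<xi>
  proof -
    \<comment> \<open>For \<open>s\<close> below this bound the fixed \<open>\<xi>\<close> lies in
      \<open>cube (pi / s)\<close>, so the uniform estimate yields an expansion at that
      \<open>\<xi>\<close>.\<close>
    define S where "S = pi / (1 + norm \<xi>)"
    have S: "S > 0" by (simp add: S_def add_pos_nonneg)
    obtain C N where C: "\<forall>s\<in>{0<..S}. \<forall>\<xi>\<in>cube (pi / s).
     norm (exp (- B s \<xi>) - exp (- P \<xi>) * (\<Sum>m\<le>K. complex_of_real s ^ m * q K m \<xi>))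
       \<le> C * s ^ Suc K * (1 + norm \<xi>) ^ N * exp (- c0 * norm \<xi> ^ l)" using bnd[OF S, of K] by (elim exE conjE)
    note C = bspec[OF bspec[OF C]]
    show ?thesis
    proof (rule asymp_expansionI[OF S])
      fix s assume s: "0 < s" "s < S"
      have "\<xi> \<in> cube (pi / s)"
      proof (rule mem_cubeI)
        have "s * (1 + norm \<xi>) < pi" using s(2) by (simp add: S_def pos_less_divide_eq add_pos_nonneg)
        then show "norm \<xi> \<le> pi / s" using s(1) by (simp add: field_simps)
      qed
      then show "norm (?F \<xi> s - (\<Sum>m<Suc K. complex_of_real s ^ m * (exp (- P \<xi>) * q K m \<xi>))) \<le>
         (C * (1 + norm \<xi>) ^ N * exp (- c0 * norm \<xi> ^ l)) * s ^ Suc K"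
        using C[of s \<xi>] s by (simp add: lessThan_Suc_atMost sum_distrib_left mult_ac del: sum.lessThan_Suc)
    qed
  qed
  \<comment> \<open>The coefficient of order zero is read off from the limit
    \<open>s \<rightarrow> 0\<close> by continuity of \<open>exp\<close>.\<close>
  have q0: "q K 0 \<xi> = 1" for K \<xi>
  proof -
    from asymp_expansion_le[OF asy, of 1 K \<xi>] obtain C S where S: "S > 0" and
      C: "\<And>s. 0 < s \<Longrightarrow> s < S \<Longrightarrow> norm (?F \<xi> s - exp (- P \<xi>) * q K 0 \<xi>) \<le> C * s"
      unfolding asymp_expansion_def by auto
    have "((\<lambda>s. ?F \<xi> s - exp (- P \<xi>) * q K 0 \<xi>) \<longlongrightarrow> 0) (at_right 0)"
    proof (rule Lim_null_comparison)
      show "\<forall>\<^sub>F s in at_right 0. norm (?F \<xi> s - exp (- P \<xi>) * q K 0 \<xi>) \<le> C * s"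
        using C S by (auto simp: eventually_at_right_field)
    qed (auto intro!: tendsto_eq_intros)
    moreover have "((\<lambda>s. ?F \<xi> s - exp (- P \<xi>) * q K 0 \<xi>) \<longlongrightarrow> exp (- P \<xi>) - exp (- P \<xi>) * q K 0 \<xi>) (at_right 0)"
      by (intro tendsto_intros scaled_symbol_tendsto)
    ultimately have "exp (- P \<xi>) - exp (- P \<xi>) * q K 0 \<xi> = 0"
      using tendsto_unique trivial_limit_at_right_real by blast
    then show ?thesis by simp
  qed
  \<comment> \<open>The families found for different \<open>K\<close> agree by uniqueness of
    coefficients. The diagonal \<open>q m m\<close> is therefore a single family that serves all
    \<open>K\<close>, as the choice in \<open>exp_polys\<close> demands.\<close>
  have q_eq: "q K m \<xi> = q m m \<xi>" if "m \<le> K" for K m \<xi>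
    using asymp_expansion_unique[OF asymp_expansion_le[OF asy[of \<xi> K]] asy[of \<xi> m], of m] that by simp
  have "\<forall>m. \<exists>p. q m m = poly_eval p" using q unfolding polyfun_def by simp
  from choice[OF this] obtain p where p: "\<And>m. q m m = poly_eval (p m)" by blast
  have p_asy: "asymp_expansion (?F \<xi>) (\<lambda>m. exp (- P \<xi>) * (if m = 0 then 1 else poly_eval (p m) \<xi>)) (Suc K)" for \<xi> K
  proof (rule asymp_expansion_cong[OF asy[of \<xi> K]])
    fix m assume "m < Suc K"
    then have "q K m \<xi> = q m m \<xi>" by (intro q_eq) simp
    then have "q K m \<xi> = (if m = 0 then 1 else poly_eval (p m) \<xi>)" unfolding p[symmetric] by (simp add: q0)
    then show "exp (- P \<xi>) * q K m \<xi> = exp (- P \<xi>) * (if m = 0 then 1 else poly_eval (p m) \<xi>)" by simp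
  qed
  have "\<exists>p. \<forall>K \<xi>. (\<lambda>s::real. exp (- diff_symbol l lhat a (s *\<^sub>R \<xi>) / complex_of_real s ^ l)
        - exp (- poly_eval b \<xi>) * (1 + (\<Sum>m=1..K. complex_of_real s ^ m * poly_eval (p m) \<xi>)))
     \<in> O[at_right 0](\<lambda>s. complex_of_real s ^ (K + 1))"
    using p_asy unfolding asymp_expansion_bigo by (intro exI[of _ p]) (simp add: scaled_symbol_def)
  from someI_ex[OF this, folded exp_polys_def]
  have Q_asy: "asymp_expansion (?F \<xi>) (\<lambda>m. exp (- P \<xi>) * (if m = 0 then 1 else Q m \<xi>)) (Suc K)" for K \<xi>
    unfolding asymp_expansion_bigo by (simp add: scaled_symbol_def)
  then show "asymp_expansion (\<lambda>s. exp (- B s \<xi>)) (\<lambda>m. exp (- P \<xi>) * (if m = 0 then 1 else Q m \<xi>)) (Suc K)" .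
  have "q K m \<xi> = (if m = 0 then 1 else Q m \<xi>)" if "m \<le> K" for m K \<xi>
    using asymp_expansion_unique[OF asy[of \<xi> K] Q_asy[of \<xi> K], of m] that by auto
  then have "(\<Sum>m\<le>K. complex_of_real s ^ m * q K m \<xi>) = (\<Sum>m\<le>K. complex_of_real s ^ m * (if m = 0 then 1 else Q m \<xi>))" for s \<xi>
    by (intro sum.cong) auto
  then show "S > 0 \<Longrightarrow> \<exists>C\<ge>0. \<exists>N. \<forall>s\<in>{0<..S}. \<forall>\<xi>\<in>cube (pi / s).
     norm (exp (- B s \<xi>) - exp (- P \<xi>) * (\<Sum>m\<le>K. complex_of_real s ^ m * (if m = 0 then 1 else Q m \<xi>)))
       \<le> C * s ^ Suc K * (1 + norm \<xi>) ^ N * exp (- c0 * norm \<xi> ^ l)"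
    using bnd[of S K] by simp
qed

text \<open>Since \<open>P - B\<close> is of order \<open>s ^ M\<close>, the function
  \<open>exp (- B)\<close> equals \<open>exp (- P)\<close> up to that order; this is an expansion
  with \<open>M\<close> terms whose higher coefficients vanish, and coefficients are unique.\<close>

lemma exp_polys_zero:
  assumes "1 \<le> m" "m < M"
  shows "Q m \<xi> = 0"
proof -
  obtain C where C: "C > 0" "\<And>s. s > 0 \<Longrightarrow> norm (B s \<xi> - P \<xi>) \<le> C * s ^ M" using scaled_symbol_approx by blast
  have "asymp_expansion (\<lambda>s. exp (- B s \<xi>)) (\<lambda>m. if m = 0 then exp (- P \<xi>) else 0) M"
  proof (rule asymp_expansionI[of 1])
    fix s :: real assume s: "0 < s" "s < 1"
    have "(\<Sum>m<M. complex_of_real s ^ m * (if m = 0 then exp (- P \<xi>) else 0)) = (\<Sum>m<M. if m = 0 then exp (- P \<xi>) else 0)"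
      by (intro sum.cong) auto
    also have "\<dots> = exp (- P \<xi>)" using M_pos by simp
    finally have "exp (- B s \<xi>) - (\<Sum>m<M. complex_of_real s ^ m * (if m = 0 then exp (- P \<xi>) else 0)) =
        exp (- P \<xi>) * (exp (P \<xi> - B s \<xi>) - (\<Sum>j\<le>0. (P \<xi> - B s \<xi>) ^ j / fact j))"
      by (simp add: right_diff_distrib flip: exp_add)
    also have "norm \<dots> \<le> norm (exp (- P \<xi>)) * (max 1 (exp (Re (P \<xi> - B s \<xi>))) * norm (P \<xi> - B s \<xi>) ^ Suc 0)"
      unfolding norm_mult by (intro mult_left_mono exp_Taylor_remainder) auto
    also have "\<dots> \<le> norm (exp (- P \<xi>)) * (exp C * (C * s ^ M))"
    proof (intro mult_left_mono mult_mono)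
      have n: "norm (P \<xi> - B s \<xi>) \<le> C * s ^ M" using C(2)[OF s(1)] by (simp add: norm_minus_commute)
      then show "norm (P \<xi> - B s \<xi>) ^ Suc 0 \<le> C * s ^ M" by simp
      have "C * s ^ M \<le> C * 1" using s C(1) by (intro mult_left_mono power_le_one) auto
      with n have "Re (P \<xi> - B s \<xi>) \<le> C" using complex_Re_le_cmod[of "P \<xi> - B s \<xi>"] by linarith
      then show "max 1 (exp (Re (P \<xi> - B s \<xi>))) \<le> exp C" using C(1) by simp
    qed auto
    finally show "norm (exp (- B s \<xi>) - (\<Sum>m<M. complex_of_real s ^ m * (if m = 0 then exp (- P \<xi>) else 0))) \<le>
        (norm (exp (- P \<xi>)) * exp C * C) * s ^ M" by (simp add: mult_ac)
  qed simp
  from asymp_expansion_unique[OF asymp_expansion_le[OF exp_polys_expansion(1)[of \<xi> M]] this, of m] assms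
  show ?thesis by simp
qed

end

section \<open>Uniqueness of the Green function\<close>

text \<open>
  The solution is only known to be bounded for each single time. By the Baire category theorem the
  set of times near which it is not bounded uniformly, if nonempty, contains a relatively open
  piece on which it is; as it at most doubles in short gaps of this set, this piece would be empty.
\<close>

locale pointwise_bounded_system =
  fixes X :: "'i set" and w w' :: "'i \<Rightarrow> real \<Rightarrow> complex" and L :: real
  assumes L: "L \<ge> 0"
    and cont: "\<And>x. x \<in> X \<Longrightarrow> continuous_on {0..} (w x)"
    and der: "\<And>x t. x \<in> X \<Longrightarrow> t > 0 \<Longrightarrow> (w x has_vector_derivative w' x t) (at t)"
    and bnd: "\<And>x t C. x \<in> X \<Longrightarrow> t > 0 \<Longrightarrow> (\<forall>y\<in>X. norm (w y t) \<le> C) \<Longrightarrow> norm (w' x t) \<le> L * C"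
    and fin: "\<And>t. t \<ge> 0 \<Longrightarrow> \<exists>C. \<forall>x\<in>X. norm (w x t) \<le> C"
begin

lemma difference_bound:
  assumes "0 \<le> s" "s \<le> t" "\<And>\<tau> x. s \<le> \<tau> \<Longrightarrow> \<tau> \<le> t \<Longrightarrow> x \<in> X \<Longrightarrow> norm (w x \<tau>) \<le> C" "x \<in> X"
  shows "norm (w x t - w x s) \<le> L * C * (t - s)"
proof (cases "s = t")
  case False
  then have "s < t" using assms by simp
  then have "norm (w x t - w x s) \<le> L * C * t - L * C * s"
  proof (rule differentiable_bound_general[where f' = "w' x" and \<phi>' = "\<lambda>_. L * C"])
    show "continuous_on {s..t} (w x)" using assms by (intro continuous_on_subset[OF cont]) auto
    show "continuous_on {s..t} (\<lambda>t. L * C * t)" by (intro continuous_intros)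
    fix \<tau> assume \<tau>: "s < \<tau>" "\<tau> < t"
    then show "(w x has_vector_derivative w' x \<tau>) (at \<tau>)" using assms by (intro der) auto
    show "((\<lambda>t. L * C * t) has_vector_derivative L * C) (at \<tau>)"
      by (auto intro!: derivative_eq_intros)
    show "norm (w' x \<tau>) \<le> L * C" using assms \<tau> by (intro bnd) auto
  qed
  then show ?thesis by (simp add: algebra_simps)
qed simp

text \<open>A bound \<open>D\<close> on the whole segment improves to \<open>G + D / 2\<close>,
  because the derivative is at most \<open>L * D\<close> and \<open>L\<close> times the length is at
  most \<open>1 / 2\<close>. Iteration converges to the fixed point \<open>2 * G\<close>, in which
  the a priori bound \<open>C\<close> no longer appears.\<close>

lemma doubling:
  assumes s: "0 \<le> s" "0 \<le> t" "L * \<bar>t - s\<bar> \<le> 1 / 2"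
    and C: "\<And>\<tau> x. \<tau> \<in> closed_segment s t \<Longrightarrow> x \<in> X \<Longrightarrow> norm (w x \<tau>) \<le> C"
    and G: "\<And>x. x \<in> X \<Longrightarrow> norm (w x s) \<le> G" and x: "x \<in> X"
  shows "norm (w x t) \<le> 2 * G"
proof -
  have G0: "0 \<le> G" using G[OF x] norm_ge_zero order.trans by blast
  have "0 \<le> C" using C[of s x] x norm_ge_zero order.trans ends_in_segment(1) by blast
  have iter: "\<forall>\<tau>\<in>closed_segment s t. \<forall>x\<in>X. norm (w x \<tau>) \<le> 2 * G + C / 2 ^ n" for n
  proof (induction n)
    case 0
    show ?case using C G0 by (fastforce intro: add_increasing)
  next
    case (Suc n)
    define D where "D = 2 * G + C / 2 ^ n"
    have D0: "0 \<le> D" using G0 \<open>0 \<le> C\<close> by (simp add: D_def)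
    show ?case
    proof (intro ballI)
      fix \<tau> x assume \<tau>: "\<tau> \<in> closed_segment s t" and x: "x \<in> X"
      have sub: "closed_segment s \<tau> \<subseteq> closed_segment s t" using \<tau> by (simp add: subset_closed_segment)
      have "norm (w x \<tau> - w x s) \<le> L * D * \<bar>\<tau> - s\<bar>"
      proof (cases "s \<le> \<tau>")
        case True
        have "norm (w x \<tau> - w x s) \<le> L * D * (\<tau> - s)"
          using True s x sub Suc.IH unfolding D_def[symmetric]
          by (intro difference_bound) (auto simp: closed_segment_eq_real_ivl)
        then show ?thesis using True by simp
      next
        case False
        have "norm (w x s - w x \<tau>) \<le> L * D * (s - \<tau>)"
          using False s \<tau> x sub Suc.IH unfolding D_def[symmetric]
          by (intro difference_bound) (auto simp: closed_segment_eq_real_ivl split: if_splits)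
        then show ?thesis using False by (simp add: norm_minus_commute)
      qed
      also have "\<dots> = D * (L * \<bar>\<tau> - s\<bar>)" by simp
      also have "\<dots> \<le> D * (1 / 2)"
      proof (rule mult_left_mono[OF _ D0])
        have "\<bar>\<tau> - s\<bar> \<le> \<bar>t - s\<bar>" using \<tau> by (auto simp: closed_segment_eq_real_ivl split: if_splits)
        then have "L * \<bar>\<tau> - s\<bar> \<le> L * \<bar>t - s\<bar>" using L by (rule mult_left_mono)
        then show "L * \<bar>\<tau> - s\<bar> \<le> 1 / 2" using s by simp
      qed
      finally have "norm (w x \<tau>) \<le> G + D / 2"
        using G[OF x] norm_triangle_ineq[of "w x \<tau> - w x s" "w x s"] by simp
      then show "norm (w x \<tau>) \<le> 2 * G + C / 2 ^ Suc n" by (simp add: D_def field_simps)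
    qed
  qed
  have "(\<lambda>n. 2 * G + C / 2 ^ n) \<longlonglongrightarrow> 2 * G + 0"
    by (intro tendsto_intros LIMSEQ_divide_realpow_zero) auto
  moreover have "norm (w x t) \<le> 2 * G + C / 2 ^ n" for n using iter x by blast
  ultimately show ?thesis using LIMSEQ_le_const[of _ "2 * G" "norm (w x t)"] by auto
qed

text \<open>Boundedness is required at nonnegative times near \<open>t\<close>, so negative times
  are good trivially and the bad times form a closed subset of the whole line.\<close>

definition good :: "real \<Rightarrow> bool" where
  "good t \<longleftrightarrow> (\<exists>\<delta>>0. \<exists>C. \<forall>s\<ge>0. \<bar>s - t\<bar> < \<delta> \<longrightarrow> (\<forall>x\<in>X. norm (w x s) \<le> C))"

lemma uniform_bound:
  assumes "0 \<le> a" "a \<le> b" "\<And>t. a \<le> t \<Longrightarrow> t \<le> b \<Longrightarrow> good t"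
  shows "\<exists>C. \<forall>t\<in>{a..b}. \<forall>x\<in>X. norm (w x t) \<le> C"
proof -
  \<comment> \<open>\<open>Bolzano\<close> speaks of arbitrary intervals; the premise on the left
    end keeps negative times, where \<open>w\<close> is not controlled, out of the claim.\<close>
  define R where "R = (\<lambda>a b. 0 \<le> a \<longrightarrow> (\<exists>C. \<forall>t\<in>{a..b}. \<forall>x\<in>X. norm (w x t) \<le> C))"
  have "R a b"
  proof (rule Bolzano)
    fix a b c assume ab: "R a b" and bc: "R b c" and le: "a \<le> b" "b \<le> c"
    show "R a c" unfolding R_def
    proof
      assume "0 \<le> a"
      then obtain C C' where "\<forall>t\<in>{a..b}. \<forall>x\<in>X. norm (w x t) \<le> C" "\<forall>t\<in>{b..c}. \<forall>x\<in>X. norm (w x t) \<le> C'"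
        using ab bc le unfolding R_def by (meson order.trans)
      then have "\<forall>t\<in>{a..c}. \<forall>x\<in>X. norm (w x t) \<le> max C C'"
        by (metis atLeastAtMost_iff linear max.coboundedI1 max.coboundedI2)
      then show "\<exists>C. \<forall>t\<in>{a..c}. \<forall>x\<in>X. norm (w x t) \<le> C" ..
    qed
  next
    fix t assume "a \<le> t" "t \<le> b"
    then obtain \<delta> C where \<delta>: "\<delta> > 0" "\<And>s x. s \<ge> 0 \<Longrightarrow> \<bar>s - t\<bar> < \<delta> \<Longrightarrow> x \<in> X \<Longrightarrow> norm (w x s) \<le> C"
      using assms(3)[of t] unfolding good_def by blast
    have "R a' b'" if "a' \<le> t \<and> t \<le> b' \<and> b' - a' < \<delta>" for a' b'
      unfolding R_def by (intro impI exI[of _ C] ballI \<delta>(2)) (use that in auto)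
    with \<delta>(1) show "\<exists>d>0. \<forall>a' b'. a' \<le> t \<and> t \<le> b' \<and> b' - a' < d \<longrightarrow> R a' b'" by blast
  qed fact
  then show ?thesis using assms by (simp add: R_def)
qed

text \<open>The end \<open>u\<close> may be bad, so no uniform bound up to \<open>u\<close> is
  given. From \<open>s\<close> back to any other point \<open>\<tau>\<close> of the segment all
  times are good, hence \<open>doubling\<close> started at \<open>s\<close> applies and gives
  \<open>2 * C\<close>, independent of \<open>\<tau>\<close>. This is the a priori bound that a
  second use of \<open>doubling\<close>, now started at \<open>u\<close>, requires.\<close>

lemma gap_bound:
  assumes u: "0 \<le> u" "0 \<le> s" "L * \<bar>s - u\<bar> \<le> 1 / 2"
    and good: "\<And>\<tau>. \<tau> \<in> closed_segment u s \<Longrightarrow> \<tau> \<noteq> u \<Longrightarrow> good \<tau>"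
    and G: "\<And>x. x \<in> X \<Longrightarrow> norm (w x u) \<le> G" and x: "x \<in> X"
  shows "norm (w x s) \<le> 2 * G"
proof -
  obtain C where C: "\<And>x. x \<in> X \<Longrightarrow> norm (w x s) \<le> C" using fin[of s] u by blast
  have *: "norm (w x \<tau>) \<le> 2 * C" if \<tau>: "\<tau> \<in> closed_segment u s" "\<tau> \<noteq> u" and x: "x \<in> X" for \<tau> x
  proof -
    have "good t" if "t \<in> closed_segment s \<tau>" for t
      using that \<tau> by (intro good) (auto simp: closed_segment_eq_real_ivl split: if_splits)
    moreover have "closed_segment s \<tau> = {min s \<tau>..max s \<tau>}" by (auto simp: closed_segment_eq_real_ivl)
    moreover have "0 \<le> \<tau>" using \<tau> u by (auto simp: closed_segment_eq_real_ivl split: if_splits)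
    ultimately have "\<exists>D. \<forall>t\<in>{min s \<tau>..max s \<tau>}. \<forall>x\<in>X. norm (w x t) \<le> D"
      using u by (intro uniform_bound) auto
    then obtain D where D: "\<And>t x. t \<in> closed_segment s \<tau> \<Longrightarrow> x \<in> X \<Longrightarrow> norm (w x t) \<le> D"
      unfolding \<open>closed_segment s \<tau> = {min s \<tau>..max s \<tau>}\<close> by blast
    have "\<bar>\<tau> - s\<bar> \<le> \<bar>s - u\<bar>" using \<tau> by (auto simp: closed_segment_eq_real_ivl split: if_splits)
    then have "L * \<bar>\<tau> - s\<bar> \<le> L * \<bar>s - u\<bar>" using L by (rule mult_left_mono)
    then show ?thesis using \<open>0 \<le> \<tau>\<close> u x C D by (intro doubling[of s \<tau> D C]) auto
  qed
  have "norm (w x \<tau>) \<le> max (2 * C) G" if "\<tau> \<in> closed_segment u s" "x \<in> X" for \<tau> x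
    using *[OF that(1) _ that(2)] G[OF that(2)] by (cases "\<tau> = u") auto
  then show ?thesis using u G x by (intro doubling[of u s "max (2 * C) G" G]) auto
qed

lemma all_good: "good t"
proof (rule ccontr)
  assume "\<not> good t"
  define bad where "bad = {t. \<not> good t}"
  have "open {t. good t}"
    unfolding open_dist
  proof (intro ballI)
    fix t assume "t \<in> {t. good t}"
    then obtain \<delta> C where \<delta>: "\<delta> > 0" "\<And>s x. s \<ge> 0 \<Longrightarrow> \<bar>s - t\<bar> < \<delta> \<Longrightarrow> x \<in> X \<Longrightarrow> norm (w x s) \<le> C"
      unfolding good_def by blast
    have "good y" if "dist y t < \<delta> / 2" for y
    proof -
      have "\<forall>s\<ge>0. \<bar>s - y\<bar> < \<delta> / 2 \<longrightarrow> (\<forall>x\<in>X. norm (w x s) \<le> C)"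
      proof (intro allI impI ballI)
        fix s x assume s: "0 \<le> s" "\<bar>s - y\<bar> < \<delta> / 2" and x: "x \<in> X"
        then have "\<bar>s - t\<bar> < \<delta>" using that unfolding dist_real_def by linarith
        then show "norm (w x s) \<le> C" by (rule \<delta>(2)[OF s(1) _ x])
      qed
      then show ?thesis unfolding good_def using half_gt_zero[OF \<delta>(1)] by blast
    qed
    then show "\<exists>e>0. \<forall>y. dist y t < e \<longrightarrow> y \<in> {t. good t}" using \<delta>(1) by (intro exI[of _ "\<delta> / 2"]) auto
  qed
  then have closed_bad: "closed bad" unfolding bad_def closed_def by (simp add: Compl_eq)
  have bad_pos: "t \<ge> 0" if "t \<in> bad" for t
  proof (rule ccontr)
    assume "\<not> t \<ge> 0"
    then have "\<forall>s\<ge>0. \<bar>s - t\<bar> < - t \<longrightarrow> (\<forall>x\<in>X. norm (w x s) \<le> 0)" by auto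
    with \<open>\<not> t \<ge> 0\<close> have "good t" unfolding good_def by (intro exI[of _ "- t"]) auto
    with that show False by (simp add: bad_def)
  qed
  define E where "E = (\<lambda>n::nat. {t\<in>{0..}. \<forall>x\<in>X. norm (w x t) \<le> real n})"
  have "closed (E n)" for n
  proof -
    have "E n = {0..} \<inter> (\<Inter>x\<in>X. {t\<in>{0..}. norm (w x t) \<le> real n})" by (auto simp: E_def)
    moreover have "closed {t\<in>{0..}. norm (w x t) \<le> real n}" if "x \<in> X" for x
    proof -
      have "{t\<in>{0..}. norm (w x t) \<le> real n} = {0..} \<inter> (\<lambda>t. norm (w x t)) -` {..real n}" by auto
      moreover have "closed ({0..} \<inter> (\<lambda>t. norm (w x t)) -` {..real n})"
        by (intro continuous_closed_preimage continuous_on_norm cont[OF that]) auto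
      ultimately show ?thesis by simp
    qed
    ultimately show ?thesis by (auto intro!: closed_Int closed_INT)
  qed
  then have "openin (top_of_set bad) (bad - E n)" for n
    by (simp add: Diff_eq openin_open_Int open_Compl)
  \<comment> \<open>If every \<open>bad - E n\<close> were dense in \<open>bad\<close>, so would be
    their intersection by Baire. It is empty, since at each time the solution is bounded by some
    natural number. Hence some \<open>E n\<close> contains all bad times close to some bad
    \<open>p\<close>.\<close>
  moreover have "\<exists>n. \<not> bad \<subseteq> closure (bad - E n)"
  proof (rule ccontr)
    assume "\<nexists>n. \<not> bad \<subseteq> closure (bad - E n)"
    with calculation have "bad \<subseteq> closure (\<Inter>n. bad - E n)"
      by (intro Baire[OF closed_bad]) auto
    moreover have "(\<Inter>n. bad - E n) = {}"
    proof -
      have "\<exists>n. t \<in> E n" if t: "t \<in> bad" for t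
      proof -
        obtain C where "\<forall>x\<in>X. norm (w x t) \<le> C" using fin[OF bad_pos[OF t]] by blast
        moreover obtain n where "C \<le> real n" using real_arch_simple by blast
        ultimately show ?thesis using bad_pos[OF t] by (auto simp: E_def intro: order.trans)
      qed
      then show ?thesis by blast
    qed
    ultimately have "bad \<subseteq> closure {}" by (simp only:)
    then show False using \<open>\<not> good t\<close> by (simp add: bad_def)
  qed
  then obtain n p where p: "p \<in> bad" "p \<notin> closure (bad - E n)" by blast
  then obtain e where e: "e > 0" "\<And>y. y \<in> bad \<Longrightarrow> \<bar>y - p\<bar> < e \<Longrightarrow> y \<in> E n"
    unfolding closure_approachable dist_real_def by blast
  \<comment> \<open>\<open>e\<close> keeps bad times inside \<open>E n\<close>; the other term makes
    \<open>L * h \<le> 1 / 2\<close> for lengths up to \<open>\<delta>\<close>, as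
    \<open>doubling\<close> demands, with \<open>L + 1\<close> to admit
    \<open>L = 0\<close>.\<close>
  define \<delta> where "\<delta> = min e (1 / (2 * (L + 1)))"
  have \<delta>: "\<delta> > 0" "\<delta> \<le> e" using e(1) L by (auto simp: \<delta>_def)
  have L\<delta>: "L * h \<le> 1 / 2" if "h \<le> \<delta>" "0 \<le> h" for h
  proof -
    have "h \<le> 1 / (2 * (L + 1))" using that by (simp add: \<delta>_def)
    then have "h * (2 * (L + 1)) \<le> 1" using L by (simp add: pos_le_divide_eq)
    then show ?thesis using that by (simp add: algebra_simps)
  qed
  have "norm (w x s) \<le> 2 * real n" if s: "0 \<le> s" "\<bar>s - p\<bar> < \<delta>" and x: "x \<in> X" for s x
  proof -
    \<comment> \<open>\<open>u\<close> will be the bad time between \<open>p\<close> and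
      \<open>s\<close> that is farthest from \<open>p\<close>. It belongs to \<open>E n\<close>, and
      the rest of the way to \<open>s\<close> consists of good times, so \<open>gap_bound\<close>
      applies with \<open>G = n\<close>.\<close>
    have "compact (bad \<inter> closed_segment p s)" using closed_bad by (intro closed_Int_compact) auto
    moreover have "bad \<inter> closed_segment p s \<noteq> {}" using p(1) by auto
    moreover have "continuous_on (bad \<inter> closed_segment p s) (\<lambda>y. \<bar>y - p\<bar>)" by (intro continuous_intros)
    ultimately have "\<exists>u\<in>bad \<inter> closed_segment p s. \<forall>y\<in>bad \<inter> closed_segment p s. \<bar>y - p\<bar> \<le> \<bar>u - p\<bar>"
      by (rule continuous_attains_sup)
    then obtain u where u: "u \<in> bad" "u \<in> closed_segment p s"
      and max: "\<And>y. y \<in> bad \<Longrightarrow> y \<in> closed_segment p s \<Longrightarrow> \<bar>y - p\<bar> \<le> \<bar>u - p\<bar>"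
      by blast
    have "\<bar>u - p\<bar> < \<delta>" "\<bar>s - u\<bar> \<le> \<delta>"
      using u(2) s by (auto simp: closed_segment_eq_real_ivl split: if_splits)
    then have "u \<in> E n" using e(2) u(1) \<delta>(2) by simp
    show ?thesis
    proof (rule gap_bound[of u s])
      show "0 \<le> u" using u(1) by (rule bad_pos)
      show "L * \<bar>s - u\<bar> \<le> 1 / 2" using \<open>\<bar>s - u\<bar> \<le> \<delta>\<close> by (intro L\<delta>) auto
      show "good \<tau>" if "\<tau> \<in> closed_segment u s" "\<tau> \<noteq> u" for \<tau>
      proof (rule ccontr)
        assume "\<not> good \<tau>"
        then have "\<tau> \<in> bad" by (simp add: bad_def)
        moreover have "\<tau> \<in> closed_segment p s" "\<bar>u - p\<bar> < \<bar>\<tau> - p\<bar>"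
          using that u(2) by (auto simp: closed_segment_eq_real_ivl split: if_splits)
        ultimately show False using max[of \<tau>] by simp
      qed
    qed (use \<open>u \<in> E n\<close> s x in \<open>auto simp: E_def\<close>)
  qed
  then have "good p" unfolding good_def using \<delta>(1) by blast
  with p(1) show False by (simp add: bad_def)
qed

text \<open>With uniform bounds on compact intervals available, \<open>doubling\<close> with
  \<open>G = 0\<close> carries the zero initial value across one step of length \<open>h\<close>;
  the step length does not shrink, so every time is reached.\<close>

lemma eq_zero:
  assumes init: "\<And>x. x \<in> X \<Longrightarrow> w x 0 = 0" and t: "t \<ge> 0" and x: "x \<in> X"
  shows "w x t = 0"
proof -
  define h where "h = 1 / (2 * (L + 1))"
  have h: "h > 0" "L * h \<le> 1 / 2" using L by (auto simp: h_def field_simps)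
  have "\<forall>t\<in>{0..real k * h}. \<forall>x\<in>X. w x t = 0" for k
  proof (induction k)
    case 0
    then show ?case using init by auto
  next
    case (Suc k)
    show ?case
    proof (intro ballI)
      fix t x assume t: "t \<in> {0..real (Suc k) * h}" and x: "x \<in> X"
      show "w x t = 0"
      proof (cases "t \<le> real k * h")
        case True
        then show ?thesis using Suc.IH t x by auto
      next
        case False
        have k0: "0 \<le> real k * h" using h by simp
        have "\<exists>C. \<forall>\<tau>\<in>{real k * h..t}. \<forall>x\<in>X. norm (w x \<tau>) \<le> C"
          by (rule uniform_bound[OF k0]) (use False all_good in auto)
        then obtain C where C: "\<And>\<tau> x. \<tau> \<in> {real k * h..t} \<Longrightarrow> x \<in> X \<Longrightarrow> norm (w x \<tau>) \<le> C" by blast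
        have "L * (t - real k * h) \<le> L * h" using t L by (intro mult_left_mono) (auto simp: algebra_simps)
        then have "norm (w x t) \<le> 2 * 0"
          using k0 False x C Suc.IH h(2) by (intro doubling[of "real k * h" t C 0]) (auto simp: closed_segment_eq_real_ivl)
        then show ?thesis by simp
      qed
    qed
  qed
  moreover obtain k where "t / h \<le> real k" using real_arch_simple by blast
  then have "t \<le> real k * h" using h by (simp add: pos_divide_le_eq)
  ultimately show ?thesis using t x by auto
qed

end

text \<open>Stated for differences of two functions, so that composition is immediate without a
  detour through linearity. The bound is assumed on \<open>X\<close> only, which also expresses that
  the operator sees no values outside the grid.\<close>

definition lipschitz_operator :: "'a set \<Rightarrow> (('a \<Rightarrow> complex) \<Rightarrow> 'a \<Rightarrow> complex) \<Rightarrow> bool" where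
  "lipschitz_operator X T \<longleftrightarrow> (\<exists>C\<ge>0. \<forall>u v B. (\<forall>x\<in>X. norm (u x - v x) \<le> B) \<longrightarrow>
     (\<forall>x\<in>X. norm (T u x - T v x) \<le> C * B))"

lemma lipschitz_operatorI:
  assumes "C \<ge> 0" "\<And>u v B x. (\<And>x. x \<in> X \<Longrightarrow> norm (u x - v x) \<le> B) \<Longrightarrow> x \<in> X \<Longrightarrow> norm (T u x - T v x) \<le> C * B"
  shows "lipschitz_operator X T"
  unfolding lipschitz_operator_def
proof (intro exI[of _ C] conjI allI impI ballI)
  fix u v :: "'a \<Rightarrow> complex" and B x assume *: "\<forall>x\<in>X. norm (u x - v x) \<le> B" and x: "x \<in> X"
  show "norm (T u x - T v x) \<le> C * B" by (rule assms(2)[OF bspec[OF *] x])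
qed fact

lemma lipschitz_operator_id: "lipschitz_operator X id"
  by (rule lipschitz_operatorI[of 1]) auto

lemma lipschitz_operator_comp:
  assumes "lipschitz_operator X S" "lipschitz_operator X T"
  shows "lipschitz_operator X (S \<circ> T)"
proof -
  obtain C where "C \<ge> 0" and C: "\<forall>u v B. (\<forall>x\<in>X. norm (u x - v x) \<le> B) \<longrightarrow> (\<forall>x\<in>X. norm (S u x - S v x) \<le> C * B)"
    using assms(1) unfolding lipschitz_operator_def by blast
  obtain D where "D \<ge> 0" and D: "\<forall>u v B. (\<forall>x\<in>X. norm (u x - v x) \<le> B) \<longrightarrow> (\<forall>x\<in>X. norm (T u x - T v x) \<le> D * B)"
    using assms(2) unfolding lipschitz_operator_def by blast
  show ?thesis
  proof (rule lipschitz_operatorI[of "C * D"])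
    fix u v :: "'a \<Rightarrow> complex" and B x assume *: "\<And>x. x \<in> X \<Longrightarrow> norm (u x - v x) \<le> B" and x: "x \<in> X"
    have "norm (S (T u) x - S (T v) x) \<le> C * (D * B)" by (rule C[rule_format, OF D[rule_format, OF *] x])
    then show "norm ((S \<circ> T) u x - (S \<circ> T) v x) \<le> C * D * B" by (simp add: mult.assoc)
  qed (use \<open>C \<ge> 0\<close> \<open>D \<ge> 0\<close> in simp)
qed

lemma lipschitz_operator_funpow: "lipschitz_operator X T \<Longrightarrow> lipschitz_operator X (T ^^ n)"
  by (induction n) (simp_all only: funpow.simps lipschitz_operator_id lipschitz_operator_comp)

lemma lipschitz_operator_op_prod:
  assumes "\<And>k. lipschitz_operator X (T k)"
  shows "lipschitz_operator X (op_prod T)"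
proof -
  have "lipschitz_operator X (foldr (\<lambda>k S. T k \<circ> S) ks id)" for ks
  proof (induction ks)
    case Nil
    show ?case using lipschitz_operator_id[of X] by (simp add: id_def)
  next
    case (Cons k ks)
    have "foldr (\<lambda>k S. T k \<circ> S) (k # ks) id = T k \<circ> foldr (\<lambda>k S. T k \<circ> S) ks id" by simp
    then show ?case using lipschitz_operator_comp[OF assms Cons.IH] by metis
  qed
  then show ?thesis by (simp add: op_prod_def)
qed

lemma lipschitz_operator_shift:
  assumes "\<And>x. x \<in> X \<Longrightarrow> f x \<in> X"
  shows "lipschitz_operator X (\<lambda>u y. u (f y) - u y)"
proof (rule lipschitz_operatorI[of 2])
  fix u v :: "'a \<Rightarrow> complex" and B x assume *: "\<And>x. x \<in> X \<Longrightarrow> norm (u x - v x) \<le> B" and x: "x \<in> X"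
  have "norm (u (f x) - u x - (v (f x) - v x)) = norm ((u (f x) - v (f x)) - (u x - v x))" by (simp add: algebra_simps)
  also have "\<dots> \<le> norm (u (f x) - v (f x)) + norm (u x - v x)" by (rule norm_triangle_ineq4)
  finally show "norm (u (f x) - u x - (v (f x) - v x)) \<le> 2 * B" using *[OF x] *[OF assms[OF x]] by simp
qed simp

lemma grid_shift:
  assumes "x \<in> grid \<epsilon>"
  shows "x + \<epsilon> *\<^sub>R axis k 1 \<in> grid \<epsilon>" "x - \<epsilon> *\<^sub>R axis k 1 \<in> grid \<epsilon>"
proof -
  have "x + (\<epsilon> * of_int n) *\<^sub>R axis k 1 \<in> grid \<epsilon>" for n
    unfolding grid_def
  proof (rule CollectI, rule allI)
    fix j
    from assms obtain m :: int where "x $ j = \<epsilon> * of_int m" by (auto simp: grid_def)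
    then have "(x + (\<epsilon> * of_int n) *\<^sub>R axis k 1) $ j = \<epsilon> * of_int (if j = k then m + n else m)"
      by (auto simp: axis_def algebra_simps)
    then show "\<exists>m::int. (x + (\<epsilon> * of_int n) *\<^sub>R axis k 1) $ j = \<epsilon> * of_int m" by blast
  qed
  from this[of 1] this[of "-1"] show "x + \<epsilon> *\<^sub>R axis k 1 \<in> grid \<epsilon>" "x - \<epsilon> *\<^sub>R axis k 1 \<in> grid \<epsilon>" by auto
qed

lemma lipschitz_operator_diff_op:
  "lipschitz_operator (grid \<epsilon>) (diff_op l lhat a \<epsilon>)"
proof -
  have "lipschitz_operator (grid \<epsilon>) (op_prod (\<lambda>k. (diff_minus \<epsilon> k ^^ (\<mu> $ k)) \<circ> (diff_plus \<epsilon> k ^^ (\<kappa> $ k))))" for \<mu> \<kappa> :: "nat^'a"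
    unfolding diff_minus_def diff_plus_def
    by (intro lipschitz_operator_op_prod lipschitz_operator_comp lipschitz_operator_funpow lipschitz_operator_shift grid_shift)
  then have "\<forall>\<nu>::(nat^'a) \<times> (nat^'a). \<exists>C. C \<ge> 0 \<and> (\<forall>u v B. (\<forall>x\<in>grid \<epsilon>. norm (u x - v x) \<le> B) \<longrightarrow> (\<forall>x\<in>grid \<epsilon>.
      norm (op_prod (\<lambda>k. (diff_minus \<epsilon> k ^^ (fst \<nu> $ k)) \<circ> (diff_plus \<epsilon> k ^^ (snd \<nu> $ k))) u x -
       op_prod (\<lambda>k. (diff_minus \<epsilon> k ^^ (fst \<nu> $ k)) \<circ> (diff_plus \<epsilon> k ^^ (snd \<nu> $ k))) v x) \<le> C * B))"
    unfolding lipschitz_operator_def by blast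
  from choice[OF this] obtain C :: "(nat^'a) \<times> (nat^'a) \<Rightarrow> real" where C: "\<forall>\<nu>. C \<nu> \<ge> 0 \<and> (\<forall>u v B. (\<forall>x\<in>grid \<epsilon>. norm (u x - v x) \<le> B) \<longrightarrow> (\<forall>x\<in>grid \<epsilon>.
      norm (op_prod (\<lambda>k. (diff_minus \<epsilon> k ^^ (fst \<nu> $ k)) \<circ> (diff_plus \<epsilon> k ^^ (snd \<nu> $ k))) u x -
       op_prod (\<lambda>k. (diff_minus \<epsilon> k ^^ (fst \<nu> $ k)) \<circ> (diff_plus \<epsilon> k ^^ (snd \<nu> $ k))) v x) \<le> C \<nu> * B))" ..
  then have C0: "C \<nu> \<ge> 0" for \<nu> by blast
  note C = spec[OF C, THEN conjunct2, rule_format]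
  show ?thesis
  proof (rule lipschitz_operatorI)
    let ?I = "diff_indices l lhat :: ((nat^'a) \<times> (nat^'a)) set"
    let ?D = "norm (1 / complex_of_real \<epsilon> ^ l) * (\<Sum>\<nu>\<in>?I. norm (a \<nu>) * C \<nu>)"
    show "0 \<le> ?D" using C0 by (intro mult_nonneg_nonneg sum_nonneg) auto
    fix u v :: "real^'a \<Rightarrow> complex" and B and x :: "real^'a" assume *: "\<And>x. x \<in> grid \<epsilon> \<Longrightarrow> norm (u x - v x) \<le> B" and x: "x \<in> grid \<epsilon>"
    let ?T = "\<lambda>\<nu> u. op_prod (\<lambda>k. (diff_minus \<epsilon> k ^^ (fst \<nu> $ k)) \<circ> (diff_plus \<epsilon> k ^^ (snd \<nu> $ k))) u x"
    have eq: "norm (diff_op l lhat a \<epsilon> u x - diff_op l lhat a \<epsilon> v x) =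
        norm (1 / complex_of_real \<epsilon> ^ l) * norm (\<Sum>\<nu>\<in>?I. a \<nu> * (?T \<nu> u - ?T \<nu> v))"
      unfolding diff_op_def case_prod_unfold prod.collapse
      by (simp only: right_diff_distrib[symmetric] sum_subtractf[symmetric] norm_mult)
    have le: "norm (\<Sum>\<nu>\<in>?I. a \<nu> * (?T \<nu> u - ?T \<nu> v)) \<le> (\<Sum>\<nu>\<in>?I. norm (a \<nu>) * (C \<nu> * B))"
      by (intro sum_norm_le) (auto simp: norm_mult intro!: mult_left_mono C * x)
    have sum: "(\<Sum>\<nu>\<in>?I. norm (a \<nu>) * (C \<nu> * B)) = (\<Sum>\<nu>\<in>?I. norm (a \<nu>) * C \<nu>) * B"
      by (simp add: sum_distrib_right mult.assoc)
    show "norm (diff_op l lhat a \<epsilon> u x - diff_op l lhat a \<epsilon> v x) \<le> ?D * B"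
      unfolding eq mult.assoc by (rule mult_left_mono[OF le[unfolded sum] norm_ge_zero])
  qed
qed

text \<open>The difference of two solutions satisfies the homogeneous system, whose operator is
  Lipschitz in the supremum over the grid. The decay condition on \<open>v\<close> with exponent
  zero bounds it at each time, and boundedness at each time is what
  \<open>pointwise_bounded_system\<close> asks for.\<close>

lemma second_green_unique:
  fixes v V :: "real^'d::finite \<Rightarrow> real \<Rightarrow> complex"
  assumes v: "second_green l lhat a \<epsilon> v"
    and V_bound: "\<And>t. t \<ge> 0 \<Longrightarrow> \<exists>C. \<forall>x\<in>grid \<epsilon>. norm (V x t) \<le> C"
    and V_0: "\<And>x. x \<in> grid \<epsilon> \<Longrightarrow> V x 0 = 0"
    and V_der: "\<And>x t. x \<in> grid \<epsilon> \<Longrightarrow> t \<ge> 0 \<Longrightarrow> (V x has_vector_derivative V' x t) (at t within {0..})"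
    and V_eq: "\<And>x t. x \<in> grid \<epsilon> \<Longrightarrow> t > 0 \<Longrightarrow> V' x t + diff_op l lhat a \<epsilon> (\<lambda>z. V z t) x = grid_delta \<epsilon> x"
    and "x \<in> grid \<epsilon>" "t \<ge> 0"
  shows "v x t = V x t"
proof -
  have "\<forall>x. \<exists>v'. x \<in> grid \<epsilon> \<longrightarrow> (\<forall>t\<ge>0. (v x has_vector_derivative v' t) (at t within {0..})) \<and>
           (\<forall>t>0. v' t + diff_op l lhat a \<epsilon> (\<lambda>z. v z t) x = grid_delta \<epsilon> x)"
    using v unfolding second_green_def by blast
  from choice[OF this] obtain v' where v'0: "\<forall>x. x \<in> grid \<epsilon> \<longrightarrow> (\<forall>t\<ge>0. (v x has_vector_derivative v' x t) (at t within {0..})) \<and>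
           (\<forall>t>0. v' x t + diff_op l lhat a \<epsilon> (\<lambda>z. v z t) x = grid_delta \<epsilon> x)" ..
  then have v_der: "\<And>x t. x \<in> grid \<epsilon> \<Longrightarrow> t \<ge> 0 \<Longrightarrow> (v x has_vector_derivative v' x t) (at t within {0..})"
    and v_eq: "\<And>x t. x \<in> grid \<epsilon> \<Longrightarrow> t > 0 \<Longrightarrow> v' x t + diff_op l lhat a \<epsilon> (\<lambda>z. v z t) x = grid_delta \<epsilon> x"
    by blast+
  have v_0: "v x 0 = 0" if "x \<in> grid \<epsilon>" for x using v that unfolding second_green_def by blast
  have v_bound: "\<exists>C. \<forall>x\<in>grid \<epsilon>. norm (v x t) \<le> C" if "t \<ge> 0" for t
  proof -
    from v that have "\<exists>C. \<forall>x\<in>grid \<epsilon>. norm x ^ 0 * norm (v x t) \<le> C" unfolding second_green_def by blast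
    then show ?thesis by simp
  qed
  obtain L where L: "L \<ge> 0" and lip: "\<forall>u v B. (\<forall>x\<in>grid \<epsilon>. norm (u x - v x) \<le> B) \<longrightarrow>
      (\<forall>x\<in>grid \<epsilon>. norm (diff_op l lhat a \<epsilon> u x - diff_op l lhat a \<epsilon> v x) \<le> L * B)"
    using lipschitz_operator_diff_op[of \<epsilon> l lhat a] unfolding lipschitz_operator_def by blast
  define w where "w = (\<lambda>x t. v x t - V x t)"
  have w_der: "(w x has_vector_derivative v' x t - V' x t) (at t within {0..})" if "x \<in> grid \<epsilon>" "t \<ge> 0" for x t
    unfolding w_def by (intro has_vector_derivative_diff v_der V_der that)
  interpret pointwise_bounded_system "grid \<epsilon>" w "\<lambda>x t. v' x t - V' x t" L
  proof
    show "L \<ge> 0" by fact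
    show "continuous_on {0..} (w x)" if "x \<in> grid \<epsilon>" for x
      by (rule continuous_on_vector_derivative[OF w_der]) (use that in auto)
    show "(w x has_vector_derivative v' x t - V' x t) (at t)" if "x \<in> grid \<epsilon>" "t > 0" for x t
    proof -
      have "t \<in> interior {0..}" using that by (intro interiorI[of "{0<..}"]) auto
      then have "at t within {0..} = at t" by (rule at_within_interior)
      then show ?thesis using w_der[of x t] that by simp
    qed
    show "norm (v' x t - V' x t) \<le> L * C" if x: "x \<in> grid \<epsilon>" and t: "t > 0" and C: "\<forall>y\<in>grid \<epsilon>. norm (w y t) \<le> C" for x t C
    proof -
      have "v' x t - V' x t = diff_op l lhat a \<epsilon> (\<lambda>z. V z t) x - diff_op l lhat a \<epsilon> (\<lambda>z. v z t) x"
        using v_eq[OF x t] V_eq[OF x t] by (simp add: eq_diff_eq[symmetric])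
      also have "norm \<dots> \<le> L * C"
        using C by (intro lip[rule_format] x) (simp add: w_def norm_minus_commute)
      finally show ?thesis .
    qed
    show "\<exists>C. \<forall>x\<in>grid \<epsilon>. norm (w x t) \<le> C" if "t \<ge> 0" for t
    proof -
      from v_bound[OF that] obtain C where C: "\<And>x. x \<in> grid \<epsilon> \<Longrightarrow> norm (v x t) \<le> C" by blast
      from V_bound[OF that] obtain D where D: "\<And>x. x \<in> grid \<epsilon> \<Longrightarrow> norm (V x t) \<le> D" by blast
      have "norm (w x t) \<le> C + D" if "x \<in> grid \<epsilon>" for x
        unfolding w_def using norm_triangle_ineq4[of "v x t" "V x t"] C[OF that] D[OF that] by linarith
      then show ?thesis by blast
    qed
  qed
  have "w x t = 0" by (rule eq_zero) (use assms v_0 V_0 in \<open>auto simp: w_def\<close>)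
  then show ?thesis by (simp add: w_def)
qed

section \<open>Fourier integrals\<close>

lemma integrable_lborel_if_has_integral:
  fixes f :: "'a::euclidean_space \<Rightarrow> real"
  assumes f: "f \<in> borel_measurable borel" "\<And>x. 0 \<le> f x" and I: "(f has_integral I) S" and S: "S \<in> sets borel"
  shows "integrable lborel (\<lambda>x. indicator S x * f x)"
proof (rule integrableI_nonneg)
  have "((\<lambda>x. indicator S x * f x) has_integral I) UNIV"
  proof -
    have "(\<lambda>x. indicator S x * f x) = (\<lambda>x. if x \<in> S then f x else 0)" by (auto simp: indicator_def)
    then show ?thesis using I by (simp only: has_integral_restrict_UNIV)
  qed
  then have "integral\<^sup>N lborel (\<lambda>x. indicator S x * f x) = I"
    using f S by (intro nn_integral_has_integral_lborel) auto
  then show "integral\<^sup>N lborel (\<lambda>x. indicator S x * f x) < \<infinity>" by simp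
qed (use f S in auto)

lemma integrable_even_extension:
  fixes g :: "real \<Rightarrow> real"
  assumes g: "integrable lborel (\<lambda>x. indicator {0..} x * g x)" and [measurable]: "g \<in> borel_measurable borel"
    and nonneg: "\<And>x. 0 \<le> g x"
  shows "integrable lborel (\<lambda>x. g \<bar>x\<bar>)"
proof (rule Bochner_Integration.integrable_bound)
  have "integrable lborel (\<lambda>x. indicator {0..} (0 + (- 1) * x) * g (0 + (- 1) * x))"
    by (rule lborel_integrable_real_affine[OF g]) simp
  then show "integrable lborel (\<lambda>x. indicator {0..} x * g x + indicator {0..} (- x) * g (- x))"
    using g by simp
  show "AE x in lborel. norm (g \<bar>x\<bar>) \<le> norm (indicator {0..} x * g x + indicator {0..} (- x) * g (- x))"
    using nonneg by (intro AE_I2) (auto simp: indicator_def abs_if)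
qed simp

lemma integrable_exp_abs:
  assumes "(c::real) > 0"
  shows "integrable lborel (\<lambda>x. exp (- c * \<bar>x\<bar>))"
proof (rule integrable_even_extension[where g = "\<lambda>x. exp (- c * x)"])
  show "integrable lborel (\<lambda>x. indicator {0..} x * exp (- c * x))"
    by (rule integrable_lborel_if_has_integral[OF _ _ has_integral_exp_minus_to_infinity[OF assms]]) auto
qed auto

lemma integrable_powr_near_0:
  assumes "(p::real) < 1" "r \<ge> 0"
  shows "integrable lborel (\<lambda>x. indicator {- r..r} x * \<bar>x\<bar> powr (- p))"
proof -
  have "integrable lborel (\<lambda>x. indicator {0..r} x * x powr (- p))"
    by (rule integrable_lborel_if_has_integral[OF _ _ has_integral_powr_from_0]) (use assms in auto)
  then have "integrable lborel (\<lambda>x. indicator {0..} x * (indicator {0..r} x * x powr (- p)))"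
    by (rule Bochner_Integration.integrable_bound) (auto simp: indicator_def)
  from integrable_even_extension[OF this]
  have "integrable lborel (\<lambda>x. indicator {0..r} \<bar>x\<bar> * \<bar>x\<bar> powr (- p))" by simp
  moreover have "indicator {0..r} \<bar>x\<bar> = (indicator {- r..r} x :: real)" for x by (auto simp: indicator_def)
  ultimately show ?thesis by simp
qed

text \<open>The average of the \<open>\<bar>x $ k\<bar>\<close> is at most \<open>norm x\<close>, so
  the function is dominated by a product of one-dimensional exponentials with rate
  \<open>c / d\<close>.\<close>

lemma integrable_exp_norm_vec:
  assumes "c > 0"
  shows "integrable lborel (\<lambda>x::real^'d::finite. exp (- c * norm x))"
proof (rule Bochner_Integration.integrable_bound)
  define e where "e = c / real CARD('d)"
  have e: "e > 0" using assms by (simp add: e_def)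
  have "integrable lborel (\<lambda>x. complex_of_real (exp (- e * \<bar>x\<bar>)))"
    using integrable_exp_abs[OF e] by (rule integrable_of_real)
  then show "integrable lborel (\<lambda>x::real^'d. \<Prod>k\<in>UNIV. complex_of_real (exp (- e * \<bar>x $ k\<bar>)))"
    by (rule lborel_product_vec(1))
  show "AE x::real^'d in lborel. norm (exp (- c * norm x)) \<le> norm (\<Prod>k\<in>UNIV. complex_of_real (exp (- e * \<bar>x $ k\<bar>)))"
  proof (rule AE_I2)
    fix x :: "real^'d"
    have "(\<Sum>k\<in>UNIV. e * \<bar>x $ k\<bar>) \<le> (\<Sum>k\<in>(UNIV::'d set). e * norm x)"
      using e component_le_norm_cart[of x] by (intro sum_mono mult_left_mono) auto
    also have "\<dots> = c * norm x" by (simp add: e_def)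
    finally have "(\<Sum>k\<in>UNIV. e * \<bar>x $ k\<bar>) \<le> c * norm x" .
    moreover have "norm (\<Prod>k\<in>UNIV. complex_of_real (exp (- e * \<bar>x $ k\<bar>))) = (\<Prod>k\<in>UNIV. exp (- e * \<bar>x $ k\<bar>))"
      unfolding of_real_prod[symmetric] norm_of_real by (intro abs_of_nonneg prod_nonneg) auto
    moreover have "\<dots> = exp (- (\<Sum>k\<in>UNIV. e * \<bar>x $ k\<bar>))" by (simp add: exp_sum sum_negf[symmetric])
    ultimately show "norm (exp (- c * norm x)) \<le> norm (\<Prod>k\<in>UNIV. complex_of_real (exp (- e * \<bar>x $ k\<bar>)))" by simp
  qed
qed measurable

text \<open>With \<open>e = c / (N + 1)\<close> one has
  \<open>min 1 e * (1 + r) \<le> 1 + e * r \<le> exp (e * r)\<close>, and the power \<open>N\<close>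
  of the last term is at most \<open>exp (c * r)\<close>. The denominator \<open>N + 1\<close>
  instead of \<open>N\<close> admits \<open>N = 0\<close>.\<close>

lemma power_le_exp_linear:
  fixes r c :: real
  assumes "c > 0" "r \<ge> 0"
  shows "(1 + r) ^ N \<le> (1 / min 1 (c / (N + 1))) ^ N * exp (c * r)"
proof -
  define e where "e = c / (real N + 1)"
  have e: "e > 0" using assms by (simp add: e_def)
  have "min 1 e * (1 + r) = min 1 e + min 1 e * r" by (simp add: distrib_left)
  also have "\<dots> \<le> 1 + e * r" using assms e by (intro add_mono mult_right_mono) auto
  also have "\<dots> \<le> exp (e * r)" by (rule exp_ge_add_one_self)
  finally have "1 + r \<le> 1 / min 1 e * exp (e * r)" using e by (simp add: field_simps)
  then have "(1 + r) ^ N \<le> (1 / min 1 e * exp (e * r)) ^ N" using assms by (intro power_mono) auto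
  also have "\<dots> = (1 / min 1 e) ^ N * exp (real N * (e * r))" by (simp only: power_mult_distrib exp_of_nat_mult)
  also have "\<dots> \<le> (1 / min 1 e) ^ N * exp (c * r)"
  proof -
    have "real N * e \<le> c" using assms by (simp add: e_def field_simps)
    then have "real N * e * r \<le> c * r" using assms(2) by (rule mult_right_mono)
    then show ?thesis using e by (intro mult_left_mono) (auto simp: mult.assoc)
  qed
  finally show ?thesis by (simp add: e_def add.commute)
qed

text \<open>From \<open>r ^ l \<ge> r - 1\<close> the exponential is at most
  \<open>exp c * exp (- c * r)\<close>; one half of the rate absorbs the polynomial, the other half
  stays integrable.\<close>

lemma integrable_poly_exp_power:
  assumes "c > 0" "l > 0"
  shows "integrable lborel (\<lambda>x::real^'d::finite. (1 + norm x) ^ N * exp (- c * norm x ^ l))"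
proof (rule Bochner_Integration.integrable_bound)
  define D where "D = (1 / min 1 (c / 2 / (N + 1))) ^ N * exp c"
  show "integrable lborel (\<lambda>x::real^'d. D * exp (- (c / 2) * norm x))"
    using assms by (intro integrable_mult_right integrable_exp_norm_vec) auto
  show "AE x::real^'d in lborel. norm ((1 + norm x) ^ N * exp (- c * norm x ^ l)) \<le> norm (D * exp (- (c / 2) * norm x))"
  proof (rule AE_I2)
    fix x :: "real^'d"
    define r where "r = norm x"
    have r: "r \<ge> 0" by (simp add: r_def)
    have D: "D \<ge> 0" using assms by (simp add: D_def)
    have "r - 1 \<le> r ^ l"
    proof (cases "r \<le> 1")
      case False
      then have "r ^ 1 \<le> r ^ l" using assms by (intro power_increasing) auto
      then show ?thesis by simp
    qed (use r in \<open>auto intro: order.trans[of _ 0]\<close>)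
    then have "c * (r - 1) \<le> c * r ^ l" using assms by (intro mult_left_mono) auto
    then have "exp (- c * r ^ l) \<le> exp (c - c * r)" by (simp add: algebra_simps)
    then have "(1 + r) ^ N * exp (- c * r ^ l) \<le>
        ((1 / min 1 (c / 2 / (N + 1))) ^ N * exp (c / 2 * r)) * exp (c - c * r)"
      using assms r by (intro mult_mono power_le_exp_linear) auto
    also have "\<dots> = D * (exp (c / 2 * r) * exp (- c * r))"
      by (simp add: D_def exp_diff exp_minus field_simps)
    also have "exp (c / 2 * r) * exp (- c * r) = exp (- (c / 2) * r)"
      by (simp add: exp_add[symmetric] field_simps)
    finally show "norm ((1 + norm x) ^ N * exp (- c * norm x ^ l)) \<le> norm (D * exp (- (c / 2) * norm x))"
      using r D unfolding r_def by simp
  qed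
qed measurable

lemma sets_cube [measurable, simp]: "cube r \<in> sets borel"
  unfolding cube_eq_cbox by simp

text \<open>Each coordinate is bounded by the norm, hence \<open>\<bar>\<theta>\<bar> \<ge> (\<Prod>k. \<bar>\<theta>\<^sub>k\<bar>) powr (1 / d)\<close>, which
  reduces the integrability of \<open>\<bar>\<theta>\<bar> powr (- l)\<close> to dimension one.\<close>

lemma integrable_inverse_norm_power:
  assumes "l < CARD('d::finite)"
  shows "integrable lborel (\<lambda>x::real^'d. indicator (cube pi) x * (1 / norm x ^ l))"
proof (rule Bochner_Integration.integrable_bound)
  define p where "p = real l / real CARD('d)"
  have p: "p < 1" "p \<ge> 0" using assms by (auto simp: p_def)
  have "integrable lborel (\<lambda>x. complex_of_real (indicator {- pi..pi} x * \<bar>x\<bar> powr (- p)))"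
    using p by (intro integrable_of_real integrable_powr_near_0) auto
  then show "integrable lborel (\<lambda>x::real^'d. \<Prod>k\<in>UNIV. complex_of_real (indicator {- pi..pi} (x $ k) * \<bar>x $ k\<bar> powr (- p)))"
    by (rule lborel_product_vec(1))
  \<comment> \<open>On a coordinate hyperplane \<open>0 powr (- p) = 0\<close> makes the majorant
    vanish, so these points are removed as a null set.\<close>
  have null: "AE x::real^'d in lborel. \<forall>k. x $ k \<noteq> 0"
  proof -
    have "AE x::real^'d in lborel. x $ k \<noteq> 0" for k
    proof (rule AE_I')
      have "negligible {x::real^'d. axis k 1 \<bullet> x = 0}"
        by (rule negligible_hyperplane) (simp add: axis_eq_0_iff)
      then have "{x::real^'d. x $ k = 0} \<in> null_sets lebesgue"
        by (simp add: negligible_iff_null_sets inner_axis')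
      moreover have "{x::real^'d. x $ k = 0} \<in> sets borel"
        by (intro borel_closed closed_Collect_eq continuous_intros)
      ultimately show "{x::real^'d. x $ k = 0} \<in> null_sets lborel"
        by (simp add: null_sets_def)
      show "{x \<in> space lborel. \<not> x $ k \<noteq> 0} \<subseteq> {x::real^'d. x $ k = 0}" by auto
    qed
    then show ?thesis by (intro AE_finite_allI[of UNIV, simplified]) auto
  qed
  show "AE x::real^'d in lborel. norm (indicator (cube pi) x * (1 / norm x ^ l)) \<le>
      norm (\<Prod>k\<in>UNIV. complex_of_real (indicator {- pi..pi} (x $ k) * \<bar>x $ k\<bar> powr (- p)))"
    using null
  proof eventually_elim
    case (elim x)
    show ?case
    proof (cases "x \<in> cube pi")
      case True
      have x: "norm x > 0" using elim by auto
      have eq: "norm (\<Prod>k\<in>UNIV. complex_of_real (indicator {- pi..pi} (x $ k) * \<bar>x $ k\<bar> powr (- p))) = (\<Prod>k\<in>UNIV. \<bar>x $ k\<bar> powr (- p))"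
        using True by (simp add: cube_def norm_mult flip: prod_norm)
      have "1 / norm x ^ l = norm x powr (- real l)" using x by (simp add: powr_minus powr_realpow divide_inverse)
      also have "\<dots> = (\<Prod>k\<in>(UNIV::'d set). norm x powr (- p))"
        using x by (simp add: powr_power p_def)
      also have "\<dots> \<le> (\<Prod>k\<in>UNIV. \<bar>x $ k\<bar> powr (- p))"
        using elim p component_le_norm_cart[of x] by (intro prod_mono conjI powr_mono2') auto
      finally show ?thesis unfolding eq using True by simp
    next
      case False
      then show ?thesis by (simp add: indicator_def)
    qed
  qed
qed simp

lemma integral_exp_int_frequency:
  "integrable lborel (\<lambda>x. complex_of_real (indicator {- pi..pi} x) * exp (\<i> * complex_of_real (of_int m * x)))"
  "(LINT x|lborel. complex_of_real (indicator {- pi..pi} x) * exp (\<i> * complex_of_real (of_int m * x))) =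
     (if m = 0 then 2 * complex_of_real pi else 0)"
proof -
  let ?f = "\<lambda>x. exp (\<i> * complex_of_real (of_int m * x))"
  have cont: "continuous_on {- pi..pi} ?f" by (intro continuous_intros)
  have ind: "(\<lambda>x. complex_of_real (indicator {- pi..pi} x) * ?f x) = (\<lambda>x. indicator {- pi..pi} x *\<^sub>R ?f x)"
    by (auto simp: scaleR_conv_of_real)
  show "integrable lborel (\<lambda>x. complex_of_real (indicator {- pi..pi} x) * ?f x)"
    unfolding ind by (intro borel_integrable_compact cont) simp
  show "(LINT x|lborel. complex_of_real (indicator {- pi..pi} x) * ?f x) = (if m = 0 then 2 * complex_of_real pi else 0)"
  proof (cases "m = 0")
    case True
    have "(LINT x|lborel. complex_of_real (indicator {- pi..pi} x)) = complex_of_real (LINT x|lborel. indicator {- pi..pi} x)"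
      by (rule integral_complex_of_real)
    then show ?thesis using True by simp
  next
    case False
    let ?F = "\<lambda>x. exp (\<i> * complex_of_real (of_int m * x)) / (\<i> * of_int m)"
    have "(LINT x|lborel. indicator {- pi..pi} x *\<^sub>R ?f x) = ?F pi - ?F (- pi)"
    proof (rule integral_FTC_Icc[OF _ _ cont])
      fix x :: real
      show "(?F has_vector_derivative ?f x) (at x within {- pi..pi})"
        using False by (auto intro!: derivative_eq_intros has_vector_derivative_real_field simp: field_simps)
    qed simp
    also have "\<dots> = 0"
    proof -
      have "exp (\<i> * complex_of_real (of_int m * pi)) = exp (\<i> * complex_of_real (of_int m * - pi)) * exp (2 * of_int m * of_real pi * \<i>)"
        by (subst exp_add[symmetric], rule arg_cong[where f = exp]) (simp add: algebra_simps)
      also have "exp (2 * of_int m * of_real pi * \<i>) = 1"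
        using exp_integer_2pi[of "of_int m"] by (simp add: mult_ac)
      finally show ?thesis by (simp only: mult_1_right diff_self)
    qed
    finally show ?thesis unfolding ind using False by simp
  qed
qed

text \<open>The inverse Fourier transform. With this normalisation \<open>Omega\<close>, the
  functions \<open>H_k\<close> and both discrete Green functions are all values of it.\<close>

definition fourier :: "(real^'d::finite \<Rightarrow> complex) \<Rightarrow> real^'d \<Rightarrow> complex" where
  "fourier \<phi> y = 1 / (2 * complex_of_real pi) ^ CARD('d) * (LINT \<xi>|lborel. \<phi> \<xi> * plane_wave \<xi> y)"

text \<open>All polynomial moments are integrable. The class contains bounded amplitudes cut off to
  a cube as well as \<open>exp (- P)\<close>, and it is stable under factors of polynomial growth,
  so it can serve as the set \<open>S\<close> of the multiplier lemmas.\<close>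

definition rapid :: "(real^'d::finite \<Rightarrow> complex) \<Rightarrow> bool" where
  "rapid \<phi> \<longleftrightarrow> \<phi> \<in> borel_measurable borel \<and> (\<forall>N. integrable lborel (\<lambda>\<xi>. (1 + norm \<xi>) ^ N * norm (\<phi> \<xi>)))"

lemma measurable_plane_wave [measurable]: "(\<lambda>\<xi>. plane_wave \<xi> y) \<in> borel_measurable borel"
  unfolding plane_wave_def by measurable

lemma integrable_plane_wave:
  assumes "integrable lborel \<phi>"
  shows "integrable lborel (\<lambda>\<xi>. \<phi> \<xi> * plane_wave \<xi> y)"
  using assms borel_measurable_integrable[OF assms]
  by (elim Bochner_Integration.integrable_bound) (auto simp: norm_mult)

lemma rapid_integrable: "rapid \<phi> \<Longrightarrow> integrable lborel \<phi>"
  unfolding rapid_def by (auto elim!: allE[of _ 0] simp: integrable_norm_iff)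

lemma rapid_mult:
  assumes "rapid \<phi>" "g \<in> borel_measurable borel" "\<And>\<xi>. norm (g \<xi>) \<le> C * (1 + norm \<xi>) ^ N"
  shows "rapid (\<lambda>\<xi>. g \<xi> * \<phi> \<xi>)"
  unfolding rapid_def
proof (intro conjI allI)
  have [measurable]: "\<phi> \<in> borel_measurable borel" "g \<in> borel_measurable borel" using assms by (auto simp: rapid_def)
  show "(\<lambda>\<xi>. g \<xi> * \<phi> \<xi>) \<in> borel_measurable borel" by measurable
  fix K
  have "integrable lborel (\<lambda>\<xi>. C * ((1 + norm \<xi>) ^ (K + N) * norm (\<phi> \<xi>)))"
    using assms(1) by (intro integrable_mult_right) (auto simp: rapid_def)
  then show "integrable lborel (\<lambda>\<xi>. (1 + norm \<xi>) ^ K * norm (g \<xi> * \<phi> \<xi>))"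
  proof (rule Bochner_Integration.integrable_bound)
    show "AE \<xi> in lborel. norm ((1 + norm \<xi>) ^ K * norm (g \<xi> * \<phi> \<xi>)) \<le> norm (C * ((1 + norm \<xi>) ^ (K + N) * norm (\<phi> \<xi>)))"
    proof (rule AE_I2)
      fix \<xi>
      have "(1 + norm \<xi>) ^ K * (norm (g \<xi>) * norm (\<phi> \<xi>)) \<le> (1 + norm \<xi>) ^ K * (C * (1 + norm \<xi>) ^ N * norm (\<phi> \<xi>))"
        by (intro mult_left_mono mult_right_mono assms) auto
      also have "\<dots> \<le> norm (C * ((1 + norm \<xi>) ^ (K + N) * norm (\<phi> \<xi>)))"
        by (simp add: power_add mult_ac)
      finally show "norm ((1 + norm \<xi>) ^ K * norm (g \<xi> * \<phi> \<xi>)) \<le> norm (C * ((1 + norm \<xi>) ^ (K + N) * norm (\<phi> \<xi>)))"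
        by (simp add: norm_mult)
    qed
  qed measurable
qed

lemma rapid_coordinate: "rapid \<phi> \<Longrightarrow> rapid (\<lambda>\<xi>. complex_of_real (\<xi> $ k) * \<phi> \<xi>)"
proof (erule rapid_mult)
  show "norm (complex_of_real (\<xi> $ k)) \<le> 1 * (1 + norm \<xi>) ^ 1" for \<xi>
    using component_le_norm_cart[of \<xi> k] by simp
qed measurable

lemma measurable_polyfun: "polyfun g \<Longrightarrow> g \<in> borel_measurable borel"
  unfolding polyfun_def by (auto intro!: borel_measurable_continuous_onI continuous_intros)

lemma rapid_polyfun: "rapid \<phi> \<Longrightarrow> polyfun g \<Longrightarrow> rapid (\<lambda>\<xi>. g \<xi> * \<phi> \<xi>)"
  using polyfun_bound[of g] measurable_polyfun[of g] by (blast intro: rapid_mult)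

lemma rapid_cube:
  assumes "g \<in> borel_measurable borel" "\<And>\<theta>. \<theta> \<in> cube r \<Longrightarrow> norm (g \<theta>) \<le> C"
  shows "rapid (\<lambda>\<theta>::real^'d::finite. complex_of_real (indicator (cube r) \<theta>) * g \<theta>)"
  unfolding rapid_def
proof (intro conjI allI)
  have [measurable]: "g \<in> borel_measurable borel" by fact
  show "(\<lambda>\<theta>. complex_of_real (indicator (cube r) \<theta>) * g \<theta>) \<in> borel_measurable borel" by measurable
  fix N
  have "integrable lborel (\<lambda>\<theta>::real^'d. indicator (cube r) \<theta> *\<^sub>R ((1 + norm \<theta>) ^ N * C))"
    by (intro borel_integrable_compact compact_cube continuous_intros)
  then show "integrable lborel (\<lambda>\<xi>. (1 + norm \<xi>) ^ N * norm (complex_of_real (indicator (cube r) \<xi>) * g \<xi>))"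
  proof (rule Bochner_Integration.integrable_bound)
    show "AE \<xi> in lborel. norm ((1 + norm \<xi>) ^ N * norm (complex_of_real (indicator (cube r) \<xi>) * g \<xi>)) \<le>
        norm (indicator (cube r) \<xi> *\<^sub>R ((1 + norm \<xi>) ^ N * C))"
    proof (rule AE_I2)
      fix \<xi> :: "real^'d"
      show "norm ((1 + norm \<xi>) ^ N * norm (complex_of_real (indicator (cube r) \<xi>) * g \<xi>)) \<le>
        norm (indicator (cube r) \<xi> *\<^sub>R ((1 + norm \<xi>) ^ N * C))"
      proof (cases "\<xi> \<in> cube r")
        case True
        have "(1 + norm \<xi>) ^ N * norm (g \<xi>) \<le> (1 + norm \<xi>) ^ N * \<bar>C\<bar>"
          using assms(2)[OF True] by (intro mult_left_mono) auto
        then show ?thesis using True by (simp add: abs_mult)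
      qed simp
    qed
  qed measurable
qed

lemma fourier_norm_le:
  assumes "integrable lborel \<phi>"
  shows "norm (fourier \<phi> (y::real^'d::finite)) \<le> (LINT \<xi>|lborel. norm (\<phi> \<xi>))"
proof -
  have "norm (LINT \<xi>|lborel. \<phi> \<xi> * plane_wave \<xi> y) \<le> (LINT \<xi>|lborel. norm (\<phi> \<xi> * plane_wave \<xi> y))"
    by (rule integral_norm_bound)
  also have "\<dots> = (LINT \<xi>|lborel. norm (\<phi> \<xi>))" by (simp add: norm_mult)
  finally have *: "norm (LINT \<xi>|lborel. \<phi> \<xi> * plane_wave \<xi> y) \<le> (LINT \<xi>|lborel. norm (\<phi> \<xi>))" .
  have "norm (1 / (2 * complex_of_real pi) ^ CARD('d)) \<le> 1"
  proof -
    have "(1::real) \<le> (2 * pi) ^ CARD('d)" using pi_ge_two by (intro one_le_power) auto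
    then show ?thesis by (simp add: norm_divide norm_power norm_mult)
  qed
  then have "norm (1 / (2 * complex_of_real pi) ^ CARD('d)) * norm (LINT \<xi>|lborel. \<phi> \<xi> * plane_wave \<xi> y) \<le> 1 * (LINT \<xi>|lborel. norm (\<phi> \<xi>))"
    using * by (intro mult_mono) auto
  then show ?thesis unfolding fourier_def norm_mult by simp
qed

lemma fourier_diff:
  assumes "integrable lborel \<phi>" "integrable lborel \<psi>"
  shows "fourier \<phi> y - fourier \<psi> y = fourier (\<lambda>\<xi>. \<phi> \<xi> - \<psi> \<xi>) y"
  unfolding fourier_def left_diff_distrib right_diff_distrib[symmetric]
  using assms by (subst Bochner_Integration.integral_diff) (auto intro: integrable_plane_wave)

lemma fourier_cmult:
  "fourier (\<lambda>\<xi>. c * \<phi> \<xi>) y = c * fourier \<phi> y"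
  unfolding fourier_def mult.assoc by (subst integral_mult_right_zero) simp

lemma fourier_sum:
  assumes "\<And>i. i \<in> I \<Longrightarrow> integrable lborel (\<phi> i)"
  shows "fourier (\<lambda>\<xi>. \<Sum>i\<in>I. \<phi> i \<xi>) y = (\<Sum>i\<in>I. fourier (\<phi> i) y)"
  unfolding fourier_def sum_distrib_right sum_distrib_left[symmetric]
  using assms by (subst Bochner_Integration.integral_sum) (auto intro: integrable_plane_wave)

lemma fourier_scale:
  fixes \<phi> :: "real^'d::finite \<Rightarrow> complex"
  assumes [measurable]: "\<phi> \<in> borel_measurable borel" and "s > 0"
  shows "fourier \<phi> y = complex_of_real s ^ CARD('d) * fourier (\<lambda>\<xi>. \<phi> (s *\<^sub>R \<xi>)) (s *\<^sub>R y)"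
proof -
  let ?g = "\<lambda>\<xi>. \<phi> \<xi> * plane_wave \<xi> y"
  have "integral\<^sup>L lborel ?g = integral\<^sup>L (density (distr lborel borel (\<lambda>x. 0 + s *\<^sub>R x)) (\<lambda>_. \<bar>s\<bar> ^ DIM(real^'d))) ?g"
    using lborel_affine[of s "0::real^'d"] assms(2) by simp
  also have "\<dots> = integral\<^sup>L (distr lborel borel (\<lambda>x. 0 + s *\<^sub>R x)) (\<lambda>x. \<bar>s\<bar> ^ DIM(real^'d) *\<^sub>R ?g x)"
    by (rule integral_density) auto
  also have "\<dots> = integral\<^sup>L lborel (\<lambda>x. \<bar>s\<bar> ^ DIM(real^'d) *\<^sub>R ?g (0 + s *\<^sub>R x))"
    by (rule integral_distr) auto
  also have "\<dots> = complex_of_real s ^ CARD('d) * (LINT \<xi>|lborel. \<phi> (s *\<^sub>R \<xi>) * plane_wave \<xi> (s *\<^sub>R y))"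
    using assms(2) by (simp add: plane_wave_def scaleR_conv_of_real[where 'a = complex])
  finally show ?thesis by (simp add: fourier_def)
qed

lemma norm_exp_i_minus_linear:
  "norm (exp (\<i> * complex_of_real x) - 1 - \<i> * complex_of_real x) \<le> x\<^sup>2"
  using exp_Taylor_remainder[of "\<i> * complex_of_real x" 1] by (simp add: norm_mult power2_eq_square algebra_simps)

lemma norm_exp_i_minus_1:
  "norm (exp (\<i> * complex_of_real x) - 1) \<le> \<bar>x\<bar>"
  using exp_Taylor_remainder[of "\<i> * complex_of_real x" 0] by (simp add: norm_mult)

text \<open>Replaces differentiation under the integral sign: a quadratic error bound for the
  amplitude is integrated and gives the derivative at once. It is used for space derivatives and for
  the time derivative.\<close>

lemma has_vector_derivative_quadratic:
  fixes f :: "real \<Rightarrow> 'a::real_normed_vector"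
  assumes "\<And>t. t \<in> S \<Longrightarrow> norm (f t - f x - (t - x) *\<^sub>R d) \<le> C * (t - x)\<^sup>2"
  shows "(f has_vector_derivative d) (at x within S)"
  unfolding has_vector_derivative_def has_derivative_within
proof (intro conjI bounded_linear_scaleR_left)
  show "((\<lambda>t. (1 / norm (t - x)) *\<^sub>R (f t - (f x + (t - x) *\<^sub>R d))) \<longlongrightarrow> 0) (at x within S)"
  proof (rule Lim_null_comparison)
    show "\<forall>\<^sub>F t in at x within S. norm ((1 / norm (t - x)) *\<^sub>R (f t - (f x + (t - x) *\<^sub>R d))) \<le> \<bar>C\<bar> * \<bar>t - x\<bar>"
      unfolding eventually_at_filter
    proof (rule always_eventually, intro allI impI)
      fix t assume t: "t \<noteq> x" "t \<in> S"
      have "norm (f t - (f x + (t - x) *\<^sub>R d)) \<le> C * (t - x)\<^sup>2" using assms[OF t(2)] by (simp add: algebra_simps)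
      also have "\<dots> \<le> \<bar>C\<bar> * (t - x)\<^sup>2" by (intro mult_right_mono) auto
      also have "\<dots> = \<bar>t - x\<bar> * (\<bar>C\<bar> * \<bar>t - x\<bar>)" by (simp add: power2_eq_square)
      finally show "norm ((1 / norm (t - x)) *\<^sub>R (f t - (f x + (t - x) *\<^sub>R d))) \<le> \<bar>C\<bar> * \<bar>t - x\<bar>"
        using t by (simp add: pos_divide_le_eq mult.commute)
    qed
    have "((\<lambda>t. \<bar>C\<bar> * \<bar>t - x\<bar>) \<longlongrightarrow> \<bar>C\<bar> * \<bar>x - x\<bar>) (at x within S)" by (intro tendsto_intros)
    then show "((\<lambda>t. \<bar>C\<bar> * \<bar>t - x\<bar>) \<longlongrightarrow> 0) (at x within S)" by simp
  qed
qed

text \<open>The second order remainder of the phase factor is at most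
  \<open>(s * \<xi> $ k)\<^sup>2\<close>, so the second moment of \<open>\<phi>\<close> is the
  constant in the quadratic error bound.\<close>

lemma fourier_has_derivative:
  assumes "rapid \<phi>"
  shows "((\<lambda>s. fourier \<phi> (y + s *\<^sub>R axis k 1)) has_vector_derivative \<i> * fourier (\<lambda>\<xi>. complex_of_real (\<xi> $ k) * \<phi> \<xi>) y) (at 0)"
proof (rule has_vector_derivative_quadratic)
  fix s :: real
  have [measurable]: "\<phi> \<in> borel_measurable borel" using assms by (simp add: rapid_def)
  have i1: "integrable lborel \<phi>" and i2: "integrable lborel (\<lambda>\<xi>. complex_of_real (\<xi> $ k) * \<phi> \<xi>)"
    using assms by (auto intro: rapid_integrable rapid_coordinate)
  let ?m = "\<lambda>\<xi>. exp (\<i> * complex_of_real (s * \<xi> $ k)) - 1 - \<i> * complex_of_real (s * \<xi> $ k)"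
  have i3: "integrable lborel (\<lambda>\<xi>. exp (\<i> * complex_of_real (s * \<xi> $ k)) * \<phi> \<xi>)"
    by (rule Bochner_Integration.integrable_bound[OF i1]) (auto simp: norm_mult)
  have f1: "fourier \<phi> (y + s *\<^sub>R axis k 1) = fourier (\<lambda>\<xi>. exp (\<i> * complex_of_real (s * \<xi> $ k)) * \<phi> \<xi>) y"
    unfolding fourier_def plane_wave_shift by (simp add: mult_ac)
  have "fourier \<phi> (y + s *\<^sub>R axis k 1) - fourier \<phi> (y + 0 *\<^sub>R axis k 1) -
      (s - 0) *\<^sub>R (\<i> * fourier (\<lambda>\<xi>. complex_of_real (\<xi> $ k) * \<phi> \<xi>) y) = fourier (\<lambda>\<xi>. ?m \<xi> * \<phi> \<xi>) y"
  proof -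
    have "(s - 0) *\<^sub>R (\<i> * fourier (\<lambda>\<xi>. complex_of_real (\<xi> $ k) * \<phi> \<xi>) y) =
        fourier (\<lambda>\<xi>. (complex_of_real s * \<i>) * (complex_of_real (\<xi> $ k) * \<phi> \<xi>)) y"
      unfolding fourier_cmult by (simp add: scaleR_conv_of_real)
    moreover have "integrable lborel (\<lambda>\<xi>. (complex_of_real s * \<i>) * (complex_of_real (\<xi> $ k) * \<phi> \<xi>))"
      using i2 by (rule integrable_mult_right)
    moreover have "(\<lambda>\<xi>. ?m \<xi> * \<phi> \<xi>) = (\<lambda>\<xi>. exp (\<i> * complex_of_real (s * \<xi> $ k)) * \<phi> \<xi> - \<phi> \<xi> -
        (complex_of_real s * \<i>) * (complex_of_real (\<xi> $ k) * \<phi> \<xi>))"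
      by (simp add: algebra_simps)
    ultimately show ?thesis unfolding f1
      using i1 i3 by (simp only: fourier_diff Bochner_Integration.integrable_diff scaleR_zero_left add_0_right)
  qed
  moreover have "norm (fourier (\<lambda>\<xi>. ?m \<xi> * \<phi> \<xi>) y) \<le> (LINT \<xi>|lborel. (1 + norm \<xi>) ^ 2 * norm (\<phi> \<xi>)) * s\<^sup>2"
  proof -
    have i4: "integrable lborel (\<lambda>\<xi>. (1 + norm \<xi>) ^ 2 * norm (\<phi> \<xi>) * s\<^sup>2)"
      using assms by (intro integrable_mult_left) (auto simp: rapid_def)
    have b: "norm (?m \<xi> * \<phi> \<xi>) \<le> (1 + norm \<xi>) ^ 2 * norm (\<phi> \<xi>) * s\<^sup>2" for \<xi>
    proof -
      have "norm (?m \<xi>) \<le> (s * \<xi> $ k)\<^sup>2" by (rule norm_exp_i_minus_linear)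
      also have "\<dots> \<le> s\<^sup>2 * (1 + norm \<xi>)\<^sup>2"
        using component_le_norm_cart[of \<xi> k] unfolding power_mult_distrib
        by (intro mult_left_mono) (auto simp: abs_le_square_iff[symmetric])
      finally have "norm (?m \<xi>) * norm (\<phi> \<xi>) \<le> s\<^sup>2 * (1 + norm \<xi>)\<^sup>2 * norm (\<phi> \<xi>)" by (rule mult_right_mono) simp
      then show ?thesis by (simp add: norm_mult mult_ac)
    qed
    have i5: "integrable lborel (\<lambda>\<xi>. ?m \<xi> * \<phi> \<xi>)"
    proof (rule Bochner_Integration.integrable_bound[OF i4])
      show "AE \<xi> in lborel. norm (?m \<xi> * \<phi> \<xi>) \<le> norm ((1 + norm \<xi>) ^ 2 * norm (\<phi> \<xi>) * s\<^sup>2)"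
        by (rule AE_I2, rule order.trans[OF b]) (simp only: real_norm_def abs_ge_self)
    qed measurable
    have "norm (fourier (\<lambda>\<xi>. ?m \<xi> * \<phi> \<xi>) y) \<le> (LINT \<xi>|lborel. norm (?m \<xi> * \<phi> \<xi>))"
      by (rule fourier_norm_le[OF i5])
    also have "\<dots> \<le> (LINT \<xi>|lborel. (1 + norm \<xi>) ^ 2 * norm (\<phi> \<xi>) * s\<^sup>2)"
      using b by (intro integral_mono integrable_norm i5 i4)
    finally show ?thesis by simp
  qed
  ultimately show "norm (fourier \<phi> (y + s *\<^sub>R axis k 1) - fourier \<phi> (y + 0 *\<^sub>R axis k 1) -
      (s - 0) *\<^sub>R (\<i> * fourier (\<lambda>\<xi>. complex_of_real (\<xi> $ k) * \<phi> \<xi>) y)) \<le> (LINT \<xi>|lborel. (1 + norm \<xi>) ^ 2 * norm (\<phi> \<xi>)) * (s - 0)\<^sup>2"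
    by simp
qed

lemma D_op_fourier:
  assumes "rapid \<phi>"
  shows "D_op k (fourier \<phi>) = fourier (\<lambda>\<xi>. complex_of_real (\<xi> $ k) * \<phi> \<xi>)"
  using vector_derivative_at[OF fourier_has_derivative[OF assms]]
  by (auto simp: D_op_def partial_deriv_def)

lemma poly_D_fourier:
  assumes "rapid \<phi>"
  shows "poly_D p (fourier \<phi>) = fourier (\<lambda>\<xi>. poly_eval p \<xi> * \<phi> \<xi>)"
proof
  fix y
  note m = poly_D_multiplier[where U = fourier and S = "{\<phi>. rapid \<phi>}" and \<phi> = \<phi>, unfolded mem_Collect_eq,
      OF D_op_fourier rapid_coordinate assms]
  have "poly_D p (fourier \<phi>) y = (\<Sum>\<alpha>\<in>Poly_Mapping.keys p. fourier (\<lambda>\<xi>. Poly_Mapping.lookup p \<alpha> *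
      ((\<Prod>k\<in>UNIV. complex_of_real (\<xi> $ k) ^ (\<alpha> $ k)) * \<phi> \<xi>)) y)"
    unfolding fourier_cmult by (rule m(1))
  also have "\<dots> = fourier (\<lambda>\<xi>. \<Sum>\<alpha>\<in>Poly_Mapping.keys p. Poly_Mapping.lookup p \<alpha> *
      ((\<Prod>k\<in>UNIV. complex_of_real (\<xi> $ k) ^ (\<alpha> $ k)) * \<phi> \<xi>)) y"
    by (rule fourier_sum[symmetric]) (intro integrable_mult_right rapid_integrable m(2))
  also have "\<dots> = fourier (\<lambda>\<xi>. poly_eval p \<xi> * \<phi> \<xi>) y"
    unfolding poly_eval_def sum_distrib_right mult.assoc ..
  finally show "poly_D p (fourier \<phi>) y = fourier (\<lambda>\<xi>. poly_eval p \<xi> * \<phi> \<xi>) y" .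
qed

text \<open>The transform is even Lipschitz, because two phases differ by at most
  \<open>norm \<xi>\<close> times the distance of the points and the first moment is finite.\<close>

lemma continuous_on_fourier:
  assumes "rapid \<phi>"
  shows "continuous_on S (fourier \<phi>)"
proof -
  have [measurable]: "\<phi> \<in> borel_measurable borel" using assms by (simp add: rapid_def)
  have i1: "integrable lborel \<phi>" using assms by (rule rapid_integrable)
  have i2: "integrable lborel (\<lambda>\<xi>. (1 + norm \<xi>) ^ 1 * norm (\<phi> \<xi>))" using assms unfolding rapid_def by blast
  define C where "C = (LINT \<xi>|lborel. (1 + norm \<xi>) ^ 1 * norm (\<phi> \<xi>))"
  have "dist (fourier \<phi> y) (fourier \<phi> z) \<le> C * dist y z" for y z
  proof -
    let ?m = "\<lambda>\<xi>. exp (\<i> * complex_of_real ((y - z) \<bullet> \<xi>)) - 1"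
    have b: "norm (?m \<xi> * \<phi> \<xi>) \<le> (1 + norm \<xi>) ^ 1 * norm (\<phi> \<xi>) * dist y z" for \<xi>
    proof -
      have "norm (?m \<xi>) \<le> \<bar>(y - z) \<bullet> \<xi>\<bar>" by (rule norm_exp_i_minus_1)
      also have "\<dots> \<le> norm (y - z) * norm \<xi>" by (rule Cauchy_Schwarz_ineq2)
      also have "\<dots> \<le> (1 + norm \<xi>) * dist y z" by (simp add: dist_norm algebra_simps)
      finally have "norm (?m \<xi>) * norm (\<phi> \<xi>) \<le> (1 + norm \<xi>) * dist y z * norm (\<phi> \<xi>)" by (rule mult_right_mono) simp
      then show ?thesis by (simp add: norm_mult mult_ac)
    qed
    have i4: "integrable lborel (\<lambda>\<xi>. (1 + norm \<xi>) ^ 1 * norm (\<phi> \<xi>) * dist y z)"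
      using i2 by (rule integrable_mult_left)
    have i5: "integrable lborel (\<lambda>\<xi>. ?m \<xi> * \<phi> \<xi>)"
    proof (rule Bochner_Integration.integrable_bound[OF i4])
      show "AE \<xi> in lborel. norm (?m \<xi> * \<phi> \<xi>) \<le> norm ((1 + norm \<xi>) ^ 1 * norm (\<phi> \<xi>) * dist y z)"
        by (rule AE_I2, rule order.trans[OF b]) (simp only: real_norm_def abs_ge_self)
    qed measurable
    have i3: "integrable lborel (\<lambda>\<xi>. exp (\<i> * complex_of_real ((y - z) \<bullet> \<xi>)) * \<phi> \<xi>)"
      by (rule Bochner_Integration.integrable_bound[OF i1]) (auto simp: norm_mult)
    have "plane_wave \<xi> y = exp (\<i> * complex_of_real ((y - z) \<bullet> \<xi>)) * plane_wave \<xi> z" for \<xi>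
      by (simp add: plane_wave_def exp_add[symmetric] inner_diff_left algebra_simps)
    then have "fourier \<phi> y = fourier (\<lambda>\<xi>. exp (\<i> * complex_of_real ((y - z) \<bullet> \<xi>)) * \<phi> \<xi>) z"
      by (simp add: fourier_def mult_ac)
    then have "fourier \<phi> y - fourier \<phi> z = fourier (\<lambda>\<xi>. ?m \<xi> * \<phi> \<xi>) z"
      using fourier_diff[OF i3 i1, of z] by (simp add: left_diff_distrib)
    then have "dist (fourier \<phi> y) (fourier \<phi> z) \<le> (LINT \<xi>|lborel. norm (?m \<xi> * \<phi> \<xi>))"
      using fourier_norm_le[OF i5, of z] by (simp add: dist_norm)
    also have "\<dots> \<le> (LINT \<xi>|lborel. (1 + norm \<xi>) ^ 1 * norm (\<phi> \<xi>) * dist y z)"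
      using b by (intro integral_mono integrable_norm i5 i4)
    finally show ?thesis by (simp add: C_def)
  qed
  then have "C-lipschitz_on S (fourier \<phi>)"
    by (intro lipschitz_onI) (auto simp: C_def intro!: integral_nonneg_AE)
  then show ?thesis by (rule lipschitz_on_continuous_on)
qed

section \<open>The explicit solution\<close>

text \<open>The primitive \<open>\<integral>\<^sub>0\<^sup>\<tau> exp (- u z) du\<close>, which is also meaningful for \<open>z = 0\<close>.\<close>

definition exp_primitive :: "real \<Rightarrow> complex \<Rightarrow> complex" where
  "exp_primitive \<tau> z = (if z = 0 then complex_of_real \<tau> else (1 - exp (- complex_of_real \<tau> * z)) / z)"

lemma exp_primitive_mult: "z * exp_primitive \<tau> z = 1 - exp (- complex_of_real \<tau> * z)"
  by (simp add: exp_primitive_def)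

lemma norm_exp_primitive_le:
  assumes "Re z \<ge> 0" "\<tau> \<ge> 0"
  shows "norm (exp_primitive \<tau> z) \<le> \<tau>"
proof (cases "z = 0")
  case False
  have "norm (exp (- complex_of_real \<tau> * z) - (\<Sum>j\<le>0. (- complex_of_real \<tau> * z) ^ j / fact j)) \<le>
      max 1 (exp (Re (- complex_of_real \<tau> * z))) * norm (- complex_of_real \<tau> * z) ^ Suc 0"
    by (rule exp_Taylor_remainder)
  also have "\<dots> = \<tau> * norm z"
  proof -
    have "exp (Re (- complex_of_real \<tau> * z)) \<le> 1" using assms by simp
    then show ?thesis using assms(2) by (simp only: max_absorb1) (simp add: norm_mult)
  qed
  finally have "norm (1 - exp (- complex_of_real \<tau> * z)) \<le> \<tau> * norm z" by (simp add: norm_minus_commute)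
  then show ?thesis using False by (simp add: exp_primitive_def norm_divide pos_divide_le_eq)
qed (use assms in \<open>simp add: exp_primitive_def\<close>)

text \<open>Singular at \<open>z = 0\<close> but uniform in \<open>\<tau>\<close>, as a dominating
  function for the limit of large time has to be.\<close>

lemma norm_exp_primitive_le':
  assumes "Re z > 0" "\<tau> \<ge> 0"
  shows "norm (exp_primitive \<tau> z) \<le> 2 / norm z"
proof -
  have "norm (1 - exp (- complex_of_real \<tau> * z)) \<le> 1 + norm (exp (- complex_of_real \<tau> * z))"
    using norm_triangle_ineq4[of 1 "exp (- complex_of_real \<tau> * z)"] by simp
  also have "\<dots> \<le> 2" using assms by simp
  finally show ?thesis using assms by (auto simp: exp_primitive_def norm_divide intro!: divide_right_mono)
qed

text \<open>For \<open>t < \<tau>\<close> the Taylor bound at \<open>\<tau>\<close> contains a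
  growing exponential. Multiplied by the size of \<open>exp (- \<tau> z)\<close> it becomes the size
  of \<open>exp (- t z)\<close>, which is at most \<open>1\<close>, so both directions are
  covered.\<close>

lemma exp_primitive_quadratic:
  assumes "Re z \<ge> 0" "\<tau> \<ge> 0" "t \<ge> 0"
  shows "norm (exp_primitive t z - exp_primitive \<tau> z - (t - \<tau>) *\<^sub>R exp (- complex_of_real \<tau> * z)) \<le> norm z * (t - \<tau>)\<^sup>2"
proof (cases "z = 0")
  case True
  then show ?thesis by (simp add: exp_primitive_def scaleR_conv_of_real)
next
  case False
  define w where "w = - complex_of_real (t - \<tau>) * z"
  have "exp (- complex_of_real t * z) = exp (- complex_of_real \<tau> * z) * exp w"
    unfolding exp_add[symmetric] by (rule arg_cong[where f = exp]) (simp add: w_def algebra_simps)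
  then have eq: "exp_primitive t z - exp_primitive \<tau> z - (t - \<tau>) *\<^sub>R exp (- complex_of_real \<tau> * z) =
      - (exp (- complex_of_real \<tau> * z) * (exp w - (\<Sum>j\<le>1. w ^ j / fact j)) / z)"
    using False by (simp add: exp_primitive_def scaleR_conv_of_real w_def field_simps)
  have "norm (exp (- complex_of_real \<tau> * z) * (exp w - (\<Sum>j\<le>1. w ^ j / fact j))) \<le>
      norm (exp (- complex_of_real \<tau> * z)) * (max 1 (exp (Re w)) * norm w ^ Suc 1)"
    unfolding norm_mult by (intro mult_left_mono exp_Taylor_remainder) auto
  also have "\<dots> = (norm (exp (- complex_of_real \<tau> * z)) * max 1 (exp (Re w))) * norm w ^ Suc 1" by simp
  also have "\<dots> \<le> 1 * norm w ^ Suc 1"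
  proof (rule mult_right_mono)
    have "norm (exp (- complex_of_real \<tau> * z)) * max 1 (exp (Re w)) = max (exp (- \<tau> * Re z)) (exp (- \<tau> * Re z) * exp (Re w))"
      by (simp add: max_mult_distrib_left)
    also have "exp (- \<tau> * Re z) * exp (Re w) = exp (- t * Re z)"
      unfolding exp_add[symmetric] by (rule arg_cong[where f = exp]) (simp add: w_def algebra_simps)
    finally show "norm (exp (- complex_of_real \<tau> * z)) * max 1 (exp (Re w)) \<le> 1" using assms by simp
  qed simp
  also have "\<dots> = norm z * (norm z * (t - \<tau>)\<^sup>2)"
  proof -
    have "norm w = \<bar>t - \<tau>\<bar> * norm z" by (simp only: w_def norm_mult norm_minus_cancel norm_of_real)
    then have "norm w ^ Suc 1 = \<bar>t - \<tau>\<bar>\<^sup>2 * (norm z * norm z)" by (simp add: power2_eq_square)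
    then show ?thesis by (simp add: mult_ac)
  qed
  finally show ?thesis unfolding eq using False by (simp add: norm_divide pos_divide_le_eq mult.commute)
qed

text \<open>At integer points the integral factorises into the orthogonality relations of the
  exponentials on \<open>{- pi..pi}\<close>. This is what produces \<open>grid_delta\<close> on the
  right hand side of the evolution equation.\<close>

lemma fourier_indicator_cube:
  fixes y :: "real^'d::finite"
  assumes "\<And>k. y $ k \<in> \<int>"
  shows "fourier (\<lambda>\<theta>. complex_of_real (indicator (cube pi) \<theta>)) y = (if y = 0 then 1 else 0)"
proof -
  from assms have "\<forall>k. \<exists>m::int. y $ k = of_int m" by (auto elim: Ints_cases)
  then obtain m :: "'d \<Rightarrow> int" where m: "\<And>k. y $ k = of_int (m k)" by metis
  have "complex_of_real (indicator (cube pi) \<theta>) * plane_wave \<theta> y =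
      (\<Prod>k\<in>UNIV. complex_of_real (indicator {- pi..pi} (\<theta> $ k)) * exp (\<i> * complex_of_real (of_int (m k) * \<theta> $ k)))" for \<theta>
  proof -
    have "(\<Prod>k\<in>UNIV. complex_of_real (indicator {- pi..pi} (\<theta> $ k))) = complex_of_real (indicator (cube pi) \<theta>)"
    proof (cases "\<theta> \<in> cube pi")
      case False
      then obtain k where "\<theta> $ k \<notin> {- pi..pi}" unfolding cube_def by blast
      then have "\<exists>k\<in>UNIV. complex_of_real (indicator {- pi..pi} (\<theta> $ k)) = 0" by (intro bexI[of _ k]) auto
      then show ?thesis using False by (simp add: prod_zero)
    qed (auto simp: cube_def)
    moreover have "(\<Prod>k\<in>UNIV. exp (\<i> * complex_of_real (of_int (m k) * \<theta> $ k))) = plane_wave \<theta> y"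
      by (simp add: plane_wave_def inner_vec_def m exp_sum sum_distrib_left)
    ultimately show ?thesis by (simp add: prod.distrib)
  qed
  then have "(LINT \<theta>|lborel. complex_of_real (indicator (cube pi) \<theta>) * plane_wave \<theta> y) =
      (\<Prod>k\<in>UNIV. if m k = 0 then 2 * complex_of_real pi else 0)"
    using lborel_product_vec(2)[of "\<lambda>k x. complex_of_real (indicator {- pi..pi} x) * exp (\<i> * complex_of_real (of_int (m k) * x))"]
    by (simp only: integral_exp_int_frequency)
  also have "\<dots> = (if y = 0 then (2 * complex_of_real pi) ^ CARD('d) else 0)"
  proof (cases "y = 0")
    case True
    then have "m k = 0" for k using m[of k] by simp
    then show ?thesis using True by simp
  next
    case False
    then obtain k where "m k \<noteq> 0" using m by (metis vec_eq_iff zero_index of_int_0)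
    then have "\<exists>k\<in>UNIV. (if m k = 0 then 2 * complex_of_real pi else 0) = 0" by (intro bexI[of _ k]) auto
    then show ?thesis using False by (simp add: prod_zero)
  qed
  finally show ?thesis by (simp add: fourier_def)
qed

section \<open>The solution in scaled variables\<close>

locale subcritical_scheme = elliptic_scheme l lhat M b a
  for l lhat M :: nat and b :: "'d::finite cpoly" and a :: "(nat^'d) \<times> (nat^'d) \<Rightarrow> complex" +
  assumes l_less: "l < CARD('d)"
begin

abbreviation cut :: "real^'d \<Rightarrow> complex" where "cut \<theta> \<equiv> complex_of_real (indicator (cube pi) \<theta>)"

definition V :: "real^'d \<Rightarrow> real \<Rightarrow> complex" where
  "V y \<tau> = fourier (\<lambda>\<theta>. cut \<theta> * exp_primitive \<tau> (A \<theta>)) y"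

definition G :: "real^'d \<Rightarrow> real \<Rightarrow> complex" where
  "G y \<tau> = fourier (\<lambda>\<theta>. cut \<theta> * exp (- complex_of_real \<tau> * A \<theta>)) y"

lemma measurable_symbol [measurable]: "A \<in> borel_measurable borel"
  by (intro borel_measurable_continuous_onI continuous_intros)

lemma measurable_poly_symbol [measurable]: "P \<in> borel_measurable borel"
  by (intro borel_measurable_continuous_onI continuous_intros)

lemma measurable_exp_primitive [measurable]: "(\<lambda>\<theta>. exp_primitive \<tau> (A \<theta>)) \<in> borel_measurable borel"
  unfolding exp_primitive_def by measurable

lemma symbol_Re_nonneg: "\<theta> \<in> cube pi \<Longrightarrow> Re (A \<theta>) \<ge> 0"
  using c0(2)[of \<theta>] c0(1) by (meson mult_nonneg_nonneg norm_ge_zero zero_le_power less_imp_le order.trans)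

lemma symbol_bounded: "\<exists>C\<ge>0. \<forall>\<theta>\<in>cube pi. norm (A \<theta>) \<le> C"
proof -
  have "compact (A ` cube pi)" by (intro compact_continuous_image compact_cube continuous_intros)
  then obtain C where "\<forall>z\<in>A ` cube pi. norm z \<le> C" using compact_imp_bounded bounded_iff by blast
  then show ?thesis by (intro exI[of _ "max 0 C"] conjI ballI, simp, intro max.coboundedI2) auto
qed

lemma rapid_exp_primitive: "\<tau> \<ge> 0 \<Longrightarrow> rapid (\<lambda>\<theta>. cut \<theta> * exp_primitive \<tau> (A \<theta>))"
  by (rule rapid_cube[of _ _ \<tau>]) (auto intro: norm_exp_primitive_le symbol_Re_nonneg)

lemma rapid_exp_symbol: "\<tau> \<ge> 0 \<Longrightarrow> rapid (\<lambda>\<theta>. cut \<theta> * exp (- complex_of_real \<tau> * A \<theta>))"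
  by (rule rapid_cube[of _ _ 1]) (auto simp: symbol_Re_nonneg)

lemma V_has_derivative:
  assumes "\<tau> \<ge> 0"
  shows "(V y has_vector_derivative G y \<tau>) (at \<tau> within {0..})"
proof -
  obtain C where C: "C \<ge> 0" "\<And>\<theta>. \<theta> \<in> cube pi \<Longrightarrow> norm (A \<theta>) \<le> C" using symbol_bounded by blast
  have i1: "integrable lborel (\<lambda>\<theta>::real^'d. indicator (cube pi) \<theta> *\<^sub>R (1::real))"
    by (intro borel_integrable_compact compact_cube continuous_intros)
  show ?thesis
  proof (rule has_vector_derivative_quadratic)
    fix t :: real assume "t \<in> {0..}"
    then have t: "t \<ge> 0" by simp
    let ?f = "\<lambda>\<theta>. cut \<theta> * exp_primitive t (A \<theta>) - cut \<theta> * exp_primitive \<tau> (A \<theta>) -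
        complex_of_real (t - \<tau>) * (cut \<theta> * exp (- complex_of_real \<tau> * A \<theta>))"
    note i = rapid_integrable[OF rapid_exp_primitive[OF t]] rapid_integrable[OF rapid_exp_primitive[OF assms]]
      integrable_mult_right[OF rapid_integrable[OF rapid_exp_symbol[OF assms]], of "complex_of_real (t - \<tau>)"]
    have eq: "V y t - V y \<tau> - (t - \<tau>) *\<^sub>R G y \<tau> = fourier ?f y"
    proof -
      have "(t - \<tau>) *\<^sub>R G y \<tau> = fourier (\<lambda>\<theta>. complex_of_real (t - \<tau>) * (cut \<theta> * exp (- complex_of_real \<tau> * A \<theta>))) y"
        unfolding fourier_cmult G_def by (simp only: scaleR_conv_of_real)
      then show ?thesis unfolding V_def
        by (simp only: fourier_diff[OF i(1) i(2)] fourier_diff[OF Bochner_Integration.integrable_diff[OF i(1) i(2)] i(3)])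
    qed
    have "norm (V y t - V y \<tau> - (t - \<tau>) *\<^sub>R G y \<tau>) \<le> (LINT \<theta>|lborel. norm (?f \<theta>))"
      unfolding eq by (intro fourier_norm_le Bochner_Integration.integrable_diff i)
    also have "\<dots> \<le> (LINT \<theta>::real^'d|lborel. (C * (t - \<tau>)\<^sup>2) * (indicator (cube pi) \<theta> *\<^sub>R 1))"
    proof (rule integral_mono)
      show "integrable lborel (\<lambda>\<theta>. norm (?f \<theta>))"
        by (intro integrable_norm Bochner_Integration.integrable_diff i)
      show "integrable lborel (\<lambda>\<theta>::real^'d. (C * (t - \<tau>)\<^sup>2) * (indicator (cube pi) \<theta> *\<^sub>R (1::real)))"
        using i1 by (rule integrable_mult_right)
      show "norm (?f \<theta>) \<le> (C * (t - \<tau>)\<^sup>2) * (indicator (cube pi) \<theta> *\<^sub>R 1)" for \<theta>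
      proof (cases "\<theta> \<in> cube pi")
        case True
        have "norm (exp_primitive t (A \<theta>) - exp_primitive \<tau> (A \<theta>) - (t - \<tau>) *\<^sub>R exp (- complex_of_real \<tau> * A \<theta>)) \<le>
            norm (A \<theta>) * (t - \<tau>)\<^sup>2"
          by (intro exp_primitive_quadratic symbol_Re_nonneg True t assms)
        also have "\<dots> \<le> C * (t - \<tau>)\<^sup>2" by (intro mult_right_mono C True) auto
        finally show ?thesis using True by (simp add: scaleR_conv_of_real)
      qed simp
    qed
    also have "\<dots> = (C * (LINT \<theta>::real^'d|lborel. indicator (cube pi) \<theta> *\<^sub>R 1)) * (t - \<tau>)\<^sup>2" by simp
    finally show "norm (V y t - V y \<tau> - (t - \<tau>) *\<^sub>R G y \<tau>) \<le> (C * (LINT \<theta>::real^'d|lborel. indicator (cube pi) \<theta> *\<^sub>R 1)) * (t - \<tau>)\<^sup>2" .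
  qed
qed

text \<open>The explicit formula in the original variables: the substitution
  \<open>\<theta> = \<epsilon> \<eta>\<close> contributes the power \<open>- d\<close> of
  \<open>\<epsilon>\<close>, and the factor in front of the symbol in the denominator contributes
  the power \<open>l\<close>.\<close>

definition W :: "real \<Rightarrow> real^'d \<Rightarrow> real \<Rightarrow> complex" where
  "W \<epsilon> x t = 1 / complex_of_real \<epsilon> ^ (CARD('d) - l) * V ((1 / \<epsilon>) *\<^sub>R x) (t / \<epsilon> ^ l)"

text \<open>The operator multiplies the amplitude by the symbol, which cancels the denominator:
  \<open>A\<close> times \<open>exp_primitive \<tau> A\<close> is
  \<open>1 - exp (- \<tau> A)\<close>. The \<open>1\<close> gives the grid delta, the exponential
  gives minus the time derivative of \<open>W\<close>.\<close>

lemma diff_op_W: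
  assumes \<epsilon>: "\<epsilon> > 0" and t: "t \<ge> 0"
  shows "diff_op l lhat a \<epsilon> (\<lambda>z. W \<epsilon> z t) x = 1 / complex_of_real \<epsilon> ^ CARD('d) *
     (fourier cut ((1 / \<epsilon>) *\<^sub>R x) - G ((1 / \<epsilon>) *\<^sub>R x) (t / \<epsilon> ^ l))"
proof -
  define \<tau> where "\<tau> = t / \<epsilon> ^ l"
  have \<tau>: "\<tau> \<ge> 0" using \<epsilon> t by (simp add: \<tau>_def)
  define c where "c = 1 / complex_of_real \<epsilon> ^ (CARD('d) - l)"
  \<comment> \<open>With the argument divided by \<open>\<epsilon>\<close>, a grid step becomes a
    unit step, which is why the multiplier lemma is used with \<open>\<omega> = 1\<close>.\<close>
  define U where "U = (\<lambda>\<phi> z. c * fourier \<phi> ((1 / \<epsilon>) *\<^sub>R (z::real^'d)))"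
  define \<phi> where "\<phi> = (\<lambda>\<theta>. cut \<theta> * exp_primitive \<tau> (A \<theta>))"
  have \<phi>: "rapid \<phi>" unfolding \<phi>_def by (rule rapid_exp_primitive[OF \<tau>])
  have WU: "(\<lambda>z. W \<epsilon> z t) = U \<phi>" by (simp add: W_def U_def V_def c_def \<phi>_def \<tau>_def)
  have shift: "fourier \<psi> (y + \<sigma> *\<^sub>R axis k 1) - fourier \<psi> y = fourier (\<lambda>\<eta>. (exp (\<i> * complex_of_real (\<sigma> * \<eta> $ k)) - 1) * \<psi> \<eta>) y"
    and rapid_shift: "rapid (\<lambda>\<eta>. (exp (\<i> * complex_of_real (\<sigma> * \<eta> $ k)) - 1) * \<psi> \<eta>)"
    if \<psi>: "rapid \<psi>" for \<psi> :: "real^'d \<Rightarrow> complex" and y k \<sigma>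
  proof -
    have r: "rapid (\<lambda>\<eta>. exp (\<i> * complex_of_real (\<sigma> * \<eta> $ k)) * \<psi> \<eta>)"
      by (rule rapid_mult[OF \<psi>, where C = 1 and N = 0]) auto
    have "fourier \<psi> (y + \<sigma> *\<^sub>R axis k 1) = fourier (\<lambda>\<eta>. exp (\<i> * complex_of_real (\<sigma> * \<eta> $ k)) * \<psi> \<eta>) y"
      unfolding fourier_def plane_wave_shift by (simp add: mult_ac)
    then show "fourier \<psi> (y + \<sigma> *\<^sub>R axis k 1) - fourier \<psi> y = fourier (\<lambda>\<eta>. (exp (\<i> * complex_of_real (\<sigma> * \<eta> $ k)) - 1) * \<psi> \<eta>) y"
      using fourier_diff[OF rapid_integrable[OF r] rapid_integrable[OF \<psi>], of y] by (simp add: left_diff_distrib)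
    show "rapid (\<lambda>\<eta>. (exp (\<i> * complex_of_real (\<sigma> * \<eta> $ k)) - 1) * \<psi> \<eta>)"
    proof (rule rapid_mult[OF \<psi>, where C = 2 and N = 0])
      show "norm (exp (\<i> * complex_of_real (\<sigma> * \<eta> $ k)) - 1) \<le> 2 * (1 + norm \<eta>) ^ 0" for \<eta> :: "real^'d"
        using norm_triangle_ineq4[of "exp (\<i> * complex_of_real (\<sigma> * \<eta> $ k))" 1] by simp
    qed measurable
  qed
  have plus: "diff_plus \<epsilon> k (U \<psi>) = U (\<lambda>\<eta>. (exp (\<i> * complex_of_real (1 * \<eta> $ k)) - 1) * \<psi> \<eta>)" if "rapid \<psi>" for k \<psi>
  proof
    fix z :: "real^'d"
    have "(1 / \<epsilon>) *\<^sub>R (z + \<epsilon> *\<^sub>R axis k 1) = (1 / \<epsilon>) *\<^sub>R z + 1 *\<^sub>R axis k 1" using \<epsilon> by (simp add: scaleR_add_right)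
    then show "diff_plus \<epsilon> k (U \<psi>) z = U (\<lambda>\<eta>. (exp (\<i> * complex_of_real (1 * \<eta> $ k)) - 1) * \<psi> \<eta>) z"
      unfolding diff_plus_def U_def right_diff_distrib[symmetric] shift[OF that, symmetric] by simp
  qed
  have minus: "diff_minus \<epsilon> k (U \<psi>) = U (\<lambda>\<eta>. (exp (- \<i> * complex_of_real (1 * \<eta> $ k)) - 1) * \<psi> \<eta>)" if "rapid \<psi>" for k \<psi>
  proof
    fix z :: "real^'d"
    have "(1 / \<epsilon>) *\<^sub>R (z - \<epsilon> *\<^sub>R axis k 1) = (1 / \<epsilon>) *\<^sub>R z + (- 1) *\<^sub>R axis k 1" using \<epsilon> by (simp add: scaleR_diff_right)
    then show "diff_minus \<epsilon> k (U \<psi>) z = U (\<lambda>\<eta>. (exp (- \<i> * complex_of_real (1 * \<eta> $ k)) - 1) * \<psi> \<eta>) z"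
      unfolding diff_minus_def U_def right_diff_distrib[symmetric] using shift[OF that, of "(1 / \<epsilon>) *\<^sub>R z" "- 1" k] by simp
  qed
  have rapid_minus: "rapid (\<lambda>\<eta>. (exp (- \<i> * complex_of_real (1 * \<eta> $ k)) - 1) * \<psi> \<eta>)" if "rapid \<psi>" for k and \<psi> :: "real^'d \<Rightarrow> complex"
    using rapid_shift[OF that, of "-1" k] by simp
  note m = diff_op_multiplier[where U = U and S = "{\<phi>. rapid \<phi>}" and \<omega> = 1 and \<epsilon> = \<epsilon> and \<phi> = \<phi>, unfolded mem_Collect_eq,
      OF minus plus rapid_minus rapid_shift \<phi>]
  have s1: "diff_op l lhat a \<epsilon> (U \<phi>) x = 1 / complex_of_real \<epsilon> ^ l *
      (\<Sum>\<nu>\<in>diff_indices l lhat. a \<nu> * U (\<lambda>\<eta>. (\<Prod>k\<in>UNIV. diff_factor 1 k \<nu> \<eta>) * \<phi> \<eta>) x)"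
    by (rule m(1))
  have s2: "(\<Sum>\<nu>\<in>diff_indices l lhat. a \<nu> * U (\<lambda>\<eta>. (\<Prod>k\<in>UNIV. diff_factor 1 k \<nu> \<eta>) * \<phi> \<eta>) x) =
      c * (\<Sum>\<nu>\<in>diff_indices l lhat. fourier (\<lambda>\<eta>. a \<nu> * ((\<Prod>k\<in>UNIV. diff_factor 1 k \<nu> \<eta>) * \<phi> \<eta>)) ((1 / \<epsilon>) *\<^sub>R x))"
    unfolding fourier_cmult U_def by (simp add: sum_distrib_left mult_ac)
  have s3: "(\<Sum>\<nu>\<in>diff_indices l lhat. fourier (\<lambda>\<eta>. a \<nu> * ((\<Prod>k\<in>UNIV. diff_factor 1 k \<nu> \<eta>) * \<phi> \<eta>)) ((1 / \<epsilon>) *\<^sub>R x)) =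
      fourier (\<lambda>\<eta>. \<Sum>\<nu>\<in>diff_indices l lhat. a \<nu> * ((\<Prod>k\<in>UNIV. diff_factor 1 k \<nu> \<eta>) * \<phi> \<eta>)) ((1 / \<epsilon>) *\<^sub>R x)"
    by (rule fourier_sum[symmetric]) (intro integrable_mult_right rapid_integrable m(2))
  have s4: "(\<lambda>\<eta>. \<Sum>\<nu>\<in>diff_indices l lhat. a \<nu> * ((\<Prod>k\<in>UNIV. diff_factor 1 k \<nu> \<eta>) * \<phi> \<eta>)) =
      (\<lambda>\<theta>. cut \<theta> - cut \<theta> * exp (- complex_of_real \<tau> * A \<theta>))"
  proof
    fix \<eta>
    have "(\<Sum>\<nu>\<in>diff_indices l lhat. a \<nu> * ((\<Prod>k\<in>UNIV. diff_factor 1 k \<nu> \<eta>) * \<phi> \<eta>)) = A (1 *\<^sub>R \<eta>) * \<phi> \<eta>"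
      unfolding diff_symbol_eq by (simp add: sum_distrib_right mult.assoc)
    also have "\<dots> = cut \<eta> * (A \<eta> * exp_primitive \<tau> (A \<eta>))" by (simp add: \<phi>_def mult_ac)
    also have "\<dots> = cut \<eta> - cut \<eta> * exp (- complex_of_real \<tau> * A \<eta>)"
      unfolding exp_primitive_mult by (simp add: right_diff_distrib)
    finally show "(\<Sum>\<nu>\<in>diff_indices l lhat. a \<nu> * ((\<Prod>k\<in>UNIV. diff_factor 1 k \<nu> \<eta>) * \<phi> \<eta>)) =
        cut \<eta> - cut \<eta> * exp (- complex_of_real \<tau> * A \<eta>)" .
  qed
  have s5: "fourier (\<lambda>\<theta>. cut \<theta> - cut \<theta> * exp (- complex_of_real \<tau> * A \<theta>)) ((1 / \<epsilon>) *\<^sub>R x) =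
      fourier cut ((1 / \<epsilon>) *\<^sub>R x) - G ((1 / \<epsilon>) *\<^sub>R x) \<tau>"
  proof -
    have "integrable lborel cut" using rapid_integrable[OF rapid_exp_symbol[of 0]] by simp
    then show ?thesis unfolding G_def using rapid_integrable[OF rapid_exp_symbol[OF \<tau>]] by (rule fourier_diff[symmetric])
  qed
  have s6: "1 / complex_of_real \<epsilon> ^ l * (c * (fourier cut ((1 / \<epsilon>) *\<^sub>R x) - G ((1 / \<epsilon>) *\<^sub>R x) \<tau>)) =
      1 / complex_of_real \<epsilon> ^ CARD('d) * (fourier cut ((1 / \<epsilon>) *\<^sub>R x) - G ((1 / \<epsilon>) *\<^sub>R x) \<tau>)"
    using l_less by (simp add: c_def flip: power_add)
  show ?thesis unfolding WU \<tau>_def[symmetric] s1 s2 s3 s4 s5 by (rule s6)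
qed

text \<open>\<open>W\<close> is bounded at each time by the integral of its amplitude, which is
  enough for the uniqueness lemma; no decay of \<open>W\<close> in space has to be
  established.\<close>

lemma second_green_explicit:
  assumes \<epsilon>: "\<epsilon> > 0" and v: "second_green l lhat a \<epsilon> v" and x: "x \<in> grid \<epsilon>" and t: "t \<ge> 0"
  shows "v x t = W \<epsilon> x t"
proof -
  let ?W' = "\<lambda>x t. 1 / complex_of_real \<epsilon> ^ CARD('d) * G ((1 / \<epsilon>) *\<^sub>R x) (t / \<epsilon> ^ l)"
  have W0: "W \<epsilon> x 0 = 0" for x
  proof -
    have "exp_primitive 0 z = 0" for z by (simp add: exp_primitive_def)
    then show ?thesis by (simp add: W_def V_def fourier_def)
  qed
  have der: "(W \<epsilon> x has_vector_derivative ?W' x t) (at t within {0..})" if t: "t \<ge> 0" for x t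
  proof -
    have "((\<lambda>t. t / \<epsilon> ^ l) has_vector_derivative (1 / \<epsilon> ^ l)) (at t within {0..})"
      using \<epsilon> by (auto intro!: derivative_eq_intros)
    moreover have "(V ((1 / \<epsilon>) *\<^sub>R x) has_vector_derivative G ((1 / \<epsilon>) *\<^sub>R x) (t / \<epsilon> ^ l)) (at (t / \<epsilon> ^ l) within (\<lambda>t. t / \<epsilon> ^ l) ` {0..})"
      by (rule has_vector_derivative_within_subset[OF V_has_derivative]) (use \<epsilon> t in auto)
    ultimately have "(V ((1 / \<epsilon>) *\<^sub>R x) \<circ> (\<lambda>t. t / \<epsilon> ^ l) has_vector_derivative (1 / \<epsilon> ^ l) *\<^sub>R G ((1 / \<epsilon>) *\<^sub>R x) (t / \<epsilon> ^ l)) (at t within {0..})"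
      by (rule vector_diff_chain_within)
    then have "((\<lambda>t. 1 / complex_of_real \<epsilon> ^ (CARD('d) - l) * V ((1 / \<epsilon>) *\<^sub>R x) (t / \<epsilon> ^ l)) has_vector_derivative
        1 / complex_of_real \<epsilon> ^ (CARD('d) - l) * ((1 / \<epsilon> ^ l) *\<^sub>R G ((1 / \<epsilon>) *\<^sub>R x) (t / \<epsilon> ^ l))) (at t within {0..})"
      unfolding o_def by (rule has_vector_derivative_mult_right)
    moreover have "1 / complex_of_real \<epsilon> ^ (CARD('d) - l) * ((1 / \<epsilon> ^ l) *\<^sub>R G ((1 / \<epsilon>) *\<^sub>R x) (t / \<epsilon> ^ l)) = ?W' x t"
      using l_less by (simp add: scaleR_conv_of_real power_add[symmetric] del: power_add)
    ultimately show ?thesis unfolding W_def[abs_def] by simp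
  qed
  have eq: "?W' x t + diff_op l lhat a \<epsilon> (\<lambda>z. W \<epsilon> z t) x = grid_delta \<epsilon> x" if x: "x \<in> grid \<epsilon>" and t: "t > 0" for x t
  proof -
    have "fourier cut ((1 / \<epsilon>) *\<^sub>R x) = (if x = 0 then 1 else 0)"
    proof -
      have "((1 / \<epsilon>) *\<^sub>R x) $ k \<in> \<int>" for k
        using x \<epsilon> by (auto simp: grid_def dest!: spec[of _ k])
      from fourier_indicator_cube[OF this] show ?thesis using \<epsilon> by simp
    qed
    then show ?thesis using diff_op_W[OF \<epsilon>, of t x] t by (simp add: grid_delta_def right_diff_distrib)
  qed
  have bound: "\<exists>C. \<forall>x\<in>grid \<epsilon>. norm (W \<epsilon> x t) \<le> C" if t: "t \<ge> 0" for t
  proof -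
    have \<tau>: "t / \<epsilon> ^ l \<ge> 0" using t \<epsilon> by simp
    have "norm (W \<epsilon> x t) \<le> norm (1 / complex_of_real \<epsilon> ^ (CARD('d) - l)) *
        (LINT \<theta>|lborel. norm (cut \<theta> * exp_primitive (t / \<epsilon> ^ l) (A \<theta>)))" for x
      unfolding W_def norm_mult V_def
      by (intro mult_left_mono order.trans[OF fourier_norm_le] rapid_integrable rapid_exp_primitive \<tau>) (auto simp: norm_mult)
    then show ?thesis by blast
  qed
  show ?thesis by (rule second_green_unique[OF v bound W0 der eq x t])
qed

section \<open>The limit for large time\<close>

lemma norm_symbol_lower_bound: "\<theta> \<in> cube pi \<Longrightarrow> c0 * norm \<theta> ^ l \<le> norm (A \<theta>)"
  using c0(2) complex_Re_le_cmod order.trans by blast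

lemma Omega_eq: "Omega l lhat a y = fourier (\<lambda>\<theta>. cut \<theta> * (1 / A \<theta>)) y"
  unfolding Omega_def fourier_def set_lebesgue_integral_def plane_wave_def
  by (simp add: scaleR_conv_of_real)

text \<open>Dominated convergence: away from the origin \<open>exp (- \<tau> A)\<close> tends to
  \<open>0\<close>, and the majorant \<open>2 / (c0 * norm \<theta> ^ l)\<close> is integrable over
  the cube because \<open>l < d\<close>.\<close>

lemma V_tendsto_Omega: "(V y \<longlongrightarrow> Omega l lhat a y) at_top"
proof -
  let ?w = "\<lambda>\<theta>::real^'d. 2 / c0 * (indicator (cube pi) \<theta> * (1 / norm \<theta> ^ l))"
  have "((\<lambda>\<tau>. LINT \<theta>|lborel. (cut \<theta> * exp_primitive \<tau> (A \<theta>)) * plane_wave \<theta> y) \<longlongrightarrow>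
      (LINT \<theta>|lborel. (cut \<theta> * (1 / A \<theta>)) * plane_wave \<theta> y)) at_top"
  proof (rule integral_dominated_convergence_at_top)
    show "integrable lborel ?w"
      by (intro integrable_mult_right integrable_inverse_norm_power l_less)
    have null: "AE \<theta>::real^'d in lborel. \<theta> \<noteq> 0" by (rule AE_lborel_singleton)
    have Re_pos: "Re (A \<theta>) > 0" if "\<theta> \<in> cube pi" "\<theta> \<noteq> 0" for \<theta>
      using symbol_pos that by auto
    show "\<forall>\<^sub>F \<tau> in at_top. AE \<theta> in lborel. norm (cut \<theta> * exp_primitive \<tau> (A \<theta>) * plane_wave \<theta> y) \<le> ?w \<theta>"
      using eventually_ge_at_top[of 0]
    proof eventually_elim
      case (elim \<tau>)
      show ?case using null
      proof eventually_elim
        case (elim \<theta>)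
        show ?case
        proof (cases "\<theta> \<in> cube pi")
          case True
          have n: "norm \<theta> ^ l > 0" using elim by simp
          have "norm (exp_primitive \<tau> (A \<theta>)) \<le> 2 / norm (A \<theta>)"
            using Re_pos[OF True elim] \<open>0 \<le> \<tau>\<close> by (rule norm_exp_primitive_le')
          also have "\<dots> \<le> 2 / (c0 * norm \<theta> ^ l)"
            using norm_symbol_lower_bound[OF True] mult_pos_pos[OF c0(1) n] by (intro frac_le) auto
          finally show ?thesis using True by (simp add: norm_mult)
        qed simp
      qed
    qed
    show "AE \<theta> in lborel. ((\<lambda>\<tau>. cut \<theta> * exp_primitive \<tau> (A \<theta>) * plane_wave \<theta> y) \<longlongrightarrow> cut \<theta> * (1 / A \<theta>) * plane_wave \<theta> y) at_top"
      using null
    proof eventually_elim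
      case (elim \<theta>)
      show ?case
      proof (cases "\<theta> \<in> cube pi")
        case True
        have "((\<lambda>\<tau>. exp (- complex_of_real \<tau> * A \<theta>)) \<longlongrightarrow> 0) at_top"
        proof (rule Lim_null_comparison)
          show "\<forall>\<^sub>F \<tau> in at_top. norm (exp (- complex_of_real \<tau> * A \<theta>)) \<le> exp (- (Re (A \<theta>) * \<tau>))"
            by (intro always_eventually) (simp add: mult.commute)
          show "((\<lambda>\<tau>. exp (- (Re (A \<theta>) * \<tau>))) \<longlongrightarrow> 0) at_top"
            using Re_pos[OF True elim]
            by (intro filterlim_compose[OF exp_at_bot] filterlim_compose[OF filterlim_uminus_at_bot_at_top]
                filterlim_tendsto_pos_mult_at_top[OF tendsto_const] filterlim_ident)
        qed
        then have "((\<lambda>\<tau>. cut \<theta> * ((1 - exp (- complex_of_real \<tau> * A \<theta>)) / A \<theta>) * plane_wave \<theta> y) \<longlongrightarrow>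
            cut \<theta> * ((1 - 0) / A \<theta>) * plane_wave \<theta> y) at_top"
          using Re_pos[OF True elim] by (intro tendsto_intros) auto
        moreover have "A \<theta> \<noteq> 0" using Re_pos[OF True elim] by auto
        ultimately show ?thesis by (simp add: exp_primitive_def)
      qed simp
    qed
  qed measurable
  from tendsto_mult_left[OF this, of "1 / (2 * complex_of_real pi) ^ CARD('d)"]
  show ?thesis unfolding Omega_eq V_def[abs_def] fourier_def .
qed

text \<open>The choice \<open>exp_polys\<close> leaves its value at index \<open>0\<close>
  arbitrary; setting that coefficient to \<open>1\<close> lets \<open>H_0\<close> and the other
  \<open>H_k\<close> be treated alike.\<close>

abbreviation "Qh k \<xi> \<equiv> (if k = 0 then 1 else Q k \<xi>)"

lemma polyfun_Qh: "polyfun (\<lambda>\<xi>. Qh k \<xi>)"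
  by (cases "k = 0") (auto simp: polyfun_def[of "poly_eval _"] intro: polyfun_const)

lemma rapid_exp_poly_symbol: "rapid (\<lambda>\<xi>. exp (- P \<xi>))"
  unfolding rapid_def
proof (intro conjI allI)
  show "(\<lambda>\<xi>. exp (- P \<xi>)) \<in> borel_measurable borel" by measurable
  show "integrable lborel (\<lambda>\<xi>. (1 + norm \<xi>) ^ N * norm (exp (- P \<xi>)))" for N
  proof (rule Bochner_Integration.integrable_bound[OF integrable_poly_exp_power[OF c0(1) l_pos, of N]])
    show "AE \<xi> in lborel. norm ((1 + norm \<xi>) ^ N * norm (exp (- P \<xi>))) \<le> norm ((1 + norm \<xi>) ^ N * exp (- c0 * norm \<xi> ^ l))"
      using c0(3) by (intro AE_I2) (auto intro!: mult_left_mono)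
  qed measurable
qed

lemma rapid_Qh: "rapid (\<lambda>\<xi>. Qh k \<xi> * exp (- P \<xi>))"
  by (rule rapid_polyfun[OF rapid_exp_poly_symbol polyfun_Qh])

lemma Hk_eq: "Hk_fun l lhat a b k = fourier (\<lambda>\<xi>. Qh k \<xi> * exp (- P \<xi>))"
proof -
  have H: "H_fun b = fourier (\<lambda>\<xi>. exp (- P \<xi>))"
    unfolding H_fun_def[abs_def] fourier_def plane_wave_def ..
  show ?thesis
    unfolding Hk_fun_def H poly_D_fourier[OF rapid_exp_poly_symbol] by auto
qed

lemma Hk_continuous: "continuous_on S (Hk_fun l lhat a b k)"
  unfolding Hk_eq by (rule continuous_on_fourier[OF rapid_Qh])

lemma Hk_bounded: "\<exists>C\<ge>0. \<forall>y. norm (Hk_fun l lhat a b k y) \<le> C"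
  unfolding Hk_eq
  by (intro exI[of _ "LINT \<xi>|lborel. norm (Qh k \<xi> * exp (- P \<xi>))"] conjI allI fourier_norm_le rapid_integrable rapid_Qh)
    (intro integral_nonneg_AE AE_I2 norm_ge_zero)

lemma Hk_zero: "1 \<le> k \<Longrightarrow> k < M \<Longrightarrow> Hk_fun l lhat a b k y = 0"
  unfolding Hk_eq using exp_polys_zero[of k] by (simp add: fourier_def)

text \<open>Outside the cube the truncated exponential is zero, and the expansion itself has to be
  small. There \<open>s * (1 + norm \<xi>) \<ge> 1\<close>, so its power \<open>Suc K\<close> can be
  inserted as a factor: the missing power of \<open>s\<close> is bought with polynomial growth,
  which the exponential absorbs.\<close>

lemma truncated_symbol_expansion:
  assumes "S > 0"
  shows "\<exists>C\<ge>0. \<exists>N. \<forall>s\<in>{0<..S}. \<forall>\<xi>.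
     norm (complex_of_real (indicator (cube (pi / s)) \<xi>) * exp (- B s \<xi>) - exp (- P \<xi>) * (\<Sum>m\<le>K. complex_of_real s ^ m * Qh m \<xi>))
       \<le> C * s ^ Suc K * ((1 + norm \<xi>) ^ N * exp (- c0 * norm \<xi> ^ l))"
proof -
  obtain C N where C: "C \<ge> 0" and inside: "\<And>s \<xi>. s \<in> {0<..S} \<Longrightarrow> \<xi> \<in> cube (pi / s) \<Longrightarrow>
     norm (exp (- B s \<xi>) - exp (- P \<xi>) * (\<Sum>m\<le>K. complex_of_real s ^ m * Qh m \<xi>))
       \<le> C * s ^ Suc K * (1 + norm \<xi>) ^ N * exp (- c0 * norm \<xi> ^ l)"
    using exp_polys_expansion(2)[OF assms, of K] by blast
  have "poly_expansion 0 (\<lambda>s \<xi>. \<Sum>m\<le>K. complex_of_real s ^ m * Qh m \<xi>)"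
    by (intro poly_expansion_sum poly_expansion_mult poly_expansion_s_power poly_expansion_polyfun polyfun_Qh)
  then obtain D J where D: "D \<ge> 0" "\<And>s \<xi>. s \<in> {0<..S} \<Longrightarrow> norm (\<Sum>m\<le>K. complex_of_real s ^ m * Qh m \<xi>) \<le> D * (1 + norm \<xi>) ^ J"
    by (rule poly_expansion_0E[where S = S]) auto
  have "norm (complex_of_real (indicator (cube (pi / s)) \<xi>) * exp (- B s \<xi>) - exp (- P \<xi>) * (\<Sum>m\<le>K. complex_of_real s ^ m * Qh m \<xi>))
       \<le> (C + D) * s ^ Suc K * ((1 + norm \<xi>) ^ (N + J + Suc K) * exp (- c0 * norm \<xi> ^ l))"
    if s: "s \<in> {0<..S}" for s \<xi>
  proof (cases "\<xi> \<in> cube (pi / s)")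
    case True
    have "norm (exp (- B s \<xi>) - exp (- P \<xi>) * (\<Sum>m\<le>K. complex_of_real s ^ m * Qh m \<xi>))
       \<le> C * s ^ Suc K * (1 + norm \<xi>) ^ N * exp (- c0 * norm \<xi> ^ l)" by (rule inside[OF s True])
    also have "\<dots> \<le> (C + D) * s ^ Suc K * (1 + norm \<xi>) ^ (N + J + Suc K) * exp (- c0 * norm \<xi> ^ l)"
      using C D(1) s by (intro mult_right_mono mult_mono power_increasing) auto
    finally show ?thesis using True by (simp add: mult.assoc)
  next
    case False
    have s0: "s > 0" using s by simp
    have "\<not> norm \<xi> \<le> pi / s" using False mem_cubeI by blast
    then have "pi \<le> s * norm \<xi>" using s0 by (simp add: field_simps)
    then have "1 \<le> s * (1 + norm \<xi>)" using s0 pi_ge_two by (simp add: distrib_left)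
    then have 1: "1 \<le> s ^ Suc K * (1 + norm \<xi>) ^ Suc K"
      unfolding power_mult_distrib[symmetric] by (rule one_le_power)
    have "norm (exp (- P \<xi>) * (\<Sum>m\<le>K. complex_of_real s ^ m * Qh m \<xi>)) \<le> exp (- c0 * norm \<xi> ^ l) * (D * (1 + norm \<xi>) ^ J)"
      unfolding norm_mult using c0(3)[of \<xi>] by (intro mult_mono D s) auto
    also have "\<dots> \<le> exp (- c0 * norm \<xi> ^ l) * (D * (1 + norm \<xi>) ^ J) * (s ^ Suc K * (1 + norm \<xi>) ^ Suc K)"
    proof -
      have "0 \<le> exp (- c0 * norm \<xi> ^ l) * (D * (1 + norm \<xi>) ^ J)" using D(1) by simp
      from mult_left_mono[OF 1 this] show ?thesis by (simp only: mult_1_right)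
    qed
    also have "\<dots> = D * s ^ Suc K * (1 + norm \<xi>) ^ (J + Suc K) * exp (- c0 * norm \<xi> ^ l)"
      by (simp add: power_add mult_ac)
    also have "\<dots> \<le> (C + D) * s ^ Suc K * (1 + norm \<xi>) ^ (N + J + Suc K) * exp (- c0 * norm \<xi> ^ l)"
      using C D(1) s0 by (intro mult_right_mono mult_mono power_increasing) auto
    finally show ?thesis using False by (simp add: mult.assoc)
  qed
  then show ?thesis using C D(1) by (intro exI[of _ "C + D"] conjI exI[of _ "N + J + Suc K"] ballI allI) auto
qed

text \<open>With \<open>\<theta> = s \<xi>\<close> and \<open>\<tau> = 1 / s ^ l\<close> the
  amplitude becomes the truncated exponential of the scaled symbol and the volume element gives
  \<open>s ^ d\<close>. Plane waves have modulus \<open>1\<close>, so integrating the majorant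
  bounds the error uniformly in \<open>y\<close>.\<close>

lemma G_expansion:
  assumes "S > 0"
  shows "\<exists>C\<ge>0. \<forall>s\<in>{0<..S}. \<forall>y.
     norm (G y (1 / s ^ l) - (\<Sum>m\<le>K. complex_of_real s ^ (CARD('d) + m) * Hk_fun l lhat a b m (s *\<^sub>R y))) \<le> C * s ^ (CARD('d) + Suc K)"
proof -
  obtain C N where C: "C \<ge> 0" and bound: "\<And>s \<xi>. s \<in> {0<..S} \<Longrightarrow>
     norm (complex_of_real (indicator (cube (pi / s)) \<xi>) * exp (- B s \<xi>) - exp (- P \<xi>) * (\<Sum>m\<le>K. complex_of_real s ^ m * Qh m \<xi>))
       \<le> C * s ^ Suc K * ((1 + norm \<xi>) ^ N * exp (- c0 * norm \<xi> ^ l))"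
    using truncated_symbol_expansion[OF assms, of K] by blast
  let ?J = "LINT \<xi>::real^'d|lborel. (1 + norm \<xi>) ^ N * exp (- c0 * norm \<xi> ^ l)"
  have J: "integrable lborel (\<lambda>\<xi>::real^'d. (1 + norm \<xi>) ^ N * exp (- c0 * norm \<xi> ^ l))"
    by (rule integrable_poly_exp_power[OF c0(1) l_pos])
  have J0: "?J \<ge> 0" by (intro integral_nonneg_AE AE_I2) auto
  have "norm (G y (1 / s ^ l) - (\<Sum>m\<le>K. complex_of_real s ^ (CARD('d) + m) * Hk_fun l lhat a b m (s *\<^sub>R y))) \<le> (C * ?J) * s ^ (CARD('d) + Suc K)"
    if s: "s \<in> {0<..S}" for s y
  proof -
    have s0: "s > 0" using s by simp
    let ?f = "\<lambda>\<xi>. complex_of_real (indicator (cube (pi / s)) \<xi>) * exp (- B s \<xi>)"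
    let ?g = "\<lambda>\<xi>. \<Sum>m\<le>K. complex_of_real s ^ m * (Qh m \<xi> * exp (- P \<xi>))"
    have f: "integrable lborel ?f"
    proof (intro rapid_integrable rapid_cube[where C = 1])
      show "(\<lambda>\<xi>. exp (- B s \<xi>)) \<in> borel_measurable borel" unfolding scaled_symbol_def
        by (intro borel_measurable_continuous_onI continuous_intros) (use s0 in auto)
      fix \<xi> :: "real^'d" assume "\<xi> \<in> cube (pi / s)"
      from scaled_symbol_lower_bound[OF s0 this] have "0 \<le> Re (B s \<xi>)"
        using c0(1) by (meson mult_nonneg_nonneg norm_ge_zero zero_le_power less_imp_le order.trans)
      then show "norm (exp (- B s \<xi>)) \<le> 1" by simp
    qed
    have g: "integrable lborel ?g"
      by (intro Bochner_Integration.integrable_sum integrable_mult_right rapid_integrable rapid_Qh)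
    have 1: "G y (1 / s ^ l) = complex_of_real s ^ CARD('d) * fourier ?f (s *\<^sub>R y)"
    proof -
      have "G y (1 / s ^ l) = complex_of_real s ^ CARD('d) *
          fourier (\<lambda>\<xi>. cut (s *\<^sub>R \<xi>) * exp (- complex_of_real (1 / s ^ l) * A (s *\<^sub>R \<xi>))) (s *\<^sub>R y)"
        unfolding G_def by (rule fourier_scale[OF _ s0]) measurable
      moreover have "cut (s *\<^sub>R \<xi>) = complex_of_real (indicator (cube (pi / s)) \<xi>)" for \<xi> :: "real^'d"
        using mem_cube_scale[OF s0, of \<xi> pi] by (simp add: indicator_def)
      moreover have "- complex_of_real (1 / s ^ l) * A (s *\<^sub>R \<xi>) = - B s \<xi>" for \<xi>
        by (simp add: scaled_symbol_def)
      ultimately show ?thesis by simp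
    qed
    have 2: "(\<Sum>m\<le>K. complex_of_real s ^ (CARD('d) + m) * Hk_fun l lhat a b m (s *\<^sub>R y)) = complex_of_real s ^ CARD('d) * fourier ?g (s *\<^sub>R y)"
    proof -
      have "fourier ?g (s *\<^sub>R y) = (\<Sum>m\<le>K. fourier (\<lambda>\<xi>. complex_of_real s ^ m * (Qh m \<xi> * exp (- P \<xi>))) (s *\<^sub>R y))"
        by (rule fourier_sum) (intro integrable_mult_right rapid_integrable rapid_Qh)
      then show ?thesis unfolding fourier_cmult Hk_eq[symmetric] by (simp add: sum_distrib_left power_add mult.assoc)
    qed
    have b: "norm (?f \<xi> - ?g \<xi>) \<le> C * s ^ Suc K * ((1 + norm \<xi>) ^ N * exp (- c0 * norm \<xi> ^ l))" for \<xi>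
    proof -
      have "?g \<xi> = exp (- P \<xi>) * (\<Sum>m\<le>K. complex_of_real s ^ m * Qh m \<xi>)" by (simp only: sum_distrib_left mult_ac)
      then show ?thesis using bound[OF s, of \<xi>] by (simp only:)
    qed
    have "norm (fourier ?f (s *\<^sub>R y) - fourier ?g (s *\<^sub>R y)) \<le> (LINT \<xi>|lborel. norm (?f \<xi> - ?g \<xi>))"
      unfolding fourier_diff[OF f g] by (intro fourier_norm_le Bochner_Integration.integrable_diff f g)
    also have "\<dots> \<le> (LINT \<xi>::real^'d|lborel. C * s ^ Suc K * ((1 + norm \<xi>) ^ N * exp (- c0 * norm \<xi> ^ l)))"
      by (intro integral_mono integrable_norm Bochner_Integration.integrable_diff f g b integrable_mult_right J)
    also have "\<dots> = C * s ^ Suc K * ?J" by (rule integral_mult_right_zero)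
    finally have "s ^ CARD('d) * norm (fourier ?f (s *\<^sub>R y) - fourier ?g (s *\<^sub>R y)) \<le> s ^ CARD('d) * (C * s ^ Suc K * ?J)"
      using s0 by (intro mult_left_mono) auto
    moreover have "norm (G y (1 / s ^ l) - (\<Sum>m\<le>K. complex_of_real s ^ (CARD('d) + m) * Hk_fun l lhat a b m (s *\<^sub>R y))) =
        s ^ CARD('d) * norm (fourier ?f (s *\<^sub>R y) - fourier ?g (s *\<^sub>R y))"
      unfolding 1 2 right_diff_distrib[symmetric] norm_mult using s0 by (simp add: norm_power)
    moreover have "s ^ CARD('d) * (C * s ^ Suc K * ?J) = (C * ?J) * s ^ (CARD('d) + Suc K)" by (simp add: power_add mult_ac)
    ultimately show ?thesis by (simp only:)
  qed
  then show ?thesis using C J0 by (intro exI[of _ "C * ?J"] conjI ballI allI mult_nonneg_nonneg) auto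
qed

end

section \<open>The expansion of the remainder\<close>

lemma radial_integral:
  fixes h :: "real \<Rightarrow> complex"
  assumes h: "continuous_on {0..} h" and n: "n \<ge> 1"
  defines "I \<equiv> \<lambda>R. LINT \<rho>:{0..R}|lborel. complex_of_real \<rho> ^ (n - 1) * h \<rho>"
  shows "R > 0 \<Longrightarrow> (I has_vector_derivative complex_of_real R ^ (n - 1) * h R) (at R)"
    and "\<lbrakk>R > 0; \<And>\<rho>. norm (h \<rho>) \<le> C\<rbrakk> \<Longrightarrow> norm (I R) \<le> C * R ^ n"
proof -
  let ?f = "\<lambda>\<rho>. complex_of_real \<rho> ^ (n - 1) * h \<rho>"
  have cont: "continuous_on {0..R} ?f" for R
    by (intro continuous_intros continuous_on_subset[OF h]) auto
  have int: "set_integrable lborel {0..R} ?f" for R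
    by (rule borel_integrable_atLeastAtMost'[OF cont])
  have I_eq: "I = (\<lambda>R. integral {0..R} ?f)"
    unfolding I_def by (rule ext) (rule set_borel_integral_eq_integral(2)[OF int])
  show "(I has_vector_derivative ?f R) (at R)" if R: "R > 0"
  proof -
    have "((\<lambda>R. integral {0..R} ?f) has_vector_derivative ?f R) (at R within {0..R + 1})"
      by (rule integral_has_vector_derivative[OF cont]) (use R in auto)
    moreover have "R \<in> interior {0..R + 1}" by (rule interiorI[of "{0<..<R + 1}"]) (use R in auto)
    then have "at R within {0..R + 1} = at R" by (rule at_within_interior)
    ultimately show ?thesis by (simp add: I_eq)
  qed
  show "norm (I R) \<le> C * R ^ n" if R: "R > 0" and C: "\<And>\<rho>. norm (h \<rho>) \<le> C"
  proof -
    have "norm (integral {0..R} ?f) \<le> integral {0..R} (\<lambda>\<rho>. R ^ (n - 1) * C)"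
    proof (rule integral_norm_bound_integral)
      show "?f integrable_on {0..R}" by (rule set_borel_integral_eq_integral(1)[OF int])
      show "norm (?f \<rho>) \<le> R ^ (n - 1) * C" if "\<rho> \<in> {0..R}" for \<rho>
        using that C[of \<rho>] unfolding norm_mult norm_power norm_of_real by (intro mult_mono power_mono) auto
    qed auto
    also have "\<dots> = C * (R * R ^ (n - 1))" using R by simp
    also have "R * R ^ (n - 1) = R ^ n" using n by (cases n) auto
    finally show ?thesis by (simp add: I_eq)
  qed
qed

section \<open>Primitives in time of the terms of the expansion\<close>

context subcritical_scheme
begin

abbreviation "HK \<equiv> Hk_fun l lhat a b"
abbreviation "FK \<equiv> F_fun l lhat a b"

text \<open>The \<open>k\<close>-th term of the expansion for grid width \<open>1\<close>; writing
  the exponent as \<open>(d + k - l) / l\<close> makes the prefactor a natural power of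
  \<open>\<tau> powr (- 1 / l)\<close>.\<close>

definition Phi :: "nat \<Rightarrow> real^'d \<Rightarrow> real \<Rightarrow> complex" where
  "Phi k y \<tau> = 1 / complex_of_real (\<tau> powr (real (CARD('d) + k - l) / real l)) * FK k ((1 / \<tau> powr (1 / real l)) *\<^sub>R y)"

lemma powr_inverse_l:
  assumes "\<tau> > 0"
  shows "\<tau> powr (real n / real l) = (\<tau> powr (1 / real l)) ^ n"
    and "1 / \<tau> powr (1 / real l) = \<tau> powr (- 1 / real l)"
    and "1 / (\<tau> powr (- 1 / real l)) ^ l = \<tau>"
    and "(\<tau> powr (- 1 / real l)) ^ n = \<tau> powr (- real n / real l)"
    and "\<tau> powr (- 1 / real l - 1) = (\<tau> powr (- 1 / real l)) ^ Suc l"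
proof -
  show "\<tau> powr (real n / real l) = (\<tau> powr (1 / real l)) ^ n"
    using assms by (simp add: powr_power)
  show 2: "1 / \<tau> powr (1 / real l) = \<tau> powr (- 1 / real l)"
    by (simp add: powr_minus divide_inverse)
  show 4: "(\<tau> powr (- 1 / real l)) ^ n = \<tau> powr (- real n / real l)" for n
    using assms by (simp add: powr_power)
  have "(\<tau> powr (- 1 / real l)) ^ l = \<tau> powr (- 1)" unfolding 4 using l_pos by simp
  then have 5: "(\<tau> powr (- 1 / real l)) ^ l = 1 / \<tau>" using assms by (simp add: powr_minus divide_inverse)
  show "1 / (\<tau> powr (- 1 / real l)) ^ l = \<tau>" unfolding 5 by simp
  show "\<tau> powr (- 1 / real l - 1) = (\<tau> powr (- 1 / real l)) ^ Suc l"
    using assms unfolding power_Suc 5 by (simp add: powr_diff)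
qed

lemma Phi_zero:
  assumes "\<tau> > 0"
  shows "Phi k 0 \<tau> = - of_nat l / of_nat (CARD('d) + k - l) * HK k 0 * complex_of_real ((\<tau> powr (- 1 / real l)) ^ (CARD('d) + k - l))"
proof -
  have s: "complex_of_real ((\<tau> powr (- 1 / real l)) ^ n) = 1 / complex_of_real (\<tau> powr (1 / real l)) ^ n" for n
    unfolding powr_inverse_l(2)[OF assms, symmetric] by (simp only: power_one_over of_real_divide of_real_power of_real_1)
  show ?thesis
    unfolding Phi_def F_fun_def powr_inverse_l(1)[OF assms] s by (simp add: add.commute)
qed

text \<open>The time power in front cancels against the one contained in the radius, and the
  direction of \<open>y\<close> is unchanged by scaling. Time is left only in the upper limit of the
  integral, which makes the derivative accessible.\<close>

lemma Phi_nonzero: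
  assumes "\<tau> > 0" "y \<noteq> 0"
  shows "Phi k y \<tau> = - of_nat l / complex_of_real (norm y) ^ (CARD('d) + k - l) *
    (LINT \<rho>:{0..norm y * \<tau> powr (- 1 / real l)}|lborel. complex_of_real \<rho> ^ (CARD('d) + k - l - 1) * HK k (\<rho> *\<^sub>R ((1 / norm y) *\<^sub>R y)))"
proof -
  define \<sigma> where "\<sigma> = \<tau> powr (1 / real l)"
  have \<sigma>: "\<sigma> > 0" using assms(1) by (simp add: \<sigma>_def)
  define Y where "Y = (1 / \<sigma>) *\<^sub>R y"
  have Y: "Y \<noteq> 0" "norm Y = norm y / \<sigma>" "(1 / norm Y) *\<^sub>R Y = (1 / norm y) *\<^sub>R y"
    using assms(2) \<sigma> by (auto simp: Y_def)
  have s: "\<tau> powr (- 1 / real l) = 1 / \<sigma>" using powr_inverse_l(2)[OF assms(1)] by (simp add: \<sigma>_def)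
  have "Phi k y \<tau> = 1 / complex_of_real (\<sigma> ^ (CARD('d) + k - l)) * FK k Y"
    unfolding Phi_def powr_inverse_l(1)[OF assms(1)] \<sigma>_def Y_def ..
  also have "\<dots> = - of_nat l / complex_of_real (norm y) ^ (CARD('d) + k - l) *
    (LINT \<rho>:{0..norm Y}|lborel. complex_of_real \<rho> ^ (CARD('d) + k - l - 1) * HK k (\<rho> *\<^sub>R ((1 / norm Y) *\<^sub>R Y)))"
    unfolding F_fun_def using Y(1) \<sigma> by (simp add: Y(2) power_divide)
  finally have "Phi k y \<tau> = - of_nat l / complex_of_real (norm y) ^ (CARD('d) + k - l) *
    (LINT \<rho>:{0..norm Y}|lborel. complex_of_real \<rho> ^ (CARD('d) + k - l - 1) * HK k (\<rho> *\<^sub>R ((1 / norm Y) *\<^sub>R Y)))" .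
  moreover have "norm Y = norm y * \<tau> powr (- 1 / real l)" using Y(2) s by simp
  ultimately show ?thesis unfolding Y(3) by (simp only:)
qed

text \<open>For \<open>y \<noteq> 0\<close> the integral is at most a constant times its upper limit
  to the power \<open>d + k - l\<close>, and the powers of \<open>norm y\<close> cancel; for
  \<open>y = 0\<close> the formula is explicit.\<close>

lemma Phi_bound: "\<exists>C\<ge>0. \<forall>y. \<forall>\<tau>>0. norm (Phi k y \<tau>) \<le> C * (\<tau> powr (- 1 / real l)) ^ (CARD('d) + k - l)"
proof -
  obtain C where C: "C \<ge> 0" "\<And>y. norm (HK k y) \<le> C" using Hk_bounded by blast
  let ?n = "CARD('d) + k - l"
  have n: "?n \<ge> 1" using l_less by simp
  have "norm (Phi k y \<tau>) \<le> (real l * C) * (\<tau> powr (- 1 / real l)) ^ ?n" if \<tau>: "\<tau> > 0" for y \<tau>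
  proof (cases "y = 0")
    case True
    have "norm (Phi k y \<tau>) = real l / real ?n * norm (HK k 0) * (\<tau> powr (- 1 / real l)) ^ ?n"
      unfolding True Phi_zero[OF \<tau>] by (simp add: norm_mult norm_divide norm_power)
    also have "\<dots> \<le> real l * C * (\<tau> powr (- 1 / real l)) ^ ?n"
    proof (intro mult_right_mono mult_mono C)
      have div_le: "u / w \<le> u" if "0 \<le> u" "1 \<le> w" for u w :: real
        using that by (simp add: divide_le_eq mult_le_cancel_left1)
      have "1 \<le> real ?n" using of_nat_mono[OF n, where 'a = real] by (simp only: of_nat_1)
      then show "real l / real ?n \<le> real l" by (rule div_le[OF of_nat_0_le_iff])
    qed auto
    finally show ?thesis .
  next
    case False
    let ?R = "norm y * \<tau> powr (- 1 / real l)"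
    have "norm (LINT \<rho>:{0..?R}|lborel. complex_of_real \<rho> ^ (?n - 1) * HK k (\<rho> *\<^sub>R ((1 / norm y) *\<^sub>R y))) \<le> C * ?R ^ ?n"
    proof (rule radial_integral(2)[OF _ n])
      have "continuous_on {0..} (HK k \<circ> (\<lambda>\<rho>. \<rho> *\<^sub>R ((1 / norm y) *\<^sub>R y)))"
        by (intro continuous_on_compose Hk_continuous continuous_intros)
      then show "continuous_on {0..} (\<lambda>\<rho>. HK k (\<rho> *\<^sub>R ((1 / norm y) *\<^sub>R y)))" by (simp add: o_def)
      show "?R > 0" using False \<tau> by simp
    qed (rule C)
    then have "norm (Phi k y \<tau>) \<le> real l / norm y ^ ?n * (C * ?R ^ ?n)"
      unfolding Phi_nonzero[OF \<tau> False] norm_mult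
      by (intro mult_mono) (auto simp: norm_divide norm_power)
    also have "\<dots> = (real l * C) * (\<tau> powr (- 1 / real l)) ^ ?n"
      using False by (simp add: power_mult_distrib)
    finally show ?thesis .
  qed
  then show ?thesis using C(1) by (intro exI[of _ "real l * C"]) auto
qed

lemma s_tendsto_0: "((\<lambda>\<tau>. \<tau> powr (- 1 / real l)) \<longlongrightarrow> 0) at_top"
  using l_pos by (intro tendsto_neg_powr filterlim_ident) auto

lemma Phi_tendsto_0: "(Phi k y \<longlongrightarrow> 0) at_top"
proof -
  obtain C where C: "\<And>\<tau>. \<tau> > 0 \<Longrightarrow> norm (Phi k y \<tau>) \<le> C * (\<tau> powr (- 1 / real l)) ^ (CARD('d) + k - l)"
    using Phi_bound by blast
  show ?thesis
  proof (rule Lim_null_comparison)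
    show "\<forall>\<^sub>F \<tau> in at_top. norm (Phi k y \<tau>) \<le> C * (\<tau> powr (- 1 / real l)) ^ (CARD('d) + k - l)"
      using eventually_gt_at_top[of 0] by eventually_elim (rule C)
    have "((\<lambda>\<tau>. C * (\<tau> powr (- 1 / real l)) ^ (CARD('d) + k - l)) \<longlongrightarrow> C * 0 ^ (CARD('d) + k - l)) at_top"
      by (intro tendsto_intros s_tendsto_0)
    then show "((\<lambda>\<tau>. C * (\<tau> powr (- 1 / real l)) ^ (CARD('d) + k - l)) \<longlongrightarrow> 0) at_top"
      using l_less by (simp add: zero_power)
  qed
qed

lemma powr_has_derivative:
  assumes "\<tau> > 0"
  shows "((\<lambda>\<tau>. \<tau> powr p) has_vector_derivative p * \<tau> powr (p - 1)) (at \<tau>)"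
  using has_real_derivative_powr[OF assms, of p]
  by (simp add: has_real_derivative_iff_has_vector_derivative)

text \<open>For \<open>y \<noteq> 0\<close> the factor \<open>- l\<close> of \<open>F_fun\<close>
  cancels the \<open>- 1 / l\<close> from differentiating \<open>\<tau> powr (- 1 / l)\<close>, and
  the powers of \<open>s\<close> add up as \<open>(d + k - l - 1) + (l + 1) = d + k\<close>. At
  \<open>y = 0\<close> the constant \<open>- l / (d + k - l)\<close> cancels the exponent of the
  power of \<open>\<tau>\<close>.\<close>

lemma Phi_has_derivative:
  assumes \<tau>: "\<tau> > 0"
  defines "s \<equiv> \<tau> powr (- 1 / real l)"
  shows "(Phi k y has_vector_derivative complex_of_real s ^ (CARD('d) + k) * HK k (s *\<^sub>R y)) (at \<tau>)"
proof -
  let ?n = "CARD('d) + k - l"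
  have n: "?n \<ge> 1" using l_less by simp
  have nl: "?n + l = CARD('d) + k" using l_less by simp
  have s: "s > 0" using \<tau> by (simp add: s_def)
  \<comment> \<open>The formulas for \<open>Phi\<close> are known at positive times; agreement near
    \<open>\<tau>\<close> suffices to transfer the derivative.\<close>
  have ev: "\<forall>\<^sub>F u in nhds \<tau>. u > 0" using \<tau> by (intro eventually_nhds_in_open[of "{0<..}", simplified]) auto
  show ?thesis
  proof (cases "y = 0")
    case True
    let ?c = "- of_nat l / of_nat ?n * HK k 0"
    have "((\<lambda>u. complex_of_real (u powr (- real ?n / real l))) has_vector_derivative
        complex_of_real ((- real ?n / real l) * \<tau> powr (- real ?n / real l - 1))) (at \<tau>)"
      by (intro has_vector_derivative_of_real has_real_derivative_powr \<tau>)
    then have "((\<lambda>u. ?c * complex_of_real (u powr (- real ?n / real l))) has_vector_derivative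
        ?c * complex_of_real ((- real ?n / real l) * \<tau> powr (- real ?n / real l - 1))) (at \<tau>)"
      by (rule has_vector_derivative_mult_right)
    moreover have "?c * complex_of_real ((- real ?n / real l) * \<tau> powr (- real ?n / real l - 1)) =
        complex_of_real s ^ (CARD('d) + k) * HK k (s *\<^sub>R y)"
    proof -
      have "real (CARD('d) + k) / real l = real ?n / real l + 1"
        using l_pos nl by (simp add: field_simps flip: of_nat_add)
      then have "- real ?n / real l - 1 = - real (CARD('d) + k) / real l"
        unfolding minus_divide_left[symmetric] by linarith
      then have p: "\<tau> powr (- real ?n / real l - 1) = s ^ (CARD('d) + k)"
        unfolding s_def powr_inverse_l(4)[OF \<tau>] by (simp only:)
      have cancel: "- L / N * h * (- N / L) = h" if "L \<noteq> 0" "N \<noteq> 0" for L N h :: complex using that by simp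
      have c: "?c * complex_of_real (- real ?n / real l) = HK k 0"
        unfolding of_real_divide of_real_minus of_real_of_nat_eq
        by (rule cancel) (use n l_pos in \<open>simp_all only: of_nat_eq_0_iff\<close>)
      have "?c * complex_of_real ((- real ?n / real l) * \<tau> powr (- real ?n / real l - 1)) =
          HK k 0 * complex_of_real (s ^ (CARD('d) + k))"
        unfolding p by (simp only: of_real_mult c mult.assoc[symmetric])
      then show ?thesis unfolding True by (simp only: scaleR_zero_right of_real_power mult.commute)
    qed
    ultimately have "((\<lambda>u. ?c * complex_of_real (u powr (- real ?n / real l))) has_vector_derivative
        complex_of_real s ^ (CARD('d) + k) * HK k (s *\<^sub>R y)) (at \<tau>)" by simp
    then show ?thesis
    proof (rule has_vector_derivative_cong_ev[THEN iffD1, rotated -1])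
      show "\<forall>\<^sub>F u in nhds \<tau>. u \<in> UNIV \<longrightarrow> ?c * complex_of_real (u powr (- real ?n / real l)) = Phi k y u"
        using ev by eventually_elim (simp only: True Phi_zero powr_inverse_l(4) simp_thms)
      show "?c * complex_of_real (\<tau> powr (- real ?n / real l)) = Phi k y \<tau>"
        using \<tau> by (simp only: True Phi_zero powr_inverse_l(4))
    qed
  next
    case False
    define r where "r = norm y"
    have r: "r > 0" using False by (simp add: r_def)
    define h where "h = (\<lambda>\<rho>. HK k (\<rho> *\<^sub>R ((1 / r) *\<^sub>R y)))"
    define I where "I = (\<lambda>R. LINT \<rho>:{0..R}|lborel. complex_of_real \<rho> ^ (?n - 1) * h \<rho>)"
    have "continuous_on {0..} (HK k \<circ> (\<lambda>\<rho>. \<rho> *\<^sub>R ((1 / r) *\<^sub>R y)))"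
      by (intro continuous_on_compose Hk_continuous continuous_intros)
    then have h: "continuous_on {0..} h" by (simp add: h_def o_def)
    let ?c = "- of_nat l / complex_of_real r ^ ?n"
    have "((\<lambda>u. r * u powr (- 1 / real l)) has_vector_derivative r * (- 1 / real l * \<tau> powr (- 1 / real l - 1))) (at \<tau>)"
      by (intro has_vector_derivative_mult_right powr_has_derivative \<tau>)
    moreover have "(I has_vector_derivative complex_of_real (r * s) ^ (?n - 1) * h (r * s)) (at (r * \<tau> powr (- 1 / real l)))"
      unfolding I_def s_def by (rule radial_integral(1)[OF h n]) (use r \<tau> in simp)
    ultimately have "(I \<circ> (\<lambda>u. r * u powr (- 1 / real l)) has_vector_derivative
        (r * (- 1 / real l * \<tau> powr (- 1 / real l - 1))) *\<^sub>R (complex_of_real (r * s) ^ (?n - 1) * h (r * s))) (at \<tau>)"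
      by (rule vector_diff_chain_at)
    then have "((\<lambda>u. ?c * I (r * u powr (- 1 / real l))) has_vector_derivative
        ?c * ((r * (- 1 / real l * \<tau> powr (- 1 / real l - 1))) *\<^sub>R (complex_of_real (r * s) ^ (?n - 1) * h (r * s)))) (at \<tau>)"
      unfolding o_def by (rule has_vector_derivative_mult_right)
    moreover have "?c * ((r * (- 1 / real l * \<tau> powr (- 1 / real l - 1))) *\<^sub>R (complex_of_real (r * s) ^ (?n - 1) * h (r * s))) =
        complex_of_real s ^ (CARD('d) + k) * HK k (s *\<^sub>R y)"
    proof -
      have hs: "h (r * s) = HK k (s *\<^sub>R y)" using r by (simp add: h_def)
      have p: "\<tau> powr (- 1 / real l - 1) = s ^ Suc l" unfolding s_def by (rule powr_inverse_l(5)[OF \<tau>])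
      obtain j where j: "?n = Suc j" using n by (cases ?n) auto
      have jl: "CARD('d) + k = j + Suc l" using j nl by simp
      show ?thesis
        unfolding p hs j jl using r l_pos
        by (simp add: scaleR_conv_of_real power_add power_mult_distrib field_simps)
    qed
    ultimately have "((\<lambda>u. ?c * I (r * u powr (- 1 / real l))) has_vector_derivative
        complex_of_real s ^ (CARD('d) + k) * HK k (s *\<^sub>R y)) (at \<tau>)" by simp
    moreover have *: "?c * I (r * u powr (- 1 / real l)) = Phi k y u" if "u > 0" for u
      unfolding Phi_nonzero[OF that False] I_def h_def r_def ..
    ultimately show ?thesis
    proof (elim has_vector_derivative_cong_ev[THEN iffD1, rotated -1])
      show "\<forall>\<^sub>F u in nhds \<tau>. u \<in> UNIV \<longrightarrow> ?c * I (r * u powr (- 1 / real l)) = Phi k y u"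
        using ev by eventually_elim (simp only: * simp_thms)
      show "?c * I (r * \<tau> powr (- 1 / real l)) = Phi k y \<tau>" by (rule *[OF \<tau>])
    qed
  qed
qed

lemma remainder_bound:
  assumes "K \<ge> M" "t0 > 0"
  shows "\<exists>R\<ge>0. \<forall>y. \<forall>\<tau>\<ge>t0. norm (V y \<tau> - Omega l lhat a y - (\<Sum>k\<in>insert 0 {M..K}. Phi k y \<tau>)) \<le>
     R / \<tau> powr (real (CARD('d) + (K + 1) - l) / real l)"
proof -
  define q where "q = real (CARD('d) + (K + 1) - l) / real l"
  have q: "q > 0" using l_less l_pos by (simp add: q_def)
  \<comment> \<open>\<open>\<tau> \<ge> t0\<close> means that
    \<open>s = \<tau> powr (- 1 / l)\<close> is at most \<open>S\<close>.\<close>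
  define S where "S = t0 powr (- 1 / real l)"
  have S: "S > 0" using assms(2) by (simp add: S_def)
  obtain C where C: "C \<ge> 0" "\<And>s y. s \<in> {0<..S} \<Longrightarrow>
     norm (G y (1 / s ^ l) - (\<Sum>m\<le>K. complex_of_real s ^ (CARD('d) + m) * HK m (s *\<^sub>R y))) \<le> C * s ^ (CARD('d) + Suc K)"
    using G_expansion[OF S, of K] by blast
  \<comment> \<open>The expansion of \<open>G\<close> has all indices up to \<open>K\<close>, the
    claim only \<open>0\<close> and those from \<open>M\<close> on; the ones in between vanish with
    \<open>H_k\<close>.\<close>
  have sums: "(\<Sum>m\<le>K. complex_of_real s ^ (CARD('d) + m) * HK m z) = (\<Sum>m\<in>insert 0 {M..K}. complex_of_real s ^ (CARD('d) + m) * HK m z)" for s z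
  proof (rule sum.mono_neutral_right)
    show "\<forall>i\<in>{..K} - insert 0 {M..K}. complex_of_real s ^ (CARD('d) + i) * HK i z = 0"
    proof
      fix i assume "i \<in> {..K} - insert 0 {M..K}"
      then have "1 \<le> i" "i < M" by auto
      then show "complex_of_real s ^ (CARD('d) + i) * HK i z = 0" by (simp add: Hk_zero)
    qed
  qed (use assms in auto)
  have "norm (V y \<tau> - Omega l lhat a y - (\<Sum>k\<in>insert 0 {M..K}. Phi k y \<tau>)) \<le> (C / q) / \<tau> powr q"
    if \<tau>: "\<tau> \<ge> t0" for y \<tau>
  proof -
    define D where "D = (\<lambda>\<tau>. V y \<tau> - Omega l lhat a y - (\<Sum>k\<in>insert 0 {M..K}. Phi k y \<tau>))"
    define s where "s = (\<lambda>u. u powr (- 1 / real l))"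
    define D' where "D' = (\<lambda>u. G y u - (\<Sum>m\<in>insert 0 {M..K}. complex_of_real (s u) ^ (CARD('d) + m) * HK m (s u *\<^sub>R y)))"
    have D_der: "(D has_vector_derivative D' u) (at u)" if u: "u > 0" for u
    proof -
      have "u \<in> interior {0..}" by (rule interiorI[of "{0<..}"]) (use u in auto)
      then have "at u within {0..} = at u" by (rule at_within_interior)
      then have "(V y has_vector_derivative G y u) (at u)"
        using V_has_derivative[of u y] u by (simp only: less_imp_le)
      then have "((\<lambda>u. V y u - Omega l lhat a y) has_vector_derivative G y u - 0) (at u)"
        by (rule has_vector_derivative_diff) (rule has_vector_derivative_const)
      then have "((\<lambda>u. V y u - Omega l lhat a y - (\<Sum>k\<in>insert 0 {M..K}. Phi k y u)) has_vector_derivative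
          G y u - 0 - (\<Sum>m\<in>insert 0 {M..K}. complex_of_real (s u) ^ (CARD('d) + m) * HK m (s u *\<^sub>R y))) (at u)"
        unfolding s_def by (rule has_vector_derivative_diff) (intro has_vector_derivative_sum Phi_has_derivative u)
      then show ?thesis by (simp add: D_def D'_def)
    qed
    have D'_bound: "norm (D' u) \<le> C * u powr (- q - 1)" if u: "u \<ge> t0" for u
    proof -
      have u0: "u > 0" using u assms(2) by simp
      have "s u \<le> S" unfolding s_def S_def using u assms(2) by (intro powr_mono2') auto
      moreover have "s u > 0" using u0 by (simp add: s_def)
      moreover have "1 / s u ^ l = u" unfolding s_def by (rule powr_inverse_l(3)[OF u0])
      ultimately have "norm (D' u) \<le> C * s u ^ (CARD('d) + Suc K)"
        using C(2)[of "s u" y] unfolding sums D'_def by simp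
      also have "s u ^ (CARD('d) + Suc K) = u powr (- q - 1)"
      proof -
        have "real (CARD('d) + Suc K) / real l = q + 1"
          unfolding q_def using l_less l_pos by (simp add: of_nat_diff field_simps)
        then have "- real (CARD('d) + Suc K) / real l = - q - 1"
          unfolding minus_divide_left[symmetric] by linarith
        then show ?thesis unfolding s_def powr_inverse_l(4)[OF u0] by (simp only:)
      qed
      finally show ?thesis .
    qed
    have t0: "\<tau> > 0" using \<tau> assms(2) by simp
    have incr: "norm (D T - D \<tau>) \<le> (C / q) / \<tau> powr q" if T: "T > \<tau>" for T
    proof -
      \<comment> \<open>Comparison with the primitive \<open>- C / q * u powr (- q)\<close> of the
        bound for \<open>D'\<close>. It tends to \<open>0\<close> at infinity because
        \<open>q > 0\<close>, so the estimate does not depend on \<open>T\<close>.\<close>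
      have "norm (D T - D \<tau>) \<le> (- C / q) * T powr (- q) - (- C / q) * \<tau> powr (- q)"
      proof (rule differentiable_bound_general[OF T, where f' = D' and \<phi>' = "\<lambda>u. C * u powr (- q - 1)"])
        show "continuous_on {\<tau>..T} D"
          by (rule continuous_on_vector_derivative[OF has_vector_derivative_at_within[OF D_der]]) (use t0 in auto)
        show "continuous_on {\<tau>..T} (\<lambda>u. - C / q * u powr - q)"
          using t0 by (intro continuous_intros) auto
        show "((\<lambda>u. - C / q * u powr - q) has_vector_derivative C * u powr (- q - 1)) (at u)" if "\<tau> < u" for u
        proof -
          have "((\<lambda>u. - C / q * u powr - q) has_vector_derivative - C / q * (- q * u powr (- q - 1))) (at u)"
            using that t0 by (intro has_vector_derivative_mult_right powr_has_derivative) auto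
          then show ?thesis using q by simp
        qed
        show "norm (D' u) \<le> C * u powr (- q - 1)" if "\<tau> < u" for u using that \<tau> by (intro D'_bound) auto
        show "(D has_vector_derivative D' u) (at u)" if "\<tau> < u" for u using that t0 by (intro D_der) auto
      qed
      also have "\<dots> \<le> (C / q) / \<tau> powr q"
        using C(1) q by (simp add: powr_minus divide_inverse)
      finally show ?thesis .
    qed
    \<comment> \<open>\<open>D\<close> vanishes at infinity, so letting \<open>T\<close> tend to
      infinity in \<open>incr\<close> turns the bound for increments into a bound for
      \<open>D \<tau>\<close> itself.\<close>
    have "(D \<longlongrightarrow> Omega l lhat a y - Omega l lhat a y - (\<Sum>k\<in>insert 0 {M..K}. 0)) at_top"
      unfolding D_def by (intro tendsto_intros V_tendsto_Omega Phi_tendsto_0)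
    then have "((\<lambda>T. norm (D T - D \<tau>)) \<longlongrightarrow> norm (0 - D \<tau>)) at_top"
      by (intro tendsto_intros) simp
    moreover have "\<forall>\<^sub>F T in at_top. norm (D T - D \<tau>) \<le> (C / q) / \<tau> powr q"
      using eventually_gt_at_top[of \<tau>] by eventually_elim (rule incr)
    ultimately have "norm (0 - D \<tau>) \<le> (C / q) / \<tau> powr q"
      by (rule tendsto_upperbound) simp
    then show ?thesis unfolding D_def by (simp only: diff_0 norm_minus_cancel)
  qed
  then show ?thesis using C(1) q unfolding q_def[symmetric] by (intro exI[of _ "C / q"] conjI allI impI) auto
qed

lemma scaled_time_powr:
  assumes "\<epsilon> > 0" "t > 0"
  shows "(t / \<epsilon> ^ l) powr (real n / real l) = t powr (real n / real l) / \<epsilon> ^ n"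
proof -
  have "(\<epsilon> ^ l) powr (real n / real l) = \<epsilon> powr (real l * (real n / real l))"
    using assms by (simp add: powr_realpow[symmetric] powr_powr)
  also have "\<dots> = \<epsilon> ^ n" using assms l_pos by (simp add: powr_realpow)
  finally show ?thesis using assms by (simp add: powr_divide)
qed

lemma exponent_eq: "real (k + CARD('d)) / real l - 1 = real (CARD('d) + k - l) / real l"
  using l_less l_pos by (simp add: of_nat_diff field_simps)

text \<open>The time power contributes \<open>d + k - l\<close> powers of \<open>\<epsilon>\<close>,
  of which \<open>d - l\<close> cancel with the prefactor; in the space argument
  \<open>\<epsilon>\<close> cancels altogether.\<close>

lemma Phi_scaled:
  assumes "\<epsilon> > 0" "t > 0"
  shows "1 / complex_of_real \<epsilon> ^ (CARD('d) - l) * Phi k ((1 / \<epsilon>) *\<^sub>R x) (t / \<epsilon> ^ l) =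
    complex_of_real \<epsilon> ^ k / complex_of_real (t powr (real (k + CARD('d)) / real l - 1)) * FK k ((1 / t powr (1 / real l)) *\<^sub>R x)"
proof -
  have y: "(1 / (t / \<epsilon> ^ l) powr (1 / real l)) *\<^sub>R (1 / \<epsilon>) *\<^sub>R x = (1 / t powr (1 / real l)) *\<^sub>R x"
    using scaled_time_powr[OF assms, of 1] assms by simp
  have n: "CARD('d) + k - l = (CARD('d) - l) + k" using l_less by simp
  show ?thesis
    unfolding Phi_def y exponent_eq scaled_time_powr[OF assms]
    using assms by (simp add: n power_add)
qed

end

theorem theorem5p1:
  fixes l lhat M :: nat
    and b :: "'d::finite cpoly"
    and a :: "(nat^'d) \<times> (nat^'d) \<Rightarrow> complex"
    and v :: "real \<Rightarrow> real^'d \<Rightarrow> real \<Rightarrow> complex"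
  assumes "even l" and "l > 0"
    and "\<And>\<alpha>. \<alpha> \<in> Poly_Mapping.keys b \<Longrightarrow> msize \<alpha> = l"
    and "strongly_elliptic l b"
    and "l \<le> lhat"
    and "M \<ge> 1"
    and "approximates l lhat a b M"
    and "\<And>\<theta>. \<theta> \<in> cube pi - {0} \<Longrightarrow> Re (diff_symbol l lhat a \<theta>) > 0"
    and "\<And>\<epsilon>. \<epsilon> > 0 \<Longrightarrow> second_green l lhat a \<epsilon> (v \<epsilon>)"
    and "int l - int CARD('d) \<le> - 1"
  shows "\<exists>r R. \<forall>K\<ge>M. \<forall>t0>0. R K t0 \<ge> (0::real) \<and>
    (\<forall>\<epsilon>>0. \<forall>x\<in>grid \<epsilon>. \<forall>t\<ge>t0 * \<epsilon> ^ l.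
       v \<epsilon> x t =
         1 / complex_of_real \<epsilon> ^ (CARD('d) - l) * Omega l lhat a ((1 / \<epsilon>) *\<^sub>R x)
         + 1 / complex_of_real (t powr (real CARD('d) / real l - 1)) *
             F_fun l lhat a b 0 ((1 / t powr (1 / real l)) *\<^sub>R x)
         + (\<Sum>k=M..K. complex_of_real \<epsilon> ^ k
              / complex_of_real (t powr (real (k + CARD('d)) / real l - 1)) *
              F_fun l lhat a b k ((1 / t powr (1 / real l)) *\<^sub>R x))
         + r \<epsilon> K x t
       \<and> norm (r \<epsilon> K x t) \<le>
           \<epsilon> ^ (K + 1) * R K t0 / t powr (real (K + CARD('d) + 1) / real l - 1))"
proof -
  interpret subcritical_scheme l lhat M b a
    by unfold_locales (use assms in auto)
  define E where "E = (\<lambda>\<epsilon> K x t.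
         1 / complex_of_real \<epsilon> ^ (CARD('d) - l) * Omega l lhat a ((1 / \<epsilon>) *\<^sub>R x)
         + 1 / complex_of_real (t powr (real CARD('d) / real l - 1)) *
             FK 0 ((1 / t powr (1 / real l)) *\<^sub>R x)
         + (\<Sum>k=M..K. complex_of_real \<epsilon> ^ k
              / complex_of_real (t powr (real (k + CARD('d)) / real l - 1)) *
              FK k ((1 / t powr (1 / real l)) *\<^sub>R x)))"
  define good where "good = (\<lambda>K t0 R. R \<ge> (0::real) \<and> (\<forall>y. \<forall>\<tau>\<ge>t0. norm (V y \<tau> - Omega l lhat a y - (\<Sum>k\<in>insert 0 {M..K}. Phi k y \<tau>)) \<le>
     R / \<tau> powr (real (CARD('d) + (K + 1) - l) / real l)))"
  \<comment> \<open>A choice for each pair \<open>K\<close>, \<open>t0\<close>, made before the grid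
    width, the point and the time are fixed.\<close>
  define R where "R = (\<lambda>K t0. SOME R. good K t0 R)"
  have R: "good K t0 (R K t0)" if "K \<ge> M" "t0 > 0" for K t0
  proof -
    have "\<exists>R. good K t0 R" unfolding good_def using remainder_bound[OF that] by blast
    then show ?thesis unfolding R_def by (rule someI_ex)
  qed
  have bound: "norm (v \<epsilon> x t - E \<epsilon> K x t) \<le> \<epsilon> ^ (K + 1) * R K t0 / t powr (real (K + CARD('d) + 1) / real l - 1)"
    if K: "K \<ge> M" "t0 > 0" and \<epsilon>: "\<epsilon> > 0" and x: "x \<in> grid \<epsilon>" and t: "t \<ge> t0 * \<epsilon> ^ l" for K t0 \<epsilon> x t
  proof -
    have "0 < t0 * \<epsilon> ^ l" using K \<epsilon> by simp
    with t have t0: "t > 0" by linarith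
    define y \<tau> where "y = (1 / \<epsilon>) *\<^sub>R x" and "\<tau> = t / \<epsilon> ^ l"
    have \<tau>: "\<tau> \<ge> t0" using t \<epsilon> by (simp add: \<tau>_def pos_le_divide_eq)
    have "E \<epsilon> K x t = 1 / complex_of_real \<epsilon> ^ (CARD('d) - l) * Omega l lhat a y
        + 1 / complex_of_real \<epsilon> ^ (CARD('d) - l) * Phi 0 y \<tau>
        + (\<Sum>k=M..K. 1 / complex_of_real \<epsilon> ^ (CARD('d) - l) * Phi k y \<tau>)"
      unfolding E_def y_def \<tau>_def Phi_scaled[OF \<epsilon> t0] by simp
    also have "\<dots> = 1 / complex_of_real \<epsilon> ^ (CARD('d) - l) * (Omega l lhat a y + (\<Sum>k\<in>insert 0 {M..K}. Phi k y \<tau>))"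
      using M_pos by (simp add: distrib_left sum_distrib_left)
    finally have "v \<epsilon> x t - E \<epsilon> K x t = 1 / complex_of_real \<epsilon> ^ (CARD('d) - l) *
        (V y \<tau> - Omega l lhat a y - (\<Sum>k\<in>insert 0 {M..K}. Phi k y \<tau>))"
      using second_green_explicit[OF \<epsilon> assms(9)[OF \<epsilon>] x, of t] t0
      by (simp add: W_def y_def \<tau>_def right_diff_distrib distrib_left)
    then have "norm (v \<epsilon> x t - E \<epsilon> K x t) = 1 / \<epsilon> ^ (CARD('d) - l) *
        norm (V y \<tau> - Omega l lhat a y - (\<Sum>k\<in>insert 0 {M..K}. Phi k y \<tau>))"
      using \<epsilon> by (simp only: norm_mult norm_divide norm_power norm_of_real norm_one abs_of_pos)
    also have "\<dots> \<le> 1 / \<epsilon> ^ (CARD('d) - l) * (R K t0 / \<tau> powr (real (CARD('d) + (K + 1) - l) / real l))"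
      using R[OF K] \<tau> \<epsilon> unfolding good_def by (intro mult_left_mono) auto
    also have "\<dots> = \<epsilon> ^ (K + 1) * R K t0 / t powr (real (CARD('d) + (K + 1) - l) / real l)"
    proof -
      have n: "CARD('d) + (K + 1) - l = (CARD('d) - l) + (K + 1)" using l_less by simp
      have cancel: "1 / \<epsilon> ^ i * (u / (w / \<epsilon> ^ (i + j))) = \<epsilon> ^ j * u / w" for i j u w
        using \<epsilon> by (simp add: power_add)
      show ?thesis unfolding \<tau>_def scaled_time_powr[OF \<epsilon> t0] by (simp only: n cancel)
    qed
    also have "real (CARD('d) + (K + 1) - l) / real l = real (K + CARD('d) + 1) / real l - 1"
      unfolding exponent_eq[symmetric] by (simp add: ac_simps)
    finally show ?thesis .
  qed
  \<comment> \<open>The remainder is taken to be the difference itself, which makes the identity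
    trivial and the remainder independent of \<open>t0\<close>; the content lies in
    \<open>bound\<close>.\<close>
  show ?thesis
    unfolding E_def[symmetric]
  proof (intro exI[of _ "\<lambda>\<epsilon> K x t. v \<epsilon> x t - E \<epsilon> K x t"] exI[of _ R] allI impI conjI ballI)
    show "R K t0 \<ge> 0" if "M \<le> K" "0 < t0" for K t0 using R[OF that] by (simp add: good_def)
  qed (use bound in \<open>auto simp: E_def\<close>)
qed

end
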